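(* Let $n\ge1$, $n_1=2\lceil n/2\rceil-1$ and $n_2=2\lfloor n/2\rfloor+1$. The (unordered) collection of singular values of a $\mathrm{GUE}_n$ matrix has the same distribution as the collection of singular values of the direct sum $$\begin{pmatrix}\chi_{n_1}\\ \chi_{n_1-1}&\chi_{n_1-2}\\ &\ddots&\ddots\\ &&\chi_4&\chi_3\\ &&&\chi_2&\chi_1\end{pmatrix}\oplus\begin{pmatrix}\chi_{n_2}\\ \chi_{n_2-3}&\chi_{n_2-2}\\ &\ddots&\ddots\\ &&\chi_4&\chi_5\\ &&&\chi_2&\chi_3\end{pmatrix}$$ of two square lower bi-diagonal random matrices, all of whose displayed entries are independent chi-distributed random variables. Explicitly, the first block has order $p=\lceil n/2\rceil$, with $(i,i)$ entry distributed as $\chi_{2(p-i)+1}$ for $1\le i\le p$ and $(i+1,i)$ entry distributed as $\chi_{2(p-i)}$ for $1\le i\le p-1$. The second block has order $q=\lfloor n/2\rfloor$, with $(i,i)$ entry distributed as $\chi_{2(q-i)+3}$ for $1\le i\le q$ and $(i+1,i)$ entry distributed as $\chi_{2(q-i)}$ for $1\le i\le q-1$.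
   Context: $\mathrm{GUE}_n$ is the law of $\frac12(G+G^{\mathrm H})$, where $G$ is an $n\times n$ matrix whose entries have real and imaginary parts that are all independent standard normal, and $G^{\mathrm H}$ is the conjugate transpose. (So diagonal entries are standard normal, and the real and imaginary parts of entries above the diagonal are independent normals of mean $0$ and variance $\frac12$.) $\chi_k$ denotes a random variable having the chi distribution with $k$ degrees of freedom, with density proportional to $x^{k-1}e^{-x^2/2}$ on $(0,\infty)$. Unspecified matrix entries are zero. The second block is empty when $n=1$. *)

theory Defs
  imports
    "HOL-Probability.Probability"
    "HOL-Computational_Algebra.Computational_Algebra"
    "Jordan_Normal_Form.Schur_Decomposition"
begin

text \<open>
  Square matrices only: the eigenvalues of \<open>A\<^sup>H A\<close> are counted with algebraic
  multiplicity, and all of them are real and nonnegative.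
\<close>
definition singular_values :: "complex mat \<Rightarrow> real multiset" where
  "singular_values A = image_mset (\<lambda>z. sqrt (Re z)) (proots (char_poly (mat_adjoint A * A)))"

definition mat_borel :: "nat \<Rightarrow> complex mat measure" where
  "mat_borel n = sigma (carrier_mat n n)
     {{A \<in> carrier_mat n n. A $$ (i, j) \<in> B} | i j B. i < n \<and> j < n \<and> B \<in> sets borel}"

text \<open>
  Unordered collections carry the usual \<open>\<sigma>\<close>-algebra of point processes, generated by the
  numbers of points (with multiplicity) in Borel sets.
\<close>
definition mset_borel :: "real multiset measure" where
  "mset_borel = sigma UNIV
     {{S. size (filter_mset (\<lambda>x. x \<in> B) S) = k} | B k. B \<in> sets borel}"

definition gue :: "nat \<Rightarrow> complex mat measure" where
  "gue n =
    (let I = {..<n} \<times> {..<n};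
         \<N> = Pi\<^sub>M I (\<lambda>_. density lborel std_normal_density)
     in distr (\<N> \<Otimes>\<^sub>M \<N>) (mat_borel n)
          (\<lambda>(x, y). let G = mat n n (\<lambda>ij. Complex (x ij) (y ij))
                    in (1 / 2) \<cdot>\<^sub>m (G + mat_adjoint G)))"

text \<open>The constant is the value of the integral of \<open>x ^ (k - 1) * exp (- x\<^sup>2 / 2)\<close> over \<open>x > 0\<close>.\<close>
definition chi_density :: "nat \<Rightarrow> real \<Rightarrow> real" where
  "chi_density k x =
    (if x > 0
     then x ^ (k - 1) * exp (- x\<^sup>2 / 2) / (2 powr (real k / 2 - 1) * Gamma (real k / 2))
     else 0)"

text \<open>Positions are 1-based here, in contrast to the 0-based indexing of \<^const>\<open>mat\<close>.\<close>
definition bidiag_positions :: "nat \<Rightarrow> (nat \<times> nat) set" where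
  "bidiag_positions m = {(i, i) | i. 1 \<le> i \<and> i \<le> m} \<union> {(i + 1, i) | i. 1 \<le> i \<and> i < m}"

definition bidiag :: "nat \<Rightarrow> (nat \<times> nat \<Rightarrow> real) \<Rightarrow> complex mat" where
  "bidiag m x = mat m m (\<lambda>(i, j).
     if (i + 1, j + 1) \<in> bidiag_positions m then complex_of_real (x (i + 1, j + 1)) else 0)"

definition mat_direct_sum :: "complex mat \<Rightarrow> complex mat \<Rightarrow> complex mat" where
  "mat_direct_sum A B =
     four_block_mat A (0\<^sub>m (dim_row A) (dim_col B)) (0\<^sub>m (dim_row B) (dim_col A)) B"

end

theory Submission
  imports Defs "HOL-Library.Poly_Mapping"
begin

text \<open>
  The law of a random multiset of \<open>n\<close> nonnegative numbers is determined by the joint moments of its even power sums,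
  provided these do not grow too fast. For the singular values of a GUE matrix the moments satisfy the loop
  equations, obtained by Gaussian integration by parts, which have a unique solution up to normalisation. The
  expectations against a product of normal laws weighted by the squared Vandermonde determinant solve the same
  equations; they are Hankel sums, and since odd normal moments vanish, they factor into the Hankel sums of the two
  Laguerre weights \<open>x\<close> to the power \<open>\<plusminus> 1 / 2\<close> times \<open>exp (- x / 2)\<close>. The Laguerre sums are in turn characterised by loop equations,
  so it suffices to verify these for the Gram matrix of each bidiagonal chi matrix. They come from integration by
  parts along vector fields on bidiagonal matrices which change the Gram matrix \<open>L\<close> by \<open>2 L\<^sup>k\<^sup>+\<^sup>1\<close> up to a commutator; the fields
  for \<open>k \<le> 2\<close> are explicit, and the Virasoro relations produce the others. No joint density of singular values is needed.
\<close>

section \<open>Formal polynomials and formal expectations\<close>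

text \<open>Between the moment recursions of single variables and the joint moments everything is
  algebra over formal polynomials, because \<open>expect\<close> asks for a moment sequence and not
  for a measure. The even normal moments, read as \<open>cnormal_moment (2 * m)\<close> and
  \<open>cnormal_moment (2 * m + 2)\<close>, can therefore act as the two Laguerre weights although
  no Laguerre variable is constructed. The ratios of their successive terms, 1 + 2 m and 3 + 2 m,
  are the origin of the parameters \<open>a = 1\<close> and \<open>a = 3\<close>, hence of the
  degrees of freedom of the two blocks. The loop equations are linear and fix moments only up to a
  scalar. The scalar is removed by the nonvanishing Hankel determinant of the normal moments, where
  the definiteness of the normal weight enters. The bracket of the fields of index 1 and k carries
  the factor k - 1, so the indices 0 and 1 never produce index 2, and that field must be exhibited.
  Its coefficients contain the nonlocal partial sums \<open>ss\<close>. Its divergence therefore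
  matches the loop equation only after telescoping, and the boundary term of these sums is what
  yields the square of the first power sum.\<close>

type_synonym 'i cpoly = "('i \<Rightarrow>\<^sub>0 nat) \<Rightarrow>\<^sub>0 complex"

text \<open>Common shape of differentiation, expectation and evaluation: additivity of all three
  reduces to additivity of \<open>h\<close> in the coefficient.\<close>

definition linear_ext :: "(('i \<Rightarrow>\<^sub>0 nat) \<Rightarrow> complex \<Rightarrow> 'b::comm_monoid_add) \<Rightarrow> 'i cpoly \<Rightarrow> 'b" where
  "linear_ext h f = (\<Sum>m\<in>Poly_Mapping.keys f. h m (Poly_Mapping.lookup f m))"

lemma linear_ext_add:
  assumes "\<And>m. h m 0 = 0" "\<And>m a b. h m (a + b) = h m a + h m b"
  shows "linear_ext h (f + g) = linear_ext h f + linear_ext h g"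
  unfolding linear_ext_def by (rule setsum_keys_plus_distrib) (use assms in auto)

lemma linear_ext_single: "h m 0 = 0 \<Longrightarrow> linear_ext h (Poly_Mapping.single m c) = h m c"
  unfolding linear_ext_def by (cases "c = 0") auto

lemma cpoly_induct [case_names single add]:
  assumes s: "\<And>m c. P (Poly_Mapping.single m c)"
    and a: "\<And>f g. P f \<Longrightarrow> P g \<Longrightarrow> P (f + g)"
  shows "P (f :: 'i cpoly)"
proof -
  have z: "P 0" using s[of 0 0] by simp
  have "P (\<Sum>m\<in>A. Poly_Mapping.single m (Poly_Mapping.lookup f m))" if "finite A" for A
    using that by induction (auto simp: z intro: a s)
  moreover have "(\<Sum>m\<in>Poly_Mapping.keys f. Poly_Mapping.single m (Poly_Mapping.lookup f m)) = f"
    by (rule poly_mapping_eqI)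
      (simp add: lookup_sum lookup_single when_def sum.delta in_keys_iff)
  ultimately show ?thesis by (metis finite_keys)
qed

definition Var :: "'i \<Rightarrow> 'i cpoly" where
  "Var i = Poly_Mapping.single (Poly_Mapping.single i 1) 1"

definition Cst :: "complex \<Rightarrow> 'i cpoly" where
  "Cst c = Poly_Mapping.single 0 c"

text \<open>Subtraction of exponents is truncated; it can truncate only where the factor
  \<open>Poly_Mapping.lookup m i\<close> makes the new coefficient zero.\<close>

definition pd :: "'i \<Rightarrow> 'i cpoly \<Rightarrow> 'i cpoly" where
  "pd i = linear_ext (\<lambda>m c. Poly_Mapping.single (m - Poly_Mapping.single i 1)
            (of_nat (Poly_Mapping.lookup m i) * c))"

text \<open>Linear functional with \<open>\<mu> i e\<close> in the role of the \<open>e\<close>-th moment of the \<open>i\<close>-th of independent variables;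
  it need not come from a measure.\<close>
definition expect :: "('i \<Rightarrow> nat \<Rightarrow> complex) \<Rightarrow> 'i cpoly \<Rightarrow> complex" where
  "expect \<mu> = linear_ext (\<lambda>m c. c * (\<Prod>i\<in>Poly_Mapping.keys m. \<mu> i (Poly_Mapping.lookup m i)))"

definition peval :: "('i \<Rightarrow> complex) \<Rightarrow> 'i cpoly \<Rightarrow> complex" where
  "peval z = linear_ext (\<lambda>m c. c * (\<Prod>i\<in>Poly_Mapping.keys m. z i ^ Poly_Mapping.lookup m i))"

lemma pd_add: "pd i (f + g) = pd i f + pd i g"
  unfolding pd_def by (rule linear_ext_add) (auto simp: algebra_simps single_add)

lemma expect_add: "expect \<mu> (f + g) = expect \<mu> f + expect \<mu> g"
  unfolding expect_def by (rule linear_ext_add) (auto simp: algebra_simps)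

lemma peval_add: "peval z (f + g) = peval z f + peval z g"
  unfolding peval_def by (rule linear_ext_add) (auto simp: algebra_simps)

lemma pd_single: "pd i (Poly_Mapping.single m c) =
    Poly_Mapping.single (m - Poly_Mapping.single i 1) (of_nat (Poly_Mapping.lookup m i) * c)"
  unfolding pd_def by (rule linear_ext_single) auto

lemma prod_keys_superset:
  assumes "finite K" "Poly_Mapping.keys m \<subseteq> K" "\<And>i. g i 0 = (1::complex)"
  shows "(\<Prod>i\<in>Poly_Mapping.keys m. g i (Poly_Mapping.lookup m i)) = (\<Prod>i\<in>K. g i (Poly_Mapping.lookup m i))"
  by (rule prod.mono_neutral_left) (use assms in \<open>auto simp: in_keys_iff\<close>)

lemma expect_single:
  assumes "finite K" "Poly_Mapping.keys m \<subseteq> K" "\<And>i. \<mu> i 0 = 1"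
  shows "expect \<mu> (Poly_Mapping.single m c) = c * (\<Prod>i\<in>K. \<mu> i (Poly_Mapping.lookup m i))"
  using prod_keys_superset[of K m \<mu>] assms unfolding expect_def by (subst linear_ext_single) auto

lemma peval_single:
  assumes "finite K" "Poly_Mapping.keys m \<subseteq> K"
  shows "peval z (Poly_Mapping.single m c) = c * (\<Prod>i\<in>K. z i ^ Poly_Mapping.lookup m i)"
  using prod_keys_superset[of K m "\<lambda>i k. z i ^ k"] assms unfolding peval_def by (subst linear_ext_single) auto

lemma single_shift:
  "of_nat (Poly_Mapping.lookup m i) \<noteq> (0::complex) \<Longrightarrow>
    m - Poly_Mapping.single i 1 + m' = m + m' - Poly_Mapping.single i (1::nat)"
  by (rule poly_mapping_eqI) (auto simp: lookup_add lookup_minus lookup_single when_def)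

lemma pd_mult: "pd i (f * g) = pd i f * g + f * pd i g"
proof (induction f rule: cpoly_induct)
  case (single m c)
  show ?case
  proof (induction g rule: cpoly_induct)
    case (single m' c')
    have 1: "pd i (Poly_Mapping.single m c) * Poly_Mapping.single m' c' =
       Poly_Mapping.single (m + m' - Poly_Mapping.single i 1) (of_nat (Poly_Mapping.lookup m i) * c * c')"
      by (cases "Poly_Mapping.lookup m i = 0")
        (use single_shift[of m i m'] in \<open>auto simp: pd_single mult_single\<close>)
    have 2: "Poly_Mapping.single m c * pd i (Poly_Mapping.single m' c') =
       Poly_Mapping.single (m + m' - Poly_Mapping.single i 1) (of_nat (Poly_Mapping.lookup m' i) * c * c')"
      by (cases "Poly_Mapping.lookup m' i = 0")
        (use single_shift[of m' i m] in \<open>auto simp: pd_single mult_single add.commute mult.commute mult.left_commute\<close>)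
    show ?case unfolding 1 2
      by (simp add: mult_single pd_single lookup_add algebra_simps flip: single_add)
  qed (simp add: pd_add algebra_simps)
qed (simp add: pd_add algebra_simps)

lemma peval_mult: "peval z (f * g) = peval z f * peval z g"
proof (induction f rule: cpoly_induct)
  case (single m c)
  show ?case
  proof (induction g rule: cpoly_induct)
    case (single m' c')
    let ?K = "Poly_Mapping.keys m \<union> Poly_Mapping.keys m'"
    have "Poly_Mapping.keys (m + m') \<subseteq> ?K" by (rule keys_add)
    then show ?case
      by (simp add: mult_single peval_single[of ?K] lookup_add power_add prod.distrib)
  qed (simp add: peval_add algebra_simps)
qed (simp add: peval_add algebra_simps)

lemma peval_Cst [simp]: "peval z (Cst c) = c"
  unfolding Cst_def by (subst peval_single[of "{}"]) auto

lemma peval_Var [simp]: "peval z (Var i) = z i"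
  unfolding Var_def by (subst peval_single[of "{i}"]) auto

lemma Cst_0 [simp]: "Cst 0 = 0" and Cst_1 [simp]: "Cst 1 = 1"
  by (auto simp: Cst_def)

lemma Cst_of_nat: "Cst (of_nat n) = of_nat n"
  by (simp add: Cst_def)

lemma Cst_mult: "Cst (a * b) = Cst a * Cst b"
  by (simp add: Cst_def mult_single)

lemma Cst_minus: "Cst (- a) = - Cst a"
  by (simp add: Cst_def single_uminus)

lemma peval_0 [simp]: "peval z 0 = 0" and peval_1 [simp]: "peval z 1 = 1"
  using peval_Cst[of z 0] peval_Cst[of z 1] by simp_all

interpretation peval: comm_ring_hom "peval z"
  by unfold_locales (auto simp: peval_add peval_mult)

lemma pd_Cst [simp]: "pd i (Cst c) = 0"
  by (simp add: Cst_def pd_single)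

lemma pd_Var: "pd i (Var j) = (if i = j then 1 else 0)"
  by (auto simp: Var_def pd_single lookup_single when_def)

lemma expect_Cst_mult: "expect \<mu> (Cst c * f) = c * expect \<mu> f"
proof (induction f rule: cpoly_induct)
  case (single m d)
  show ?case by (simp add: Cst_def mult_single expect_def linear_ext_single)
qed (simp add: expect_add algebra_simps)

lemma expect_0 [simp]: "expect \<mu> 0 = 0"
  using expect_Cst_mult[of \<mu> 0 0] by simp

lemma expect_sum: "expect \<mu> (\<Sum>i\<in>A. f i) = (\<Sum>i\<in>A. expect \<mu> (f i))"
  by (induction A rule: infinite_finite_induct) (auto simp: expect_add)

lemma expect_uminus: "expect \<mu> (- f) = - expect \<mu> f"
  using expect_Cst_mult[of \<mu> "-1" f] by (simp add: Cst_minus)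

lemma expect_diff: "expect \<mu> (f - g) = expect \<mu> f - expect \<mu> g"
  using expect_add[of \<mu> f "-g"] by (simp add: expect_uminus)

lemma expect_of_nat_mult: "expect \<mu> (of_nat k * f) = of_nat k * expect \<mu> f"
  using expect_Cst_mult[of \<mu> "of_nat k" f] by (simp add: Cst_of_nat)

lemma Var_power: "Var i ^ k = Poly_Mapping.single (Poly_Mapping.single i k) 1"
  by (induction k) (auto simp: Var_def mult_single simp flip: single_add)

lemma prod_Var_power: "finite I \<Longrightarrow>
  (\<Prod>i\<in>I. Var i ^ e i) = Poly_Mapping.single (\<Sum>i\<in>I. Poly_Mapping.single i (e i)) 1"
  by (induction I rule: finite_induct) (auto simp: Var_power mult_single)

lemma expect_monomial:
  assumes "finite I" "\<And>i. \<mu> i 0 = 1"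
  shows "expect \<mu> (\<Prod>i\<in>I. Var i ^ e i) = (\<Prod>i\<in>I. \<mu> i (e i))"
proof -
  have l: "Poly_Mapping.lookup (\<Sum>i\<in>I. Poly_Mapping.single i (e i)) j = (if j \<in> I then e j else 0)" for j
    using assms(1) by (simp add: lookup_sum lookup_single when_def sum.delta)
  have "Poly_Mapping.keys (\<Sum>i\<in>I. Poly_Mapping.single i (e i)) \<subseteq> I"
    using l by (auto simp: in_keys_iff split: if_splits)
  then show ?thesis
    using assms by (simp add: prod_Var_power expect_single[of I] l)
qed

lemma expect_1: "(\<And>i. \<mu> i 0 = 1) \<Longrightarrow> expect \<mu> 1 = 1"
  using expect_monomial[of "{}" \<mu>] by simp

section \<open>Integration by parts derived from moment recursions\<close>

lemma Var_mult_pd_single: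
  "Var i * pd i (Poly_Mapping.single m c) = Poly_Mapping.single m (of_nat (Poly_Mapping.lookup m i) * c)"
proof (cases "Poly_Mapping.lookup m i = 0")
  case False
  then have "Poly_Mapping.single i 1 + (m - Poly_Mapping.single i 1) = m"
    by (intro poly_mapping_eqI) (auto simp: lookup_add lookup_minus lookup_single when_def)
  then show ?thesis by (simp add: pd_single Var_def mult_single)
qed (simp add: pd_single)

lemma expect_Var_power_single:
  assumes "\<And>j. \<mu> j 0 = 1"
  shows "expect \<mu> (Var i ^ k * Poly_Mapping.single m c) =
     c * \<mu> i (k + Poly_Mapping.lookup m i) * (\<Prod>j\<in>Poly_Mapping.keys m - {i}. \<mu> j (Poly_Mapping.lookup m j))"
proof -
  let ?K = "insert i (Poly_Mapping.keys m)"
  have "Poly_Mapping.keys (Poly_Mapping.single i k + m) \<subseteq> ?K"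
    using keys_add[of "Poly_Mapping.single i k" m] by (auto split: if_splits)
  then have "expect \<mu> (Var i ^ k * Poly_Mapping.single m c) =
      c * (\<Prod>j\<in>?K. \<mu> j (Poly_Mapping.lookup (Poly_Mapping.single i k + m) j))"
    by (simp add: Var_power mult_single expect_single[of ?K] assms del: prod.insert)
  also have "(\<Prod>j\<in>?K. \<mu> j (Poly_Mapping.lookup (Poly_Mapping.single i k + m) j)) =
      \<mu> i (k + Poly_Mapping.lookup m i) * (\<Prod>j\<in>Poly_Mapping.keys m - {i}. \<mu> j (Poly_Mapping.lookup m j))"
    by (subst prod.insert_remove, simp)
      (intro arg_cong2[where f = "(*)"] prod.cong, auto simp: lookup_add lookup_single when_def split: if_splits)
  finally show ?thesis by (simp add: mult.assoc)
qed

text \<open>Gaussian integration by parts. On a monomial it is the recursion for the moments of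
  variable \<open>i\<close>; when that variable is absent, it is the vanishing of the first
  moment.\<close>

lemma expect_Var_normal:
  assumes "\<And>j. \<mu> j 0 = 1" "\<mu> i 1 = 0" "\<And>e. \<mu> i (e + 2) = of_nat (e + 1) * \<mu> i e"
  shows "expect \<mu> (Var i * f) = expect \<mu> (pd i f)"
proof (induction f rule: cpoly_induct)
  case (single m c)
  note e = expect_Var_power_single[where \<mu> = \<mu> and i = i, OF assms(1)]
  show ?case
  proof (cases "Poly_Mapping.lookup m i")
    case 0
    then show ?thesis using e[of 1 m c] assms(2) by (simp add: pd_single)
  next
    case (Suc d)
    let ?m = "m - Poly_Mapping.single i 1"
    have 1: "Poly_Mapping.lookup ?m i = d" using Suc by (simp add: lookup_minus)
    have 2: "Poly_Mapping.lookup ?m j = Poly_Mapping.lookup m j" if "j \<noteq> i" for j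
      using that by (simp add: lookup_minus lookup_single when_def)
    have 3: "Poly_Mapping.keys ?m - {i} = Poly_Mapping.keys m - {i}"
      using 2 by (auto simp: in_keys_iff)
    have 4: "(\<Prod>j\<in>Poly_Mapping.keys m - {i}. \<mu> j (Poly_Mapping.lookup ?m j)) =
        (\<Prod>j\<in>Poly_Mapping.keys m - {i}. \<mu> j (Poly_Mapping.lookup m j))"
      by (rule prod.cong[OF refl], subst 2) auto
    show ?thesis
      using e[of 1 m c] e[of 0 ?m "of_nat (Suc d) * c"] assms(3)[of d] Suc 1 3 4
      by (simp add: pd_single)
  qed
qed (simp add: pd_add expect_add algebra_simps)

text \<open>One identity for two kinds of variables: a chi variable with k degrees of freedom has
  \<open>r = 2\<close>, \<open>a = k\<close>, \<open>b = 1\<close>, and a Laguerre weight has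
  \<open>r = 1\<close>, \<open>b = 2\<close>. The Euler operator \<open>Var i * pd i\<close> is
  diagonal on monomials, so the right-hand side multiplies each of them by the factor in the
  recursion.\<close>

lemma expect_Var_gamma:
  assumes "\<And>j. \<mu> j 0 = 1" "\<And>e. \<mu> i (e + r) = (a + b * of_nat e) * \<mu> i e"
  shows "expect \<mu> (Var i ^ r * f) = expect \<mu> (Cst a * f + Cst b * (Var i * pd i f))"
proof (induction f rule: cpoly_induct)
  case (single m c)
  note e = expect_Var_power_single[where \<mu> = \<mu> and i = i, OF assms(1)]
  show ?case
    using e[of r m c] e[of 0 m c] e[of 0 m "of_nat (Poly_Mapping.lookup m i) * c"]
      assms(2)[of "Poly_Mapping.lookup m i"]
    by (simp add: Var_mult_pd_single expect_add expect_Cst_mult add.commute algebra_simps)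
qed (simp add: pd_add expect_add algebra_simps)

lemma peval_single_restrict:
  fixes x :: "'i \<Rightarrow> real"
  assumes "finite K"
  shows "peval (\<lambda>i. if i \<in> K then of_real (x i) else 1) (Poly_Mapping.single mm c) =
    c * of_real (\<Prod>i\<in>K. x i ^ Poly_Mapping.lookup mm i)"
proof -
  have "(\<Prod>i\<in>K \<union> Poly_Mapping.keys mm. (if i \<in> K then of_real (x i) else 1) ^ Poly_Mapping.lookup mm i) =
      (\<Prod>i\<in>K. complex_of_real (x i) ^ Poly_Mapping.lookup mm i)"
    by (rule prod.mono_neutral_cong_right) (use assms in auto)
  then show ?thesis using assms by (simp add: peval_single[of "K \<union> Poly_Mapping.keys mm"])
qed

lemma expect_single_restrict:
  fixes n :: "'i \<Rightarrow> nat \<Rightarrow> real"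
  assumes "finite K" "\<And>i e. \<nu> i e = (if i \<in> K then of_real (n i e) else 1)" "\<And>i. \<nu> i 0 = 1"
  shows "expect \<nu> (Poly_Mapping.single mm c) = c * of_real (\<Prod>i\<in>K. n i (Poly_Mapping.lookup mm i))"
proof -
  have "(\<Prod>i\<in>K \<union> Poly_Mapping.keys mm. \<nu> i (Poly_Mapping.lookup mm i)) = (\<Prod>i\<in>K. complex_of_real (n i (Poly_Mapping.lookup mm i)))"
    by (rule prod.mono_neutral_cong_right) (use assms in auto)
  then show ?thesis using assms by (simp add: expect_single[of "K \<union> Poly_Mapping.keys mm"])
qed

text \<open>Bridge from formal to genuine expectations. Variables outside \<open>I\<close> are set
  to 1 and given moments 1, so no condition on the variables of \<open>f\<close> is
  required.\<close>

lemma has_bochner_integral_peval: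
  fixes Z :: "'i \<Rightarrow> 'w \<Rightarrow> real"
  assumes "finite I"
    and m: "\<And>e. has_bochner_integral P (\<lambda>\<omega>. \<Prod>i\<in>I. Z i \<omega> ^ e i) (\<Prod>i\<in>I. m i (e i))"
    and \<mu>: "\<And>i e. \<mu> i e = (if i \<in> I then of_real (m i e) else 1)"
    and \<mu>0: "\<And>i. \<mu> i 0 = 1"
  shows "has_bochner_integral P (\<lambda>\<omega>. peval (\<lambda>i. if i \<in> I then of_real (Z i \<omega>) else 1) f) (expect \<mu> f)"
proof (induction f rule: cpoly_induct)
  case (single mm c)
  show ?case
    unfolding peval_single_restrict[OF assms(1)] expect_single_restrict[where \<nu> = \<mu> and n = m, OF assms(1) \<mu> \<mu>0]
    by (intro has_bochner_integral_mult_right has_bochner_integral_of_real m)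
next
  case (add f g)
  then show ?case by (simp add: peval_add expect_add has_bochner_integral_add)
qed

section \<open>Point processes determined by moments of power sums\<close>

text \<open>Even powers of singular values are powers of eigenvalues of the Gram matrix, so these
  sums are traces and hence polynomials in the matrix entries.\<close>

definition even_psum :: "nat \<Rightarrow> real multiset \<Rightarrow> real" where
  "even_psum k S = (\<Sum>s\<in>#S. s ^ (2 * k))"

definition npoints :: "real set \<Rightarrow> real multiset \<Rightarrow> real" where
  "npoints B S = (\<Sum>s\<in>#S. indicator B s)"

lemma npoints_eq_size: "npoints B S = real (size (filter_mset (\<lambda>x. x \<in> B) S))"
  unfolding npoints_def by (induction S) (auto simp: indicator_def)

lemma tendsto_sum_mset:
  fixes g :: "nat \<Rightarrow> 'a \<Rightarrow> real"
  assumes "\<And>s. s \<in># S \<Longrightarrow> (\<lambda>m. g m s) \<longlonglongrightarrow> f s"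
  shows "(\<lambda>m. \<Sum>s\<in>#S. g m s) \<longlonglongrightarrow> (\<Sum>s\<in>#S. f s)"
  using assms by (induction S) (auto intro!: tendsto_add)

lemma sum_mset_nonneg_real: "(\<And>s. s \<in># S \<Longrightarrow> 0 \<le> f s) \<Longrightarrow> 0 \<le> (\<Sum>s\<in>#S. f s :: real)"
  by (induction S) auto

lemma npoints_nonneg: "0 \<le> npoints B S" and even_psum_nonneg: "0 \<le> even_psum k S"
  unfolding npoints_def even_psum_def by (auto intro: sum_mset_nonneg_real)

lemma npoints_le: "npoints B S \<le> real (size S)"
  unfolding npoints_eq_size by (simp add: size_filter_mset_lesseq)

lemma even_psum_0: "even_psum 0 S = real (size S)"
  unfolding even_psum_def by simp

text \<open>Each squared point is at most the sum of all squares. Hence the growth of the moments of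
  \<open>even_psum 1\<close> controls all other power sums.\<close>

lemma even_psum_le_power: "size S \<ge> 1 \<Longrightarrow> even_psum k S \<le> real (size S) * even_psum 1 S ^ k"
proof -
  assume n: "size S \<ge> 1"
  have le: "s ^ 2 \<le> even_psum 1 S" if sS: "s \<in># S" for s
  proof -
    obtain S' where S': "S = add_mset s S'" using multi_member_split[OF sS] by blast
    show ?thesis using even_psum_nonneg[of 1 S'] unfolding S' by (simp add: even_psum_def)
  qed
  have "(\<Sum>s\<in>#S. s ^ (2 * k)) \<le> (\<Sum>s\<in>#S. even_psum 1 S ^ k)"
    by (rule sum_mset_mono) (auto simp: power_mult intro!: power_mono le[simplified])
  then show ?thesis by (simp add: even_psum_def)
qed

lemma space_mset_borel [simp]: "space mset_borel = UNIV"
  unfolding mset_borel_def by simp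

lemma sets_mset_borel: "sets mset_borel = sigma_sets UNIV
    {{S. size (filter_mset (\<lambda>x. x \<in> B) S) = k} | B k. B \<in> sets borel}"
  unfolding mset_borel_def by (rule sets_measure_of) auto

lemma measurable_mset_borelI:
  assumes "\<And>B. B \<in> sets borel \<Longrightarrow> (\<lambda>\<omega>. npoints B (S \<omega>)) \<in> borel_measurable M"
  shows "S \<in> M \<rightarrow>\<^sub>M mset_borel"
  unfolding mset_borel_def
proof (rule measurable_measure_of)
  fix y assume "y \<in> {{S. size (filter_mset (\<lambda>x. x \<in> B) S) = k} | B k. B \<in> sets (borel :: real measure)}"
  then obtain B k where B: "B \<in> sets borel" and y: "y = {S. size (filter_mset (\<lambda>x. x \<in> B) S) = k}" by auto
  have "S -` y \<inter> space M = (\<lambda>\<omega>. npoints B (S \<omega>)) -` {real k} \<inter> space M"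
    unfolding y npoints_eq_size by auto
  also have "\<dots> \<in> sets M" by (rule measurable_sets[OF assms[OF B]]) auto
  finally show "S -` y \<inter> space M \<in> sets M" .
qed auto

lemma npoints_measurable [measurable]:
  assumes "B \<in> sets borel"
  shows "npoints B \<in> borel_measurable mset_borel"
proof -
  have "(\<lambda>S. size (filter_mset (\<lambda>x. x \<in> B) S)) \<in> mset_borel \<rightarrow>\<^sub>M count_space UNIV"
    by (subst measurable_count_space_eq2_countable)
      (use assms in \<open>auto simp: sets_mset_borel vimage_def intro!: sigma_sets.Basic\<close>)
  then have "(\<lambda>S. real (size (filter_mset (\<lambda>x. x \<in> B) S))) \<in> borel_measurable mset_borel"
    by measurable
  then show ?thesis by (simp add: npoints_eq_size[abs_def])
qed

text \<open>No measurable selection of individual points is made. Polynomials in the squared points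
  give continuous functions by Stone-Weierstrass, ramps give half lines, and complements and
  disjoint unions give all Borel sets.\<close>

lemma measurable_npoints_of_even_psum:
  assumes n: "\<And>\<omega>. \<omega> \<in> space M \<Longrightarrow> size (S \<omega>) = n"
    and pos: "\<And>\<omega> s. \<omega> \<in> space M \<Longrightarrow> s \<in># S \<omega> \<Longrightarrow> 0 \<le> s"
    and even_psum: "\<And>k. (\<lambda>\<omega>. even_psum k (S \<omega>)) \<in> borel_measurable M"
    and B: "B \<in> sets borel"
  shows "(\<lambda>\<omega>. npoints B (S \<omega>)) \<in> borel_measurable M"
proof -
  have poly: "(\<lambda>\<omega>. \<Sum>s\<in>#S \<omega>. g (s\<^sup>2)) \<in> borel_measurable M" if g: "real_polynomial_function g" for g :: "real \<Rightarrow> real"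
  proof -
    obtain a d where "g = (\<lambda>x. \<Sum>i\<le>d. a i * x ^ i)"
      using g by (auto simp: real_polynomial_function_iff_sum)
    then have "(\<Sum>s\<in>#X. g (s\<^sup>2)) = (\<Sum>i\<le>d. a i * even_psum i X)" for X
      by (induction X) (auto simp: even_psum_def sum.distrib algebra_simps simp flip: power_mult)
    then show ?thesis using even_psum by simp
  qed
  have cont: "(\<lambda>\<omega>. \<Sum>s\<in>#S \<omega>. f (s\<^sup>2)) \<in> borel_measurable M" if f: "continuous_on UNIV f" for f :: "real \<Rightarrow> real"
  proof -
    \<comment> \<open>Precision 1 / (m + 1) on the interval from -m to m: every fixed point
      eventually lies in the interval, which gives pointwise convergence on the whole line.\<close>
    have "\<exists>g. real_polynomial_function g \<and> (\<forall>x\<in>{-real m..real m}. \<bar>f x - g x\<bar> < 1 / real (Suc m))" for m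
      by (rule Stone_Weierstrass_real_polynomial_function[of "{- real m..real m}" f "1 / real (Suc m)"])
        (use f in \<open>auto intro: continuous_on_subset\<close>)
    then obtain g where g: "\<And>m. real_polynomial_function (g m)"
      and gf: "\<And>m x. \<bar>x\<bar> \<le> real m \<Longrightarrow> \<bar>f x - g m x\<bar> < 1 / real (Suc m)"
      by (metis abs_le_iff atLeastAtMost_iff minus_le_iff)
    have lim: "(\<lambda>m. g m x) \<longlonglongrightarrow> f x" for x
    proof (rule Lim_transform)
      show "(\<lambda>m. f x) \<longlonglongrightarrow> f x" by simp
      show "(\<lambda>m. g m x - f x) \<longlonglongrightarrow> 0"
      proof (rule tendsto_rabs_zero_cancel, rule tendsto_sandwich[where f = "\<lambda>_. 0" and h = "\<lambda>m. 1 / real (Suc m)"])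
        show "\<forall>\<^sub>F m in sequentially. \<bar>g m x - f x\<bar> \<le> 1 / real (Suc m)"
          using eventually_ge_at_top[of "nat \<lceil>\<bar>x\<bar>\<rceil>"]
        proof eventually_elim
          case (elim m)
          then have "\<bar>x\<bar> \<le> real m" by linarith
          from gf[OF this] show ?case by (simp add: abs_minus_commute)
        qed
        show "(\<lambda>m. 1 / real (Suc m)) \<longlonglongrightarrow> 0" by (rule LIMSEQ_Suc[OF lim_1_over_n])
      qed auto
    qed
    show ?thesis
      by (rule borel_measurable_LIMSEQ_real[OF tendsto_sum_mset[OF lim] poly[OF g]])
  qed
  \<comment> \<open>Ramps falling from 1 at \<open>c\<close> to 0 at \<open>c + 1 / m\<close>
    decrease to the indicator of the closed half line.\<close>
  have sq: "(\<lambda>\<omega>. \<Sum>s\<in>#S \<omega>. indicator {..c} (s\<^sup>2) :: real) \<in> borel_measurable M" for c :: real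
  proof (rule borel_measurable_LIMSEQ_real)
    show "(\<lambda>m. \<Sum>s\<in>#S \<omega>. max 0 (min 1 (1 - real m * (s\<^sup>2 - c)))) \<longlonglongrightarrow> (\<Sum>s\<in>#S \<omega>. indicator {..c} (s\<^sup>2))"
      for \<omega>
    proof (rule tendsto_sum_mset)
      fix s
      show "(\<lambda>m. max 0 (min 1 (1 - real m * (s\<^sup>2 - c)))) \<longlonglongrightarrow> indicator {..c} (s\<^sup>2)"
      proof (cases "s\<^sup>2 \<le> c")
        case True
        then have "max 0 (min 1 (1 - real m * (s\<^sup>2 - c))) = 1" for m
          by (simp add: mult_nonneg_nonpos)
        then show ?thesis using True by simp
      next
        case False
        have "\<forall>\<^sub>F m in sequentially. max 0 (min 1 (1 - real m * (s\<^sup>2 - c))) = 0"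
          using eventually_ge_at_top[of "nat \<lceil>1 / (s\<^sup>2 - c)\<rceil>"]
        proof eventually_elim
          case (elim m)
          then have "1 / (s\<^sup>2 - c) \<le> real m" by linarith
          then have "1 \<le> real m * (s\<^sup>2 - c)" using False by (simp add: field_simps)
          then show ?case by simp
        qed
        then show ?thesis using False by (simp add: tendsto_eventually)
      qed
    qed
    show "(\<lambda>\<omega>. \<Sum>s\<in>#S \<omega>. max 0 (min 1 (1 - real m * (s\<^sup>2 - c)))) \<in> borel_measurable M" for m
      by (rule cont) (intro continuous_intros)
  qed
  have half: "(\<lambda>\<omega>. npoints {..c} (S \<omega>)) \<in> borel_measurable M" for c
  proof -
    have "npoints {..c} (S \<omega>) = (if c < 0 then 0 else (\<Sum>s\<in>#S \<omega>. indicator {..c\<^sup>2} (s\<^sup>2)))" if "\<omega> \<in> space M" for \<omega>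
    proof -
      \<comment> \<open>A nonnegative point is at most \<open>c\<close> exactly when
        \<open>c\<close> is nonnegative and the squares compare in the same way.\<close>
      have "indicator {..c} s = (if c < 0 then 0 else indicator {..c\<^sup>2} (s\<^sup>2) :: real)" if "s \<in># S \<omega>" for s
        using pos[OF \<open>\<omega> \<in> space M\<close> that] by (auto simp: indicator_def abs_le_square_iff[symmetric])
      then have "npoints {..c} (S \<omega>) = (\<Sum>s\<in>#S \<omega>. if c < 0 then 0 else indicator {..c\<^sup>2} (s\<^sup>2))"
        unfolding npoints_def by (intro arg_cong[where f = sum_mset] image_mset_cong) auto
      then show ?thesis by (cases "c < 0") simp_all
    qed
    then show ?thesis using sq[of "c\<^sup>2"] by (simp cong: measurable_cong)
  qed
  have "B \<in> sigma_sets UNIV (range atMost)"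
    using B by (simp add: borel_eq_atMost)
  show ?thesis
  proof (rule sigma_sets_induct_disjoint[OF _ _ \<open>B \<in> sigma_sets UNIV (range atMost)\<close>])
    show "Int_stable (range (atMost :: real \<Rightarrow> _))" by (auto simp: Int_stable_def)
    show "(\<lambda>\<omega>. npoints A (S \<omega>)) \<in> borel_measurable M" if "A \<in> range atMost" for A
      using half that by auto
    show "(\<lambda>\<omega>. npoints {} (S \<omega>)) \<in> borel_measurable M" by (simp add: npoints_def)
    show "(\<lambda>\<omega>. npoints (UNIV - A) (S \<omega>)) \<in> borel_measurable M"
      if "(\<lambda>\<omega>. npoints A (S \<omega>)) \<in> borel_measurable M" for A
    proof -
      have "npoints (UNIV - A) X = real (size X) - npoints A X" for X
        unfolding npoints_def by (induction X) (auto simp: indicator_def)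
      then have "npoints (UNIV - A) (S \<omega>) = real n - npoints A (S \<omega>)" if "\<omega> \<in> space M" for \<omega>
        using n[OF that] by simp
      then show ?thesis using that by (simp cong: measurable_cong)
    qed
    show "(\<lambda>\<omega>. npoints (\<Union>i. A i) (S \<omega>)) \<in> borel_measurable M"
      if dis: "disjoint_family A" and m: "\<And>i. (\<lambda>\<omega>. npoints (A i) (S \<omega>)) \<in> borel_measurable M" for A :: "nat \<Rightarrow> real set"
    proof (rule borel_measurable_LIMSEQ_real)
      show "(\<lambda>m. \<Sum>i<m. npoints (A i) (S \<omega>)) \<longlonglongrightarrow> npoints (\<Union>i. A i) (S \<omega>)" for \<omega>
      proof -
        have ind: "(\<Sum>i<m. indicator (A i) s) = (indicator (\<Union>i<m. A i) s :: real)" for m s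
          by (rule indicator_UN_disjoint[symmetric]) (use dis in \<open>auto simp: disjoint_family_on_def\<close>)
        have "(\<Sum>i<m. npoints (A i) X) = (\<Sum>s\<in>#X. indicator (\<Union>i<m. A i) s)" for m X
          unfolding npoints_def by (induction X) (auto simp: sum.distrib ind)
        then show ?thesis
          unfolding npoints_def by (auto intro!: tendsto_sum_mset LIMSEQ_indicator_UN)
      qed
      show "(\<lambda>\<omega>. \<Sum>i<m. npoints (A i) (S \<omega>)) \<in> borel_measurable M" for m
        using m by auto
    qed
  qed auto
qed

section \<open>Determinacy of laws on the half line by even moments\<close>

lemma summable_fact_ratio:
  fixes a :: real assumes "0 \<le> a"
  shows "summable (\<lambda>k. a ^ k * fact (k + r) / fact (2 * k))"
\<comment> \<open>The ratio of consecutive terms is a (k + 1 + r) / ((2 k + 1) (2 k + 2)); from the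
  chosen index on, a (1 + r) is at most k, which bounds the ratio by 1/2.\<close>
proof (rule summable_ratio_test[where c = "1/2" and N = "nat \<lceil>a * (1 + real r)\<rceil>"])
  fix k assume "k \<ge> nat \<lceil>a * (1 + real r)\<rceil>"
  then have k: "a * (1 + real r) \<le> real k" by linarith
  have "a * (real k + 1 + real r) \<le> a * ((1 + real r) * (real k + 1))"
    using assms by (intro mult_left_mono) (auto simp: algebra_simps)
  also have "\<dots> \<le> real k * (real k + 1)"
    using k mult_right_mono[OF k, of "real k + 1"] by (simp add: mult.assoc)
  also have "\<dots> \<le> (2 * real k + 1) * (real k + 1)" by (intro mult_right_mono) auto
  finally have *: "a * (real k + 1 + real r) \<le> (2 * real k + 1) * (real k + 1)" .
  let ?t = "a ^ k * fact (k + r) / fact (2 * k)"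
  have t: "?t \<ge> 0" using assms by simp
  have f: "fact (2 * Suc k) = (2 * real k + 2) * ((2 * real k + 1) * fact (2 * k))"
    by (simp add: algebra_simps)
  have "a ^ Suc k * fact (Suc k + r) / fact (2 * Suc k) =
      ?t * (a * (real k + 1 + real r) / ((2 * real k + 1) * (2 * real k + 2)))"
    unfolding f by (simp add: field_simps)
  also have "\<dots> \<le> ?t * (1 / 2)"
  proof (rule mult_left_mono[OF _ t])
    have "0 < (2 * real k + 1) * (2 * real k + 2)" by simp
    then show "a * (real k + 1 + real r) / ((2 * real k + 1) * (2 * real k + 2)) \<le> 1 / 2"
      by (subst pos_divide_le_eq) (use * in \<open>auto simp: algebra_simps\<close>)
  qed
  finally have "a ^ Suc k * fact (Suc k + r) / fact (2 * Suc k) \<le> ?t * (1 / 2)" .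
  moreover have "a ^ Suc k * fact (Suc k + r) / fact (2 * Suc k) \<ge> 0" using assms by simp
  ultimately show "norm (a ^ Suc k * fact (Suc k + r) / fact (2 * Suc k)) \<le> 1 / 2 * norm ?t"
    using t by (metis abs_of_nonneg mult.commute real_norm_def)
qed simp

text \<open>The cosine series contains even powers only, so the absolute values of its terms have
  even moments as expectations, and the summability hypothesis is exactly what termwise integration
  needs.\<close>

lemma (in prob_space) expectation_cos:
  fixes X :: "'a \<Rightarrow> real"
  assumes X [measurable]: "random_variable borel X"
    and i: "\<And>k. integrable M (\<lambda>\<omega>. X \<omega> ^ (2 * k))"
    and s: "summable (\<lambda>k. t ^ (2 * k) / fact (2 * k) * expectation (\<lambda>\<omega>. X \<omega> ^ (2 * k)))"
  shows "expectation (\<lambda>\<omega>. cos (t * X \<omega>)) =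
    suminf (\<lambda>k. (- 1) ^ k * (t ^ (2 * k) / fact (2 * k) * expectation (\<lambda>\<omega>. X \<omega> ^ (2 * k))))"
proof -
  let ?f = "\<lambda>k \<omega>. (- 1) ^ k / fact (2 * k) * (t * X \<omega>) ^ (2 * k)"
  have sums: "(\<lambda>k. ?f k \<omega>) sums cos (t * X \<omega>)" for \<omega>
    using cos_paired[of "t * X \<omega>"] by simp
  have abs: "norm (?f k \<omega>) = t ^ (2 * k) / fact (2 * k) * X \<omega> ^ (2 * k)" for k \<omega>
    by (simp add: abs_mult power_mult_distrib power_abs power_mult)
  have "expectation (\<lambda>\<omega>. cos (t * X \<omega>)) = expectation (\<lambda>\<omega>. suminf (\<lambda>k. ?f k \<omega>))"
    using sums by (simp add: sums_iff)
  also have "\<dots> = suminf (\<lambda>k. expectation (?f k))"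
  proof (rule integral_suminf)
    show "integrable M (?f k)" for k
      using i[of k] by (simp add: power_mult_distrib)
    show "AE \<omega> in M. summable (\<lambda>k. norm (?f k \<omega>))"
    proof (rule AE_I2)
      fix \<omega>
      have "summable (\<lambda>k. (t * X \<omega>)\<^sup>2 ^ k * fact (k + 0) / fact (2 * k))"
        by (rule summable_fact_ratio) simp
      then show "summable (\<lambda>k. norm (?f k \<omega>))"
      proof (rule summable_comparison_test')
        fix k :: nat
        have "(t * X \<omega>)\<^sup>2 ^ k * 1 / fact (2 * k) \<le> (t * X \<omega>)\<^sup>2 ^ k * fact (k + 0) / fact (2 * k)"
          by (intro divide_right_mono mult_left_mono) auto
        then show "norm (norm (?f k \<omega>)) \<le> (t * X \<omega>)\<^sup>2 ^ k * fact (k + 0) / fact (2 * k)"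
          by (simp add: abs_mult power_mult_distrib power_abs power_mult)
      qed
    qed
    show "summable (\<lambda>k. expectation (\<lambda>\<omega>. norm (?f k \<omega>)))"
      unfolding abs using s by simp
  qed
  also have "\<dots> = suminf (\<lambda>k. (- 1) ^ k * (t ^ (2 * k) / fact (2 * k) * expectation (\<lambda>\<omega>. X \<omega> ^ (2 * k))))"
    by (simp add: power_mult_distrib)
  finally show ?thesis .
qed

text \<open>Symmetrising by an independent random sign reduces the determinacy of a law on the half line
  by its even moments to characteristic functions, which become cosine transforms.\<close>
definition rademacher :: "real measure \<Rightarrow> real measure" where
  "rademacher \<mu> = distr (\<mu> \<Otimes>\<^sub>M measure_pmf (bernoulli_pmf (1/2))) borel (\<lambda>(s, b). if b then s else - s)"

lemma rademacher_real_distribution: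
  assumes "real_distribution \<mu>"
  shows "real_distribution (rademacher \<mu>)"
proof -
  interpret real_distribution \<mu> by fact
  interpret B: prob_space "measure_pmf (bernoulli_pmf (1/2))" by (rule measure_pmf.prob_space_axioms)
  interpret P: pair_prob_space \<mu> "measure_pmf (bernoulli_pmf (1/2))" ..
  have [measurable]: "(\<lambda>(s, b). if b then s else - s) \<in> \<mu> \<Otimes>\<^sub>M measure_pmf (bernoulli_pmf (1/2)) \<rightarrow>\<^sub>M borel"
    by measurable
  show ?thesis unfolding rademacher_def
    by (rule prob_space.real_distribution_distr[OF P.prob_space_axioms]) measurable
qed

lemma char_rademacher:
  assumes "real_distribution \<mu>"
  shows "char (rademacher \<mu>) t = of_real (\<integral>s. cos (t * s) \<partial>\<mu>)"
proof -
  interpret real_distribution \<mu> by fact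
  let ?B = "measure_pmf (bernoulli_pmf (1/2))"
  interpret B: prob_space ?B by (rule measure_pmf.prob_space_axioms)
  interpret P: pair_prob_space \<mu> ?B ..
  have [measurable]: "(\<lambda>(s, b). if b then s else - s) \<in> \<mu> \<Otimes>\<^sub>M ?B \<rightarrow>\<^sub>M borel"
    by measurable
  let ?f = "\<lambda>z::real \<times> bool. iexp (t * (if snd z then fst z else - fst z))"
  have "char (rademacher \<mu>) t = (\<integral>z. ?f z \<partial>(\<mu> \<Otimes>\<^sub>M ?B))"
    unfolding char_def rademacher_def by (subst integral_distr) (auto simp: case_prod_beta)
  also have "\<dots> = (\<integral>s. (\<integral>b. ?f (s, b) \<partial>?B) \<partial>\<mu>)"
  proof (rule P.integral_fst'[symmetric])
    show "integrable (\<mu> \<Otimes>\<^sub>M ?B) ?f"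
    proof (rule P.integrable_const_bound[where B = 1])
      show "?f \<in> borel_measurable (\<mu> \<Otimes>\<^sub>M ?B)" by measurable
    qed simp
  qed
  also have "\<dots> = (\<integral>s. of_real (cos (t * s)) \<partial>\<mu>)"
  proof (rule Bochner_Integration.integral_cong[OF refl])
    fix s
    have "(\<integral>b. ?f (s, b) \<partial>?B) = (\<Sum>b\<in>UNIV. pmf (bernoulli_pmf (1/2)) b *\<^sub>R ?f (s, b))"
      by (rule integral_measure_pmf) auto
    also have "\<dots> = of_real (cos (t * s))"
      unfolding cis_conv_exp[symmetric] by (simp add: UNIV_bool complex_eq_iff)
    finally show "(\<integral>b. ?f (s, b) \<partial>?B) = of_real (cos (t * s))" .
  qed
  finally show ?thesis by simp
qed

lemma distr_abs_rademacher:
  assumes "real_distribution \<mu>" "AE s in \<mu>. 0 \<le> s"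
  shows "distr (rademacher \<mu>) borel abs = \<mu>"
proof -
  interpret real_distribution \<mu> by fact
  let ?B = "measure_pmf (bernoulli_pmf (1/2))"
  interpret B: prob_space ?B by (rule measure_pmf.prob_space_axioms)
  have [measurable]: "(\<lambda>(s, b). if b then s else - s) \<in> \<mu> \<Otimes>\<^sub>M ?B \<rightarrow>\<^sub>M borel"
    by measurable
  have "distr (rademacher \<mu>) borel abs = distr (\<mu> \<Otimes>\<^sub>M ?B) borel (\<lambda>z. \<bar>fst z\<bar>)"
    unfolding rademacher_def by (subst distr_distr) (auto simp: comp_def case_prod_beta intro!: distr_cong)
  also have "\<dots> = distr (distr (\<mu> \<Otimes>\<^sub>M ?B) \<mu> fst) borel abs"
    by (subst distr_distr) (auto simp: comp_def)
  also have "distr (\<mu> \<Otimes>\<^sub>M ?B) \<mu> fst = \<mu>"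
    by (rule prob_space.distr_pair_fst[OF measure_pmf.prob_space_axioms])
  also have "distr \<mu> borel abs = distr \<mu> borel (\<lambda>x. x)"
    by (rule distr_cong_AE) (use assms(2) in auto)
  also have "\<dots> = \<mu>" by (rule distr_id2) simp
  finally show ?thesis .
qed

text \<open>The cosine transforms agree by expansion into even moments, so the symmetrised laws
  agree by Levy uniqueness, and the absolute value undoes the symmetrisation. Summability for one
  law suffices because the moments coincide.\<close>

lemma real_distribution_eqI_even_moments:
  assumes "real_distribution \<mu>" "real_distribution \<nu>"
    and pos: "AE s in \<mu>. 0 \<le> s" "AE s in \<nu>. 0 \<le> s"
    and int: "\<And>k. integrable \<mu> (\<lambda>s. s ^ (2 * k))" "\<And>k. integrable \<nu> (\<lambda>s. s ^ (2 * k))"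
    and eq: "\<And>k. (\<integral>s. s ^ (2 * k) \<partial>\<mu>) = (\<integral>s. s ^ (2 * k) \<partial>\<nu>)"
    and sum: "\<And>t. summable (\<lambda>k. t ^ (2 * k) / fact (2 * k) * (\<integral>s. s ^ (2 * k) \<partial>\<mu>))"
  shows "\<mu> = \<nu>"
proof -
  interpret \<mu>: real_distribution \<mu> by fact
  interpret \<nu>: real_distribution \<nu> by fact
  have "(\<integral>s. cos (t * s) \<partial>\<mu>) = (\<integral>s. cos (t * s) \<partial>\<nu>)" for t
    using \<mu>.expectation_cos[of "\<lambda>s. s" t] \<nu>.expectation_cos[of "\<lambda>s. s" t] int sum[of t] eq by simp
  then have "char (rademacher \<mu>) = char (rademacher \<nu>)"
    by (auto simp: char_rademacher assms(1,2))
  then have "rademacher \<mu> = rademacher \<nu>"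
    by (intro Levy_uniqueness rademacher_real_distribution assms(1,2))
  then show ?thesis
    using distr_abs_rademacher[OF assms(1) pos(1)] distr_abs_rademacher[OF assms(2) pos(2)] by metis
qed

section \<open>Weighted intensity measures of point processes\<close>

lemma sum_mset_tendsto_SUP:
  fixes U :: "nat \<Rightarrow> 'a \<Rightarrow> ennreal"
  assumes "incseq U"
  shows "(SUP i. \<Sum>s\<in>#S. U i s) = (\<Sum>s\<in>#S. SUP i. U i s)"
proof (induction S)
  case (add x S)
  have inc: "incseq (\<lambda>i. \<Sum>s\<in>#S. U i s)" for S
    using assms by (auto simp: incseq_def le_fun_def intro!: sum_mset_mono)
  have "(SUP i. U i x + (\<Sum>s\<in>#S. U i s)) = (SUP i. U i x) + (SUP i. \<Sum>s\<in>#S. U i s)"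
    by (rule ennreal_SUP_add) (use assms inc in \<open>auto simp: incseq_def le_fun_def\<close>)
  then show ?case using add by simp
qed simp

text \<open>The intensity measure of the point process \<open>S\<close>, weighted by \<open>H\<close>. Its even moments are the
  expectations of power sums times \<open>H\<close>, and determinacy of this one-dimensional measure allows one to trade
  a power sum for a counting variable.\<close>
definition count_measure :: "'w measure \<Rightarrow> ('w \<Rightarrow> real multiset) \<Rightarrow> ('w \<Rightarrow> real) \<Rightarrow> real measure" where
  "count_measure M S H = measure_of UNIV (sets borel) (\<lambda>B. \<integral>\<^sup>+\<omega>. (\<Sum>s\<in>#S \<omega>. indicator B s) * ennreal (H \<omega>) \<partial>M)"

lemma sum_mset_ennreal: "(\<And>s. s \<in># S \<Longrightarrow> 0 \<le> f s) \<Longrightarrow> (\<Sum>s\<in>#S. ennreal (f s)) = ennreal (\<Sum>s\<in>#S. f s)"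
  by (induction S) (auto simp: ennreal_plus sum_mset_nonneg_real)

lemma sum_mset_indicator_ennreal: "(\<Sum>s\<in>#S. indicator B s) = ennreal (npoints B S)"
  unfolding npoints_def by (subst sum_mset_ennreal[symmetric]) (auto simp: ennreal_indicator)

lemma sum_mset_measurable:
  assumes "f \<in> borel_measurable borel"
  shows "(\<lambda>S. \<Sum>s\<in>#S. f s :: ennreal) \<in> borel_measurable mset_borel"
  using assms
proof (induction f rule: borel_measurable_induct)
  case (set A)
  then show ?case unfolding sum_mset_indicator_ennreal by measurable
next
  case (mult u c)
  have eq: "(\<Sum>s\<in>#S. c * u s) = c * (\<Sum>s\<in>#S. u s)" for S
    by (induction S) (auto simp: distrib_left)
  have [measurable]: "(\<lambda>S. \<Sum>s\<in>#S. u s) \<in> borel_measurable mset_borel" using mult by simp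
  show ?case unfolding eq by measurable
next
  case (add u v)
  then show ?case by (simp add: sum_mset.distrib)
next
  case (seq U)
  have eq: "(\<Sum>s\<in>#S. (SUP i. U i) s) = (SUP i. \<Sum>s\<in>#S. U i s)" for S
    using sum_mset_tendsto_SUP[OF \<open>incseq U\<close>] by (simp add: image_comp)
  show ?case unfolding eq using seq by auto
qed auto

context prob_space
begin

context
  fixes S :: "'a \<Rightarrow> real multiset" and H :: "'a \<Rightarrow> real"
  assumes S [measurable]: "S \<in> M \<rightarrow>\<^sub>M mset_borel" and H [measurable]: "H \<in> borel_measurable M"
begin

lemma sum_mset_measurable' [measurable]:
  "f \<in> borel_measurable borel \<Longrightarrow> (\<lambda>\<omega>. \<Sum>s\<in>#S \<omega>. f s :: ennreal) \<in> borel_measurable M"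
  using measurable_compose[OF S sum_mset_measurable] by simp

lemma sets_count_measure [simp, measurable_cong]: "sets (count_measure M S H) = sets borel"
  and space_count_measure [simp]: "space (count_measure M S H) = UNIV"
  unfolding count_measure_def using sets.sigma_sets_eq[of "borel :: real measure"] by auto

lemma emeasure_count_measure:
  assumes "B \<in> sets borel"
  shows "emeasure (count_measure M S H) B = (\<integral>\<^sup>+\<omega>. (\<Sum>s\<in>#S \<omega>. indicator B s) * ennreal (H \<omega>) \<partial>M)"
  unfolding count_measure_def
proof (rule emeasure_measure_of_sigma)
  let ?\<mu> = "\<lambda>B. \<integral>\<^sup>+\<omega>. (\<Sum>s\<in>#S \<omega>. indicator B s) * ennreal (H \<omega>) \<partial>M"
  show "sigma_algebra UNIV (sets (borel :: real measure))"
    using sets.sigma_algebra_axioms[of "borel :: real measure"] by simp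
  show "positive (sets borel) ?\<mu>" by (simp add: positive_def sum_mset_indicator_ennreal npoints_eq_size)
  show "countably_additive (sets borel) ?\<mu>"
  proof (rule countably_additiveI)
    fix A :: "nat \<Rightarrow> real set"
    assume A: "range A \<subseteq> sets borel" "disjoint_family A"
    have A' [measurable]: "A i \<in> sets borel" for i using A by auto
    have "(\<Sum>s\<in>#X. indicator (\<Union>i. A i) s) = suminf (\<lambda>i. \<Sum>s\<in>#X. indicator (A i) s :: ennreal)" for X
    proof (induction X)
      case (add x X)
      then show ?case
        by (simp add: suminf_add[symmetric] suminf_indicator[OF A(2)])
    qed simp
    then have "?\<mu> (\<Union>i. A i) = (\<integral>\<^sup>+\<omega>. suminf (\<lambda>i. (\<Sum>s\<in>#S \<omega>. indicator (A i) s) * ennreal (H \<omega>)) \<partial>M)"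
      by simp
    also have "\<dots> = suminf (\<lambda>i. ?\<mu> (A i))"
      by (rule nn_integral_suminf) measurable
    finally show "suminf (\<lambda>i. ?\<mu> (A i)) = ?\<mu> (\<Union>i. A i)" by simp
  qed
qed fact

lemma nn_integral_count_measure:
  assumes "f \<in> borel_measurable borel"
  shows "(\<integral>\<^sup>+s. f s \<partial>count_measure M S H) = (\<integral>\<^sup>+\<omega>. (\<Sum>s\<in>#S \<omega>. f s) * ennreal (H \<omega>) \<partial>M)"
  using assms
proof (induction f rule: borel_measurable_induct)
  case (set A)
  then show ?case by (simp add: emeasure_count_measure)
next
  case (mult u c)
  have eq: "(\<Sum>s\<in>#X. c * u s) = c * (\<Sum>s\<in>#X. u s)" for X
    by (induction X) (auto simp: distrib_left)
  have [measurable]: "u \<in> borel_measurable borel" by fact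
  have "(\<integral>\<^sup>+\<omega>. (\<Sum>s\<in>#S \<omega>. c * u s) * ennreal (H \<omega>) \<partial>M) = (\<integral>\<^sup>+\<omega>. c * ((\<Sum>s\<in>#S \<omega>. u s) * ennreal (H \<omega>)) \<partial>M)"
    by (simp only: eq mult.assoc)
  also have "\<dots> = c * (\<integral>\<^sup>+\<omega>. (\<Sum>s\<in>#S \<omega>. u s) * ennreal (H \<omega>) \<partial>M)"
    by (rule nn_integral_cmult) measurable
  finally have R: "(\<integral>\<^sup>+\<omega>. (\<Sum>s\<in>#S \<omega>. c * u s) * ennreal (H \<omega>) \<partial>M) =
      c * (\<integral>\<^sup>+\<omega>. (\<Sum>s\<in>#S \<omega>. u s) * ennreal (H \<omega>) \<partial>M)" .
  have L: "(\<integral>\<^sup>+s. c * u s \<partial>count_measure M S H) = c * (\<integral>\<^sup>+s. u s \<partial>count_measure M S H)"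
    by (rule nn_integral_cmult) measurable
  show ?case by (simp only: L R mult(4))
next
  case (add u v)
  have [measurable]: "u \<in> borel_measurable borel" "v \<in> borel_measurable borel" by fact+
  show ?case using add by (simp add: sum_mset.distrib distrib_right nn_integral_add)
next
  case (seq U)
  have [measurable]: "U i \<in> borel_measurable borel" for i by fact
  have eq: "(\<Sum>s\<in>#X. (SUP i. U i) s) = (SUP i. \<Sum>s\<in>#X. U i s)" for X
    using sum_mset_tendsto_SUP[OF \<open>incseq U\<close>] by (simp add: image_comp)
  have inc: "incseq (\<lambda>i \<omega>. (\<Sum>s\<in>#S \<omega>. U i s) * ennreal (H \<omega>))"
    using \<open>incseq U\<close> by (auto simp: incseq_def le_fun_def intro!: mult_right_mono sum_mset_mono)
  have "(\<integral>\<^sup>+s. (SUP i. U i) s \<partial>count_measure M S H) = (SUP i. \<integral>\<^sup>+s. U i s \<partial>count_measure M S H)"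
    using nn_integral_monotone_convergence_SUP[OF \<open>incseq U\<close>, of "count_measure M S H"]
    by (simp add: image_comp measurable_cong_sets[OF sets_count_measure refl])
  also have "\<dots> = (SUP i. \<integral>\<^sup>+\<omega>. (\<Sum>s\<in>#S \<omega>. U i s) * ennreal (H \<omega>) \<partial>M)"
    using seq by simp
  also have "\<dots> = (\<integral>\<^sup>+\<omega>. (SUP i. (\<Sum>s\<in>#S \<omega>. U i s) * ennreal (H \<omega>)) \<partial>M)"
    by (rule nn_integral_monotone_convergence_SUP[symmetric, OF inc]) measurable
  also have "\<dots> = (\<integral>\<^sup>+\<omega>. (\<Sum>s\<in>#S \<omega>. (SUP i. U i) s) * ennreal (H \<omega>) \<partial>M)"
    unfolding eq by (simp add: SUP_mult_right_ennreal)
  finally show ?case .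
qed auto

lemma count_measure_props:
  assumes n: "n \<ge> 1" "\<And>\<omega>. \<omega> \<in> space M \<Longrightarrow> size (S \<omega>) = n"
    and pos: "\<And>\<omega> s. \<omega> \<in> space M \<Longrightarrow> s \<in># S \<omega> \<Longrightarrow> 0 \<le> s"
    and H0: "\<And>\<omega>. \<omega> \<in> space M \<Longrightarrow> 0 \<le> H \<omega>"
    and int: "\<And>k. integrable M (\<lambda>\<omega>. even_psum k (S \<omega>) * H \<omega>)"
    and one: "real n * expectation H = 1"
  shows "real_distribution (count_measure M S H)" "AE s in count_measure M S H. 0 \<le> s"
    "integrable (count_measure M S H) (\<lambda>s. s ^ (2 * k))"
    "(\<integral>s. s ^ (2 * k) \<partial>count_measure M S H) = expectation (\<lambda>\<omega>. even_psum k (S \<omega>) * H \<omega>)"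
    "B \<in> sets borel \<Longrightarrow> emeasure (count_measure M S H) B = ennreal (expectation (\<lambda>\<omega>. npoints B (S \<omega>) * H \<omega>))"
proof -
  let ?\<mu> = "count_measure M S H"
  \<comment> \<open>The power sum of order 0 is the constant \<open>n\<close>, so integrability of
    the weight is contained in the case \<open>k = 0\<close>.\<close>
  have "integrable M (\<lambda>\<omega>. 1 / real n * (even_psum 0 (S \<omega>) * H \<omega>))"
    using int[of 0] by simp
  then have intH: "integrable M H"
    by (rule Bochner_Integration.integrable_cong[THEN iffD1, OF refl, rotated]) (use n in \<open>auto simp: even_psum_0\<close>)
  show em: "emeasure ?\<mu> B = ennreal (expectation (\<lambda>\<omega>. npoints B (S \<omega>) * H \<omega>))" if [measurable]: "B \<in> sets borel" for B
  proof -
    have "integrable M (\<lambda>\<omega>. npoints B (S \<omega>) * H \<omega>)"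
    proof (rule Bochner_Integration.integrable_bound[OF integrable_mult_right[OF intH, of "real n"]])
      show "AE \<omega> in M. norm (npoints B (S \<omega>) * H \<omega>) \<le> norm (real n * H \<omega>)"
        using npoints_le[of B] n(2) H0 npoints_nonneg
        by (intro AE_I2) (auto simp: abs_mult intro!: mult_mono)
    qed measurable
    then have "(\<integral>\<^sup>+\<omega>. ennreal (npoints B (S \<omega>) * H \<omega>) \<partial>M) = ennreal (expectation (\<lambda>\<omega>. npoints B (S \<omega>) * H \<omega>))"
      by (rule nn_integral_eq_integral) (use npoints_nonneg H0 in auto)
    moreover have "(\<integral>\<^sup>+\<omega>. ennreal (npoints B (S \<omega>) * H \<omega>) \<partial>M) = (\<integral>\<^sup>+\<omega>. ennreal (npoints B (S \<omega>)) * ennreal (H \<omega>) \<partial>M)"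
      by (rule nn_integral_cong) (auto simp: ennreal_mult npoints_nonneg H0)
    ultimately show ?thesis
      by (simp add: emeasure_count_measure sum_mset_indicator_ennreal)
  qed
  have "expectation (\<lambda>\<omega>. npoints UNIV (S \<omega>) * H \<omega>) = 1"
    using one n(2) by (subst Bochner_Integration.integral_cong[OF refl, where g = "\<lambda>\<omega>. real n * H \<omega>"])
      (auto simp: npoints_eq_size)
  then have "prob_space ?\<mu>"
    by (intro prob_spaceI) (simp add: em)
  then show "real_distribution ?\<mu>"
    by (simp add: real_distribution_def real_distribution_axioms_def)
  have "expectation (\<lambda>\<omega>. npoints {..<0} (S \<omega>) * H \<omega>) = 0"
  proof (subst Bochner_Integration.integral_cong[OF refl, where g = "\<lambda>\<omega>. 0"])
    fix \<omega> assume "\<omega> \<in> space M"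
    then have "filter_mset (\<lambda>x. x \<in> {..<0}) (S \<omega>) = {#}"
      using pos filter_mset_cong[OF refl, of "S \<omega>" "\<lambda>x. x \<in> {..<0}" "\<lambda>_. False"] by (force simp: not_less)
    then show "npoints {..<0} (S \<omega>) * H \<omega> = 0" by (simp add: npoints_eq_size)
  qed simp
  then have "emeasure ?\<mu> {..<0} = 0" by (simp add: em)
  then show "AE s in ?\<mu>. 0 \<le> s"
    by (intro AE_I[where N = "{..<0}"]) auto
  have eq: "(\<Sum>s\<in>#S \<omega>. ennreal (s ^ (2 * k))) = ennreal (even_psum k (S \<omega>))" for \<omega>
    unfolding even_psum_def by (rule sum_mset_ennreal) auto
  have nn: "(\<integral>\<^sup>+s. ennreal (s ^ (2 * k)) \<partial>?\<mu>) = ennreal (expectation (\<lambda>\<omega>. even_psum k (S \<omega>) * H \<omega>))"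
  proof -
    have "(\<integral>\<^sup>+s. ennreal (s ^ (2 * k)) \<partial>?\<mu>) = (\<integral>\<^sup>+\<omega>. ennreal (even_psum k (S \<omega>)) * ennreal (H \<omega>) \<partial>M)"
      by (subst nn_integral_count_measure) (auto simp: eq)
    also have "\<dots> = (\<integral>\<^sup>+\<omega>. ennreal (even_psum k (S \<omega>) * H \<omega>) \<partial>M)"
      by (rule nn_integral_cong) (auto simp: ennreal_mult even_psum_nonneg H0)
    also have "\<dots> = ennreal (expectation (\<lambda>\<omega>. even_psum k (S \<omega>) * H \<omega>))"
      by (rule nn_integral_eq_integral[OF int]) (use even_psum_nonneg H0 in auto)
    finally show ?thesis .
  qed
  show "integrable ?\<mu> (\<lambda>s. s ^ (2 * k))"
    by (rule integrableI_nonneg) (auto simp: nn measurable_cong_sets[OF sets_count_measure refl])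
  show "(\<integral>s. s ^ (2 * k) \<partial>?\<mu>) = expectation (\<lambda>\<omega>. even_psum k (S \<omega>) * H \<omega>)"
    by (subst integral_eq_nn_integral, simp, simp)
      (simp add: nn, intro enn2real_ennreal integral_nonneg_AE AE_I2 mult_nonneg_nonneg even_psum_nonneg H0)
qed

end
end

text \<open>After division of the weights by the common total mass \<open>c\<close>, both
  intensities are probability laws on the half line with equal even moments, hence equal; their
  values on \<open>B\<close> are the two sides.\<close>

lemma npoints_integral_eq_step:
  assumes M: "prob_space M" and N: "prob_space N"
    and S [measurable]: "S \<in> M \<rightarrow>\<^sub>M mset_borel" and T [measurable]: "T \<in> N \<rightarrow>\<^sub>M mset_borel"
    and H [measurable]: "H \<in> borel_measurable M" and K [measurable]: "K \<in> borel_measurable N"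
    and n: "n \<ge> 1"
    and nS: "\<And>\<omega>. \<omega> \<in> space M \<Longrightarrow> size (S \<omega>) = n" "\<And>\<omega> s. \<omega> \<in> space M \<Longrightarrow> s \<in># S \<omega> \<Longrightarrow> 0 \<le> s"
    and nT: "\<And>\<omega>. \<omega> \<in> space N \<Longrightarrow> size (T \<omega>) = n" "\<And>\<omega> s. \<omega> \<in> space N \<Longrightarrow> s \<in># T \<omega> \<Longrightarrow> 0 \<le> s"
    and H0: "\<And>\<omega>. \<omega> \<in> space M \<Longrightarrow> 0 \<le> H \<omega>" and K0: "\<And>\<omega>. \<omega> \<in> space N \<Longrightarrow> 0 \<le> K \<omega>"
    and intH: "\<And>k. integrable M (\<lambda>\<omega>. even_psum k (S \<omega>) * H \<omega>)" and intK: "\<And>k. integrable N (\<lambda>\<omega>. even_psum k (T \<omega>) * K \<omega>)"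
    and eq: "\<And>k. (\<integral>\<omega>. even_psum k (S \<omega>) * H \<omega> \<partial>M) = (\<integral>\<omega>. even_psum k (T \<omega>) * K \<omega> \<partial>N)"
    and sum: "\<And>t. summable (\<lambda>k. t ^ (2 * k) / fact (2 * k) * (\<integral>\<omega>. even_psum k (S \<omega>) * H \<omega> \<partial>M))"
    and B [measurable]: "B \<in> sets borel"
  shows "(\<integral>\<omega>. npoints B (S \<omega>) * H \<omega> \<partial>M) = (\<integral>\<omega>. npoints B (T \<omega>) * K \<omega> \<partial>N)"
proof -
  interpret M: prob_space M by fact
  interpret N: prob_space N by fact
  define c where "c = real n * M.expectation H"
  have P0: "(\<integral>\<omega>. even_psum 0 (S \<omega>) * H \<omega> \<partial>M) = c" "(\<integral>\<omega>. even_psum 0 (T \<omega>) * K \<omega> \<partial>N) = real n * N.expectation K"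
    unfolding c_def
    by (subst Bochner_Integration.integral_cong[OF refl, where g = "\<lambda>\<omega>. real n * H \<omega>"], simp_all add: even_psum_0 nS)
      (subst Bochner_Integration.integral_cong[OF refl, where g = "\<lambda>\<omega>. real n * K \<omega>"], simp_all add: even_psum_0 nT)
  then have cK: "c = real n * N.expectation K" using eq[of 0] by simp
  have iH: "integrable M H" and iK: "integrable N K"
  proof -
    have "integrable M (\<lambda>\<omega>. 1 / real n * (even_psum 0 (S \<omega>) * H \<omega>))" "integrable N (\<lambda>\<omega>. 1 / real n * (even_psum 0 (T \<omega>) * K \<omega>))"
      using intH[of 0] intK[of 0] by simp_all
    then show "integrable M H" "integrable N K"
      using n by (auto elim!: Bochner_Integration.integrable_cong[THEN iffD1, OF refl, rotated] simp: even_psum_0 nS nT)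
  qed
  show ?thesis
  proof (cases "c = 0")
    \<comment> \<open>A zero total mass cannot be normalised, but then both nonnegative weights
      vanish almost surely.\<close>
    case True
    then have 0: "M.expectation H = 0" "N.expectation K = 0" using cK n unfolding c_def by auto
    have "AE \<omega> in M. H \<omega> = 0"
      using 0 integral_nonneg_eq_0_iff_AE[OF iH] H0 by auto
    moreover have "AE \<omega> in N. K \<omega> = 0"
      using 0 integral_nonneg_eq_0_iff_AE[OF iK] K0 by auto
    ultimately have "(\<integral>\<omega>. npoints B (S \<omega>) * H \<omega> \<partial>M) = (\<integral>\<omega>. 0 \<partial>M)" "(\<integral>\<omega>. npoints B (T \<omega>) * K \<omega> \<partial>N) = (\<integral>\<omega>. 0 \<partial>N)"
      by (auto intro!: integral_eq_zero_AE)
    then show ?thesis by simp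
  next
    case False
    have "M.expectation H \<ge> 0" by (rule integral_nonneg_AE) (use H0 in auto)
    then have "c \<ge> 0" unfolding c_def by simp
    then have c: "c > 0" using False by simp
    let ?H = "\<lambda>\<omega>. H \<omega> / c" and ?K = "\<lambda>\<omega>. K \<omega> / c"
    let ?\<mu> = "count_measure M S ?H" and ?\<nu> = "count_measure N T ?K"
    have H' [measurable]: "?H \<in> borel_measurable M" and K' [measurable]: "?K \<in> borel_measurable N" by measurable
    have 1: "real n * M.expectation ?H = 1" "real n * N.expectation ?K = 1"
      using c cK n unfolding c_def by auto
    have iH': "integrable M (\<lambda>\<omega>. even_psum k (S \<omega>) * ?H \<omega>)" and iK': "integrable N (\<lambda>\<omega>. even_psum k (T \<omega>) * ?K \<omega>)" for k
      using intH[of k] intK[of k] by auto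
    have H0': "\<And>\<omega>. \<omega> \<in> space M \<Longrightarrow> 0 \<le> ?H \<omega>" and K0': "\<And>\<omega>. \<omega> \<in> space N \<Longrightarrow> 0 \<le> ?K \<omega>"
      using H0 K0 c by auto
    note mu = M.count_measure_props[OF S H' n nS H0' iH' 1(1)]
    note nu = N.count_measure_props[OF T K' n nT K0' iK' 1(2)]
    have mom: "(\<integral>s. s ^ (2 * k) \<partial>?\<mu>) = M.expectation (\<lambda>\<omega>. even_psum k (S \<omega>) * ?H \<omega>)" for k
      by (rule mu(4))
    have mom': "(\<integral>s. s ^ (2 * k) \<partial>?\<nu>) = N.expectation (\<lambda>\<omega>. even_psum k (T \<omega>) * ?K \<omega>)" for k
      by (rule nu(4))
    have emu: "emeasure ?\<mu> B = ennreal (M.expectation (\<lambda>\<omega>. npoints B (S \<omega>) * ?H \<omega>))"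
      by (rule mu(5)) (assumption | rule B)+
    have enu: "emeasure ?\<nu> B = ennreal (N.expectation (\<lambda>\<omega>. npoints B (T \<omega>) * ?K \<omega>))"
      by (rule nu(5)) (assumption | rule B)+
    have "?\<mu> = ?\<nu>"
    proof (rule real_distribution_eqI_even_moments)
      show "(\<integral>s. s ^ (2 * k) \<partial>?\<mu>) = (\<integral>s. s ^ (2 * k) \<partial>?\<nu>)" for k
        unfolding mom mom' using eq[of k] by simp
      show "summable (\<lambda>k. t ^ (2 * k) / fact (2 * k) * (\<integral>s. s ^ (2 * k) \<partial>?\<mu>))" for t
        using summable_divide[OF sum[of t], of c] unfolding mom by simp
      show "real_distribution ?\<mu>" by (rule mu(1))
      show "real_distribution ?\<nu>" by (rule nu(1))
      show "AE s in ?\<mu>. 0 \<le> s" by (rule mu(2))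
      show "AE s in ?\<nu>. 0 \<le> s" by (rule nu(2))
      show "integrable ?\<mu> (\<lambda>s. s ^ (2 * k))" for k by (rule mu(3))
      show "integrable ?\<nu> (\<lambda>s. s ^ (2 * k))" for k by (rule nu(3))
    qed
    then have "ennreal (M.expectation (\<lambda>\<omega>. npoints B (S \<omega>) * ?H \<omega>)) = ennreal (N.expectation (\<lambda>\<omega>. npoints B (T \<omega>) * ?K \<omega>))"
      using emu enu by metis
    then have "M.expectation (\<lambda>\<omega>. npoints B (S \<omega>) * ?H \<omega>) = N.expectation (\<lambda>\<omega>. npoints B (T \<omega>) * ?K \<omega>)"
    proof (subst (asm) ennreal_inj)
      show "0 \<le> M.expectation (\<lambda>\<omega>. npoints B (S \<omega>) * ?H \<omega>)"
        by (rule integral_nonneg_AE, rule AE_I2, rule mult_nonneg_nonneg[OF npoints_nonneg H0'])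
      show "0 \<le> N.expectation (\<lambda>\<omega>. npoints B (T \<omega>) * ?K \<omega>)"
        by (rule integral_nonneg_AE, rule AE_I2, rule mult_nonneg_nonneg[OF npoints_nonneg K0'])
    qed
    then show ?thesis using c by simp
  qed
qed

section \<open>From moments of power sums to joint laws of counts\<close>

lemma prod_list_even_psum_le:
  assumes "size S \<ge> 1"
  shows "(\<Prod>k\<leftarrow>ks. even_psum k S) \<le> real (size S) ^ length ks * even_psum 1 S ^ sum_list ks"
proof (induction ks)
  case (Cons k ks)
  have "even_psum k S * (\<Prod>k\<leftarrow>ks. even_psum k S) \<le>
      (real (size S) * even_psum 1 S ^ k) * (real (size S) ^ length ks * even_psum 1 S ^ sum_list ks)"
    by (intro mult_mono even_psum_le_power assms Cons) (auto simp: even_psum_nonneg intro!: prod_list_nonneg)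
  then show ?case by (simp add: power_add mult_ac)
qed simp

lemma prod_list_npoints_le:
  "(\<Prod>B\<leftarrow>Bs. npoints B S) \<le> real (size S) ^ length Bs"
proof (induction Bs)
  case (Cons B Bs)
  then show ?case
    by (auto intro!: mult_mono npoints_le prod_list_nonneg simp: npoints_nonneg)
qed simp

lemma prod_list_even_psum_nonneg: "0 \<le> (\<Prod>k\<leftarrow>ks. even_psum k S)" and prod_list_npoints_nonneg: "0 \<le> (\<Prod>B\<leftarrow>Bs. npoints B S)"
  by (auto intro!: prod_list_nonneg simp: even_psum_nonneg npoints_nonneg)

text \<open>The counting variables are brought in one at a time, the weight being the product of all other factors.\<close>
lemma npoints_moments_eq:
  assumes M: "prob_space M" and N: "prob_space N"
    and S [measurable]: "S \<in> M \<rightarrow>\<^sub>M mset_borel" and T [measurable]: "T \<in> N \<rightarrow>\<^sub>M mset_borel"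
    and n: "n \<ge> 1"
    and nS: "\<And>\<omega>. \<omega> \<in> space M \<Longrightarrow> size (S \<omega>) = n" "\<And>\<omega> s. \<omega> \<in> space M \<Longrightarrow> s \<in># S \<omega> \<Longrightarrow> 0 \<le> s"
    and nT: "\<And>\<omega>. \<omega> \<in> space N \<Longrightarrow> size (T \<omega>) = n" "\<And>\<omega> s. \<omega> \<in> space N \<Longrightarrow> s \<in># T \<omega> \<Longrightarrow> 0 \<le> s"
    and intS: "\<And>ks. integrable M (\<lambda>\<omega>. \<Prod>k\<leftarrow>ks. even_psum k (S \<omega>))" and intT: "\<And>ks. integrable N (\<lambda>\<omega>. \<Prod>k\<leftarrow>ks. even_psum k (T \<omega>))"
    and eq: "\<And>ks. (\<integral>\<omega>. (\<Prod>k\<leftarrow>ks. even_psum k (S \<omega>)) \<partial>M) = (\<integral>\<omega>. (\<Prod>k\<leftarrow>ks. even_psum k (T \<omega>)) \<partial>N)"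
    and C: "C \<ge> 0" "\<And>m. (\<integral>\<omega>. even_psum 1 (S \<omega>) ^ m \<partial>M) \<le> C ^ m * fact m"
    and Bs: "set Bs \<subseteq> sets borel"
  shows "(\<integral>\<omega>. (\<Prod>k\<leftarrow>ks. even_psum k (S \<omega>)) * (\<Prod>B\<leftarrow>Bs. npoints B (S \<omega>)) \<partial>M) =
         (\<integral>\<omega>. (\<Prod>k\<leftarrow>ks. even_psum k (T \<omega>)) * (\<Prod>B\<leftarrow>Bs. npoints B (T \<omega>)) \<partial>N)"
  using Bs
\<comment> \<open>The list \<open>ks\<close> varies because the determinacy argument for the new set
  needs all even moments of the intensity, that is, the hypothesis for \<open>k # ks\<close> with
  every \<open>k\<close>.\<close>
proof (induction Bs arbitrary: ks)
  case Nil
  then show ?case using eq by simp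
next
  case (Cons B Bs)
  have meas: "(\<lambda>X. \<Prod>B\<leftarrow>Bs. npoints B X) \<in> borel_measurable mset_borel" if "set Bs \<subseteq> sets borel" for Bs
    using that by (induction Bs) auto
  have mBs: "set Bs \<subseteq> sets borel" using Cons.prems by simp
  note [measurable] = meas[OF mBs]
  have mS [measurable]: "(\<lambda>\<omega>. \<Prod>k\<leftarrow>ks. even_psum k (S \<omega>)) \<in> borel_measurable M" for ks
    using intS by (rule borel_measurable_integrable)
  have mT [measurable]: "(\<lambda>\<omega>. \<Prod>k\<leftarrow>ks. even_psum k (T \<omega>)) \<in> borel_measurable N" for ks
    using intT by (rule borel_measurable_integrable)
  have mS2 [measurable]: "(\<lambda>\<omega>. \<Prod>B\<leftarrow>Bs. npoints B (S \<omega>)) \<in> borel_measurable M"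
    by (rule measurable_compose[OF S meas[OF mBs]])
  have mT2 [measurable]: "(\<lambda>\<omega>. \<Prod>B\<leftarrow>Bs. npoints B (T \<omega>)) \<in> borel_measurable N"
    by (rule measurable_compose[OF T meas[OF mBs]])
  let ?H = "\<lambda>\<omega>. (\<Prod>k\<leftarrow>ks. even_psum k (S \<omega>)) * (\<Prod>B\<leftarrow>Bs. npoints B (S \<omega>))"
  let ?K = "\<lambda>\<omega>. (\<Prod>k\<leftarrow>ks. even_psum k (T \<omega>)) * (\<Prod>B\<leftarrow>Bs. npoints B (T \<omega>))"
  have bnd: "norm ((\<Prod>k\<leftarrow>ks. even_psum k X) * (\<Prod>B\<leftarrow>Bs. npoints B X)) \<le> norm (real n ^ length Bs * (\<Prod>k\<leftarrow>ks. even_psum k X))"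
    if "size X = n" for X ks
    using mult_right_mono[OF prod_list_npoints_le[of X Bs] prod_list_even_psum_nonneg[of X ks]] that
      prod_list_even_psum_nonneg[of X ks] prod_list_npoints_nonneg[of X Bs]
    by (simp add: abs_mult mult.commute)
  have intM: "integrable M (\<lambda>\<omega>. (\<Prod>k\<leftarrow>ks. even_psum k (S \<omega>)) * (\<Prod>B\<leftarrow>Bs. npoints B (S \<omega>)))" for ks
    by (rule Bochner_Integration.integrable_bound[OF integrable_mult_right[OF intS[of ks], of "real n ^ length Bs"]])
      (use bnd nS in auto)
  have intN: "integrable N (\<lambda>\<omega>. (\<Prod>k\<leftarrow>ks. even_psum k (T \<omega>)) * (\<Prod>B\<leftarrow>Bs. npoints B (T \<omega>)))" for ks
    by (rule Bochner_Integration.integrable_bound[OF integrable_mult_right[OF intT[of ks], of "real n ^ length Bs"]])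
      (use bnd nT in auto)
  have int1: "integrable M (\<lambda>\<omega>. even_psum 1 (S \<omega>) ^ m)" for m
    using intS[of "replicate m 1"] by (simp add: prod_list_replicate)
  have "(\<integral>\<omega>. npoints B (S \<omega>) * ?H \<omega> \<partial>M) = (\<integral>\<omega>. npoints B (T \<omega>) * ?K \<omega> \<partial>N)"
  proof (rule npoints_integral_eq_step[OF M N S T _ _ n nS nT])
    show "integrable M (\<lambda>\<omega>. even_psum k (S \<omega>) * ?H \<omega>)" for k
      using intM[of "k # ks"] by (simp add: mult.assoc)
    show "integrable N (\<lambda>\<omega>. even_psum k (T \<omega>) * ?K \<omega>)" for k
      using intN[of "k # ks"] by (simp add: mult.assoc)
    show "(\<integral>\<omega>. even_psum k (S \<omega>) * ?H \<omega> \<partial>M) = (\<integral>\<omega>. even_psum k (T \<omega>) * ?K \<omega> \<partial>N)" for k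
      using Cons.IH[OF mBs, of "k # ks"] by (simp add: mult.assoc)
    show "summable (\<lambda>k. t ^ (2 * k) / fact (2 * k) * (\<integral>\<omega>. even_psum k (S \<omega>) * ?H \<omega> \<partial>M))" for t
    proof -
      \<comment> \<open>One factor \<open>n\<close> for each counting variable and for each of the
        \<open>length ks + 1\<close> power sums; the orders of the power sums add up to
        \<open>k + s\<close>, the exponent of \<open>even_psum 1\<close>.\<close>
      define D where "D = real n ^ length Bs * real n ^ Suc (length ks)"
      define s where "s = sum_list ks"
      have le: "(\<integral>\<omega>. even_psum k (S \<omega>) * ?H \<omega> \<partial>M) \<le> D * (C ^ (k + s) * fact (k + s))" for k
      proof -
        have "(\<integral>\<omega>. even_psum k (S \<omega>) * ?H \<omega> \<partial>M) \<le> (\<integral>\<omega>. D * even_psum 1 (S \<omega>) ^ (k + s) \<partial>M)"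
        proof (rule integral_mono)
          show "integrable M (\<lambda>\<omega>. even_psum k (S \<omega>) * ?H \<omega>)"
            using intM[of "k # ks"] by (simp add: mult.assoc)
          show "integrable M (\<lambda>\<omega>. D * even_psum 1 (S \<omega>) ^ (k + s))"
            using int1 by simp
          fix \<omega> assume \<omega>: "\<omega> \<in> space M"
          have "(\<Prod>k\<leftarrow>k # ks. even_psum k (S \<omega>)) * (\<Prod>B\<leftarrow>Bs. npoints B (S \<omega>)) \<le>
              (real n ^ length (k # ks) * even_psum 1 (S \<omega>) ^ sum_list (k # ks)) * real n ^ length Bs"
            using prod_list_even_psum_le[of "S \<omega>" "k # ks"] prod_list_npoints_le[of "S \<omega>" Bs] nS(1)[OF \<omega>] n
            by (intro mult_mono) (auto simp del: prod_list.Cons list.map sum_list.Cons length_Cons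
                simp: prod_list_npoints_nonneg even_psum_nonneg)
          then show "even_psum k (S \<omega>) * ?H \<omega> \<le> D * even_psum 1 (S \<omega>) ^ (k + s)"
            by (simp add: D_def s_def mult_ac)
        qed
        also have "\<dots> \<le> D * (C ^ (k + s) * fact (k + s))"
          using C(2)[of "k + s"] by (auto simp: D_def intro!: mult_left_mono)
        finally show ?thesis .
      qed
      have "summable (\<lambda>k. D * C ^ s * ((t\<^sup>2 * C) ^ k * fact (k + s) / fact (2 * k)))"
        by (intro summable_mult summable_fact_ratio) (use C in auto)
      then show ?thesis
      proof (rule summable_comparison_test')
        fix k :: nat
        have "0 \<le> (\<integral>\<omega>. even_psum k (S \<omega>) * ?H \<omega> \<partial>M)"
          by (intro integral_nonneg_AE AE_I2 mult_nonneg_nonneg even_psum_nonneg prod_list_even_psum_nonneg prod_list_npoints_nonneg)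
        then have "norm (t ^ (2 * k) / fact (2 * k) * (\<integral>\<omega>. even_psum k (S \<omega>) * ?H \<omega> \<partial>M)) =
            t ^ (2 * k) / fact (2 * k) * (\<integral>\<omega>. even_psum k (S \<omega>) * ?H \<omega> \<partial>M)"
          by (subst real_norm_def, subst abs_of_nonneg) auto
        also have "\<dots> \<le> t ^ (2 * k) / fact (2 * k) * (D * (C ^ (k + s) * fact (k + s)))"
          by (intro mult_left_mono le) auto
        also have "\<dots> = D * C ^ s * ((t\<^sup>2 * C) ^ k * fact (k + s) / fact (2 * k))"
          by (simp add: power_add power_mult power_mult_distrib)
        finally show "norm (t ^ (2 * k) / fact (2 * k) * (\<integral>\<omega>. even_psum k (S \<omega>) * ?H \<omega> \<partial>M)) \<le>
            D * C ^ s * ((t\<^sup>2 * C) ^ k * fact (k + s) / fact (2 * k))" .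
      qed
    qed
    show "0 \<le> ?H \<omega>" for \<omega> by (intro mult_nonneg_nonneg prod_list_even_psum_nonneg prod_list_npoints_nonneg)
    show "0 \<le> ?K \<omega>" for \<omega> by (intro mult_nonneg_nonneg prod_list_even_psum_nonneg prod_list_npoints_nonneg)
    show "B \<in> sets borel" using Cons.prems by simp
    show "?H \<in> borel_measurable M" "?K \<in> borel_measurable N" by measurable
  qed
  then show ?case by (simp add: mult_ac)
qed

text \<open>Lagrange interpolation at the nodes 0, ..., n.\<close>

lemma indicator_nat_polynomial:
  assumes "k \<le> n"
  obtains q :: "real poly" where "\<And>m. m \<le> n \<Longrightarrow> poly q (real m) = (if m = k then 1 else 0)"
proof
  let ?q = "\<Prod>i\<in>{..n} - {k}. Polynomial.smult (1 / (real k - real i)) [:- real i, 1:]"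
  fix m assume m: "m \<le> n"
  show "poly ?q (real m) = (if m = k then 1 else 0)"
  proof (cases "m = k")
    case True
    have "poly (Polynomial.smult (1 / (real k - real i)) [:- real i, 1:]) (real k) = 1" if "i \<noteq> k" for i
      using that by (simp flip: diff_divide_distrib)
    then have "poly ?q (real k) = 1"
      unfolding poly_prod by (intro prod.neutral) auto
    then show ?thesis using True by simp
  next
    case False
    then have "poly ?q (real m) = 0"
      using m by (auto simp: poly_prod intro!: bexI[of _ m])
    then show ?thesis using False by simp
  qed
qed

text \<open>A count of an \<open>n\<close>-point collection is one of 0, ..., n, so the event that
  it equals \<open>k\<close> is a polynomial in the count. Events are converted one at a time, and
  \<open>Bs\<close> absorbs the powers produced by the polynomial.\<close>

lemma npoints_indicator_moments_eq:
  assumes M: "prob_space M" and N: "prob_space N"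
    and S [measurable]: "S \<in> M \<rightarrow>\<^sub>M mset_borel" and T [measurable]: "T \<in> N \<rightarrow>\<^sub>M mset_borel"
    and nS: "\<And>\<omega>. \<omega> \<in> space M \<Longrightarrow> size (S \<omega>) = n" and nT: "\<And>\<omega>. \<omega> \<in> space N \<Longrightarrow> size (T \<omega>) = n"
    and eq: "\<And>Bs. set Bs \<subseteq> sets borel \<Longrightarrow>
      (\<integral>\<omega>. (\<Prod>B\<leftarrow>Bs. npoints B (S \<omega>)) \<partial>M) = (\<integral>\<omega>. (\<Prod>B\<leftarrow>Bs. npoints B (T \<omega>)) \<partial>N)"
    and L: "fst ` set L \<subseteq> sets borel" and Bs: "set Bs \<subseteq> sets borel"
  shows "(\<integral>\<omega>. (\<Prod>(B, k)\<leftarrow>L. if npoints B (S \<omega>) = real k then 1 else 0) * (\<Prod>B\<leftarrow>Bs. npoints B (S \<omega>)) \<partial>M) =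
         (\<integral>\<omega>. (\<Prod>(B, k)\<leftarrow>L. if npoints B (T \<omega>) = real k then 1 else 0) * (\<Prod>B\<leftarrow>Bs. npoints B (T \<omega>)) \<partial>N)"
  using L Bs
proof (induction L arbitrary: Bs)
  case Nil
  then show ?case using eq by simp
next
  case (Cons z L)
  obtain B k where z: "z = (B, k)" by (cases z)
  have L: "fst ` set L \<subseteq> sets borel" and B [measurable]: "B \<in> sets borel" using Cons.prems z by auto
  interpret M: prob_space M by fact
  interpret N: prob_space N by fact
  let ?I = "\<lambda>X. (\<Prod>(B, k)\<leftarrow>L. if npoints B X = real k then 1 else 0 :: real)"
  have mI: "?I \<in> borel_measurable mset_borel"
    using L by (induction L) auto
  have mB: "(\<lambda>X. \<Prod>B\<leftarrow>Bs. npoints B X) \<in> borel_measurable mset_borel" if "set Bs \<subseteq> sets borel" for Bs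
    using that by (induction Bs) auto
  have I01: "\<bar>?I X\<bar> \<le> 1" for X
    by (induction L) (auto simp: abs_mult)
  have int: "integrable P (\<lambda>\<omega>. ?I (U \<omega>) * (\<Prod>B\<leftarrow>Bs. npoints B (U \<omega>)))"
    if "prob_space P" "U \<in> P \<rightarrow>\<^sub>M mset_borel" "\<And>\<omega>. \<omega> \<in> space P \<Longrightarrow> size (U \<omega>) = n" "set Bs \<subseteq> sets borel"
    for P :: "'x measure" and U Bs
  proof -
    interpret P: prob_space P by fact
    show ?thesis
    proof (rule P.integrable_const_bound[where B = "1 * real n ^ length Bs"])
      show "AE \<omega> in P. norm (?I (U \<omega>) * (\<Prod>B\<leftarrow>Bs. npoints B (U \<omega>))) \<le> 1 * real n ^ length Bs"
      proof (rule AE_I2)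
        fix \<omega> assume "\<omega> \<in> space P"
        then have "\<bar>\<Prod>B\<leftarrow>Bs. npoints B (U \<omega>)\<bar> \<le> real n ^ length Bs"
          using prod_list_npoints_le[of "U \<omega>" Bs] prod_list_npoints_nonneg[of "U \<omega>" Bs] that(3) by simp
        then show "norm (?I (U \<omega>) * (\<Prod>B\<leftarrow>Bs. npoints B (U \<omega>))) \<le> 1 * real n ^ length Bs"
          unfolding real_norm_def abs_mult by (intro mult_mono I01) auto
      qed
      show "(\<lambda>\<omega>. ?I (U \<omega>) * (\<Prod>B\<leftarrow>Bs. npoints B (U \<omega>))) \<in> borel_measurable P"
        using measurable_compose[OF that(2) mI] measurable_compose[OF that(2) mB[OF that(4)]] by measurable
    qed
  qed
  show ?case
  proof (cases "k \<le> n")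
    case False
    have 0: "npoints B X \<noteq> real k" if "size X = n" for X
      using npoints_le[of B X] that False by auto
    have "(\<integral>\<omega>. (\<Prod>(B, k)\<leftarrow>z # L. if npoints B (S \<omega>) = real k then 1 else 0) * (\<Prod>B\<leftarrow>Bs. npoints B (S \<omega>)) \<partial>M) = (\<integral>\<omega>. 0 \<partial>M)"
      by (rule Bochner_Integration.integral_cong[OF refl]) (use 0 nS z in auto)
    moreover have "(\<integral>\<omega>. (\<Prod>(B, k)\<leftarrow>z # L. if npoints B (T \<omega>) = real k then 1 else 0) * (\<Prod>B\<leftarrow>Bs. npoints B (T \<omega>)) \<partial>N) = (\<integral>\<omega>. 0 \<partial>N)"
      by (rule Bochner_Integration.integral_cong[OF refl]) (use 0 nT z in auto)
    ultimately show ?thesis by simp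
  next
    case True
    obtain q :: "real poly" where q: "\<And>m. m \<le> n \<Longrightarrow> poly q (real m) = (if m = k then 1 else 0)"
      using indicator_nat_polynomial[OF True] by blast
    have ind: "(\<Prod>(B, k)\<leftarrow>z # L. if npoints B X = real k then 1 else 0) * (\<Prod>B\<leftarrow>Bs. npoints B X) =
        (\<Sum>j\<le>Polynomial.degree q. Polynomial.coeff q j * (?I X * (\<Prod>B\<leftarrow>replicate j B @ Bs. npoints B X)))" if "size X = n" for X
    proof -
      have "(if npoints B X = real k then 1 else 0) = poly q (npoints B X)"
        using q[of "size (filter_mset (\<lambda>x. x \<in> B) X)"] that
        by (auto simp: npoints_eq_size size_filter_mset_lesseq)
      also have "\<dots> = (\<Sum>j\<le>Polynomial.degree q. Polynomial.coeff q j * npoints B X ^ j)"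
        by (rule poly_altdef)
      finally show ?thesis
        by (simp add: z sum_distrib_left sum_distrib_right prod_list_replicate mult_ac)
    qed
    have Bs': "set (replicate j B @ Bs) \<subseteq> sets borel" for j
      using Cons.prems B by auto
    have "(\<integral>\<omega>. (\<Prod>(B, k)\<leftarrow>z # L. if npoints B (S \<omega>) = real k then 1 else 0) * (\<Prod>B\<leftarrow>Bs. npoints B (S \<omega>)) \<partial>M) =
        (\<integral>\<omega>. (\<Sum>j\<le>Polynomial.degree q. Polynomial.coeff q j * (?I (S \<omega>) * (\<Prod>B\<leftarrow>replicate j B @ Bs. npoints B (S \<omega>)))) \<partial>M)"
      by (rule Bochner_Integration.integral_cong[OF refl ind[OF nS]])
    also have "\<dots> = (\<Sum>j\<le>Polynomial.degree q. Polynomial.coeff q j * (\<integral>\<omega>. ?I (S \<omega>) * (\<Prod>B\<leftarrow>replicate j B @ Bs. npoints B (S \<omega>)) \<partial>M))"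
      by (subst Bochner_Integration.integral_sum) (use int[OF M S nS Bs'] in auto)
    also have "\<dots> = (\<Sum>j\<le>Polynomial.degree q. Polynomial.coeff q j * (\<integral>\<omega>. ?I (T \<omega>) * (\<Prod>B\<leftarrow>replicate j B @ Bs. npoints B (T \<omega>)) \<partial>N))"
      using Cons.IH[OF L Bs'] by simp
    also have "\<dots> = (\<integral>\<omega>. (\<Sum>j\<le>Polynomial.degree q. Polynomial.coeff q j * (?I (T \<omega>) * (\<Prod>B\<leftarrow>replicate j B @ Bs. npoints B (T \<omega>)))) \<partial>N)"
      by (subst Bochner_Integration.integral_sum) (use int[OF N T nT Bs'] in auto)
    also have "\<dots> = (\<integral>\<omega>. (\<Prod>(B, k)\<leftarrow>z # L. if npoints B (T \<omega>) = real k then 1 else 0) * (\<Prod>B\<leftarrow>Bs. npoints B (T \<omega>)) \<partial>N)"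
      by (rule Bochner_Integration.integral_cong[OF refl ind[OF nT, symmetric]])
    finally show ?thesis .
  qed
qed

text \<open>Finite intersections of count events form a generator of \<open>mset_borel\<close>
  stable under intersection, and their probabilities are determined by the joint moments of counts.
  The bound with \<open>C\<close> is assumed for one side only, since the moments agree.\<close>

theorem mset_distr_eqI:
  assumes M: "prob_space M" and N: "prob_space N" and n: "n \<ge> 1"
    and nS: "\<And>\<omega>. \<omega> \<in> space M \<Longrightarrow> size (S \<omega>) = n" "\<And>\<omega> s. \<omega> \<in> space M \<Longrightarrow> s \<in># S \<omega> \<Longrightarrow> 0 \<le> s"
    and nT: "\<And>\<omega>. \<omega> \<in> space N \<Longrightarrow> size (T \<omega>) = n" "\<And>\<omega> s. \<omega> \<in> space N \<Longrightarrow> s \<in># T \<omega> \<Longrightarrow> 0 \<le> s"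
    and intS: "\<And>ks. integrable M (\<lambda>\<omega>. \<Prod>k\<leftarrow>ks. even_psum k (S \<omega>))" and intT: "\<And>ks. integrable N (\<lambda>\<omega>. \<Prod>k\<leftarrow>ks. even_psum k (T \<omega>))"
    and eq: "\<And>ks. (\<integral>\<omega>. (\<Prod>k\<leftarrow>ks. even_psum k (S \<omega>)) \<partial>M) = (\<integral>\<omega>. (\<Prod>k\<leftarrow>ks. even_psum k (T \<omega>)) \<partial>N)"
    and C: "C \<ge> 0" "\<And>m. (\<integral>\<omega>. even_psum 1 (S \<omega>) ^ m \<partial>M) \<le> C ^ m * fact m"
  shows "S \<in> M \<rightarrow>\<^sub>M mset_borel" "T \<in> N \<rightarrow>\<^sub>M mset_borel" "distr M mset_borel S = distr N mset_borel T"
proof -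
  have mS: "(\<lambda>\<omega>. even_psum k (S \<omega>)) \<in> borel_measurable M" and mT: "(\<lambda>\<omega>. even_psum k (T \<omega>)) \<in> borel_measurable N" for k
    using borel_measurable_integrable[OF intS[of "[k]"]] borel_measurable_integrable[OF intT[of "[k]"]] by simp_all
  show S [measurable]: "S \<in> M \<rightarrow>\<^sub>M mset_borel"
    by (intro measurable_mset_borelI measurable_npoints_of_even_psum[OF nS mS])
  show T [measurable]: "T \<in> N \<rightarrow>\<^sub>M mset_borel"
    by (intro measurable_mset_borelI measurable_npoints_of_even_psum[OF nT mT])
  interpret M: prob_space M by fact
  interpret N: prob_space N by fact
  define E where "E = (\<lambda>L :: (real set \<times> nat) list. {X. \<forall>(B, k)\<in>set L. npoints B X = real k})"
  let ?E = "{E L | L. fst ` set L \<subseteq> sets borel}"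
  have Nbs: "(\<integral>\<omega>. (\<Prod>B\<leftarrow>Bs. npoints B (S \<omega>)) \<partial>M) = (\<integral>\<omega>. (\<Prod>B\<leftarrow>Bs. npoints B (T \<omega>)) \<partial>N)"
    if "set Bs \<subseteq> sets borel" for Bs
    using npoints_moments_eq[OF M N S T n nS nT intS intT eq C that, where ks = "[]"] by simp
  have Esets: "E L \<in> sets mset_borel" if "fst ` set L \<subseteq> sets borel" for L
  proof -
    have "E L = {X \<in> space mset_borel. \<forall>z\<in>set L. npoints (fst z) X = real (snd z)}"
      by (auto simp: E_def)
    also have "\<dots> \<in> sets mset_borel"
    proof (rule sets.sets_Collect_finite_All)
      fix z assume "z \<in> set L"
      then have [measurable]: "fst z \<in> sets borel" using that by auto
      show "{X \<in> space mset_borel. npoints (fst z) X = real (snd z)} \<in> sets mset_borel"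
        by measurable
    qed simp
    finally show ?thesis .
  qed
  have ind: "indicator (E L) X = (\<Prod>(B, k)\<leftarrow>L. if npoints B X = real k then 1 else 0 :: real)" for L X
  proof -
    have "(\<Prod>(B, k)\<leftarrow>L. if npoints B X = real k then 1 else 0 :: real) = (if \<forall>z\<in>set L. npoints (fst z) X = real (snd z) then 1 else 0)"
      by (induction L) (auto simp: case_prod_beta)
    then show ?thesis by (auto simp: E_def indicator_def case_prod_beta)
  qed
  have me: "measure (distr M mset_borel S) (E L) = measure (distr N mset_borel T) (E L)"
    if L: "fst ` set L \<subseteq> sets borel" for L
  proof -
    have "measure (distr P mset_borel U) (E L) = (\<integral>\<omega>. (\<Prod>(B, k)\<leftarrow>L. if npoints B (U \<omega>) = real k then 1 else 0) \<partial>P)"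
      if "prob_space P" and U [measurable]: "U \<in> P \<rightarrow>\<^sub>M mset_borel" for P :: "'x measure" and U
    proof -
      interpret prob_space P by fact
      have [measurable]: "E L \<in> sets mset_borel" by (rule Esets[OF L])
      have "measure (distr P mset_borel U) (E L) = (\<integral>X. indicator (E L) X \<partial>distr P mset_borel U)"
        by simp
      also have "\<dots> = (\<integral>\<omega>. indicator (E L) (U \<omega>) \<partial>P)"
        by (rule integral_distr) measurable
      finally show ?thesis by (simp add: ind)
    qed
    from this[OF M S] this[OF N T] npoints_indicator_moments_eq[OF M N S T nS(1) nT(1) Nbs L, where Bs = "[]"]
    show ?thesis by simp
  qed
  show "distr M mset_borel S = distr N mset_borel T"
  proof (rule measure_eqI_generator_eq[where E = ?E and \<Omega> = UNIV and A = "\<lambda>_. UNIV"])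
    show "Int_stable ?E"
    proof (rule Int_stableI)
      fix a b assume "a \<in> ?E" "b \<in> ?E"
      then obtain L L' where "a = E L" "b = E L'" and L: "fst ` set L \<subseteq> sets borel" "fst ` set L' \<subseteq> sets borel" by auto
      then have "a \<inter> b = E (L @ L')" by (auto simp: E_def)
      moreover have "fst ` set (L @ L') \<subseteq> sets borel" using L by (simp add: image_Un)
      ultimately show "a \<inter> b \<in> ?E" by blast
    qed
    have "sigma_sets UNIV ?E = sets mset_borel"
    proof
      show "sigma_sets UNIV ?E \<subseteq> sets mset_borel"
        using sets.sigma_sets_subset[of ?E mset_borel] Esets by auto
      show "sets mset_borel \<subseteq> sigma_sets UNIV ?E"
        unfolding sets_mset_borel
      proof (rule sigma_sets_mono')
        show "{{S. size (filter_mset (\<lambda>x. x \<in> B) S) = k} | B k. B \<in> sets borel} \<subseteq> ?E"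
        proof clarify
          fix B k assume "B \<in> sets (borel :: real measure)"
          moreover have "{S. size (filter_mset (\<lambda>x. x \<in> B) S) = k} = E [(B, k)]"
            by (auto simp: E_def npoints_eq_size)
          ultimately show "\<exists>L. {S. size (filter_mset (\<lambda>x. x \<in> B) S) = k} = E L \<and> fst ` set L \<subseteq> sets borel"
            by (intro exI[of _ "[(B, k)]"]) auto
        qed
      qed
    qed
    then show "sets (distr M mset_borel S) = sigma_sets UNIV ?E" "sets (distr N mset_borel T) = sigma_sets UNIV ?E"
      by simp_all
    show "range (\<lambda>_. UNIV) \<subseteq> ?E"
      by (auto simp: E_def intro!: exI[of _ "[]"])
    fix X assume "X \<in> ?E"
    then obtain L where X: "X = E L" "fst ` set L \<subseteq> sets borel" by auto
    interpret DM: prob_space "distr M mset_borel S" by (rule M.prob_space_distr) fact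
    interpret DN: prob_space "distr N mset_borel T" by (rule N.prob_space_distr) fact
    show "emeasure (distr M mset_borel S) X = emeasure (distr N mset_borel T) X"
      using me[OF X(2)] by (simp add: DM.emeasure_eq_measure DN.emeasure_eq_measure X)
  next
    interpret DM: prob_space "distr M mset_borel S" by (rule M.prob_space_distr) fact
    show "emeasure (distr M mset_borel S) UNIV \<noteq> \<infinity>"
      by simp
  qed auto
qed

section \<open>Loop equations\<close>

text \<open>Additivity and the Leibniz rule already annihilate the integers, and the coefficients of
  the loop polynomials are integers.\<close>

definition derivation :: "('r::comm_ring_1 \<Rightarrow> 'r) \<Rightarrow> bool" where
  "derivation D \<longleftrightarrow> (\<forall>f g. D (f + g) = D f + D g) \<and> (\<forall>f g. D (f * g) = D f * g + f * D g)"

lemma derivation_add: "derivation D \<Longrightarrow> D (f + g) = D f + D g"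
  and derivation_mult: "derivation D \<Longrightarrow> D (f * g) = D f * g + f * D g"
  by (auto simp: derivation_def)

lemma derivation_0: "derivation D \<Longrightarrow> D 0 = 0"
  using derivation_add[of D 0 0] by simp

lemma derivation_1: "derivation D \<Longrightarrow> D 1 = 0"
  using derivation_mult[of D 1 1] by simp

lemma derivation_uminus: "derivation D \<Longrightarrow> D (- f) = - D f"
  using derivation_add[of D f "- f"] derivation_0[of D] by (simp add: eq_neg_iff_add_eq_0 add.commute)

lemma derivation_diff: "derivation D \<Longrightarrow> D (f - g) = D f - D g"
  using derivation_add[of D f "- g"] derivation_uminus[of D g] by simp

lemma derivation_of_nat: "derivation D \<Longrightarrow> D (of_nat n) = 0"
  by (induction n) (auto simp: derivation_0 derivation_1 derivation_add)

lemma derivation_of_int: "derivation D \<Longrightarrow> D (of_int n) = 0"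
  by (cases n rule: int_cases2) (auto simp: derivation_of_nat derivation_uminus)

lemma derivation_numeral: "derivation D \<Longrightarrow> D (numeral n) = 0"
  using derivation_of_nat[of D "numeral n"] by simp

lemma derivation_sum: "derivation D \<Longrightarrow> D (\<Sum>i\<in>A. f i) = (\<Sum>i\<in>A. D (f i))"
  by (induction A rule: infinite_finite_induct) (auto simp: derivation_0 derivation_add)

lemma derivation_power2: "derivation D \<Longrightarrow> D (f\<^sup>2) = 2 * f * D f"
  by (simp add: power2_eq_square derivation_mult algebra_simps)

lemmas derivation_simps = derivation_0 derivation_1 derivation_add derivation_mult derivation_uminus
  derivation_diff derivation_of_nat derivation_of_int derivation_numeral derivation_sum derivation_power2

lemma derivation_sum_scaled:
  assumes "\<And>i. i \<in> A \<Longrightarrow> derivation (D i)"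
  shows "derivation (\<lambda>f. \<Sum>i\<in>A. c i * D i f)"
  using assms unfolding derivation_def
  by (auto simp: distrib_left sum.distrib sum_distrib_left sum_distrib_right mult_ac
      intro!: sum.cong arg_cong2[where f = "(+)"])

lemma derivation_scaled: "derivation D \<Longrightarrow> derivation (\<lambda>f. c * D f)"
  unfolding derivation_def by (auto simp: algebra_simps)

lemma derivation_bracket:
  "derivation D \<Longrightarrow> derivation D' \<Longrightarrow> derivation (\<lambda>f. D (D' f) - D' (D f))"
  unfolding derivation_def by (auto simp: algebra_simps)

lemma derivation_pd: "derivation (pd i)"
  unfolding derivation_def by (simp add: pd_add pd_mult)

text \<open>The index map \<open>g\<close> is left free to cover both shifts in use, j + k for
  Laguerre and j + k - 1 for Gaussian loop equations.\<close>

lemma derivation_prod_list: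
  assumes "derivation D" "\<And>k. D (P k) = c * of_nat k * P (g k)"
  shows "D (\<Prod>k\<leftarrow>ks. P k) = c * (\<Sum>j<length ks. of_nat (ks ! j) * (\<Prod>k\<leftarrow>ks[j := g (ks ! j)]. P k))"
proof (induction ks)
  case Nil
  then show ?case using derivation_1[OF assms(1)] by simp
next
  case (Cons k ks)
  then show ?case
    by (simp add: derivation_mult[OF assms(1)] assms(2) sum.lessThan_Suc_shift sum_distrib_left algebra_simps
        del: sum.lessThan_Suc)
qed

section \<open>Derivations acting on traces of matrix powers\<close>

definition tr :: "'r::comm_ring_1 mat \<Rightarrow> 'r" where
  "tr A = (\<Sum>i<dim_row A. A $$ (i, i))"

lemma tr_add: "A \<in> carrier_mat n n \<Longrightarrow> B \<in> carrier_mat n n \<Longrightarrow> tr (A + B) = tr A + tr B"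
  by (simp add: tr_def sum.distrib)

lemma tr_diff: "A \<in> carrier_mat n n \<Longrightarrow> B \<in> carrier_mat n n \<Longrightarrow> tr (A - B) = tr A - tr B"
  by (simp add: tr_def sum_subtractf)

lemma tr_smult: "A \<in> carrier_mat n n \<Longrightarrow> tr (c \<cdot>\<^sub>m A) = c * tr A"
  by (simp add: tr_def sum_distrib_left)

lemma index_mult_sum:
  "A \<in> carrier_mat n m \<Longrightarrow> B \<in> carrier_mat m k \<Longrightarrow> i < n \<Longrightarrow> j < k \<Longrightarrow>
    (A * B) $$ (i, j) = (\<Sum>l<m. A $$ (i, l) * B $$ (l, j))"
  by (simp add: scalar_prod_def atLeast0LessThan)

lemma tr_mult_commute:
  assumes "A \<in> carrier_mat n m" "B \<in> carrier_mat m n"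
  shows "tr (A * B) = tr (B * A)"
proof -
  have "tr (A * B) = (\<Sum>i<n. \<Sum>l<m. A $$ (i, l) * B $$ (l, i))"
    using assms by (simp add: tr_def index_mult_sum del: index_mult_mat(1))
  also have "\<dots> = (\<Sum>l<m. \<Sum>i<n. B $$ (l, i) * A $$ (i, l))"
    by (subst sum.swap) (simp add: mult.commute)
  also have "\<dots> = tr (B * A)"
    using assms by (simp add: tr_def index_mult_sum del: index_mult_mat(1))
  finally show ?thesis .
qed

lemma pow_mat_add:
  assumes "A \<in> carrier_mat n n"
  shows "A ^\<^sub>m (i + j) = A ^\<^sub>m i * A ^\<^sub>m j"
proof (induction j)
  case (Suc j)
  then show ?case
    using assms by (simp add: assoc_mult_mat[OF pow_carrier_mat[OF assms] pow_carrier_mat[OF assms] assms])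
qed (use assms in auto)

lemma derivation_mat_mult:
  assumes D: "derivation D" and A: "A \<in> carrier_mat n n" and B: "B \<in> carrier_mat n n"
  shows "map_mat D (A * B) = map_mat D A * B + A * map_mat D B"
proof (rule eq_matI)
  fix i j assume ij: "i < dim_row (map_mat D A * B + A * map_mat D B)" "j < dim_col (map_mat D A * B + A * map_mat D B)"
  then have "map_mat D (A * B) $$ (i, j) = D (\<Sum>l<n. A $$ (i, l) * B $$ (l, j))"
    using A B by (simp add: index_mult_sum del: index_mult_mat(1))
  also have "\<dots> = (\<Sum>l<n. D (A $$ (i, l)) * B $$ (l, j)) + (\<Sum>l<n. A $$ (i, l) * D (B $$ (l, j)))"
    by (simp add: derivation_simps[OF D] sum.distrib)
  also have "\<dots> = (map_mat D A * B + A * map_mat D B) $$ (i, j)"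
    using A B ij by (simp add: index_mult_sum[where n = n and m = n and k = n] del: index_mult_mat(1))
  finally show "map_mat D (A * B) $$ (i, j) = (map_mat D A * B + A * map_mat D B) $$ (i, j)" .
qed (use A B in auto)

text \<open>The extra power in front is what the induction needs: peeling off the last factor leaves
  one \<open>A\<close> behind the derivative, and cyclicity of the trace moves it to the front. For
  \<open>k = 0\<close> the truncated exponent is multiplied by zero.\<close>

lemma derivation_tr_pow_aux:
  assumes D: "derivation D" and A: "A \<in> carrier_mat n n"
  shows "tr (A ^\<^sub>m m * map_mat D (A ^\<^sub>m k)) = of_nat k * tr (A ^\<^sub>m (m + k - 1) * map_mat D A)"
proof (induction k arbitrary: m)
  case 0
  have "map_mat D (1\<^sub>m n) = 0\<^sub>m n n"
    by (rule eq_matI) (auto simp: derivation_simps[OF D] one_mat_def)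
  then show ?case using A by (simp add: tr_def pow_carrier_mat[OF A])
next
  case (Suc k)
  have Am [simp]: "A ^\<^sub>m i \<in> carrier_mat n n" for i using A by simp
  have DA: "map_mat D B \<in> carrier_mat n n" if "B \<in> carrier_mat n n" for B using that by simp
  let ?D = "map_mat D (A ^\<^sub>m k)"
  have "A ^\<^sub>m m * map_mat D (A ^\<^sub>m Suc k) = A ^\<^sub>m m * (?D * A) + A ^\<^sub>m m * (A ^\<^sub>m k * map_mat D A)"
  proof -
    have X: "?D * A \<in> carrier_mat n n" "A ^\<^sub>m k * map_mat D A \<in> carrier_mat n n"
      using A by auto
    show ?thesis by (simp add: derivation_mat_mult[OF D Am A] mult_add_distrib_mat[OF Am X])
  qed
  moreover have "tr (A ^\<^sub>m m * (?D * A)) = tr (A ^\<^sub>m Suc m * ?D)"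
  proof -
    have "A ^\<^sub>m m * (?D * A) = (A ^\<^sub>m m * ?D) * A"
      using A by (simp add: assoc_mult_mat[OF Am DA[OF Am] A])
    then have "tr (A ^\<^sub>m m * (?D * A)) = tr (A * (A ^\<^sub>m m * ?D))"
      using tr_mult_commute[OF mult_carrier_mat[OF Am[of m] DA[OF Am[of k]]] A] by simp
    also have "A * (A ^\<^sub>m m * ?D) = (A * A ^\<^sub>m m) * ?D"
      by (rule assoc_mult_mat[OF A Am DA[OF Am], symmetric])
    also have "A * A ^\<^sub>m m = A ^\<^sub>m Suc m"
      using pow_mat_add[OF A, of 1 m] A by simp
    finally show ?thesis .
  qed
  moreover have "A ^\<^sub>m m * (A ^\<^sub>m k * map_mat D A) = A ^\<^sub>m (m + k) * map_mat D A"
    using A by (simp add: pow_mat_add[OF A] assoc_mult_mat[OF Am Am DA[OF A]])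
  moreover have "k \<noteq> 0 \<Longrightarrow> Suc m + k - 1 = m + k" by simp
  ultimately have "tr (A ^\<^sub>m m * map_mat D (A ^\<^sub>m Suc k)) =
      of_nat k * tr (A ^\<^sub>m (Suc m + k - 1) * map_mat D A) + tr (A ^\<^sub>m (m + k) * map_mat D A)"
  proof -
    have X: "A ^\<^sub>m m * (?D * A) \<in> carrier_mat n n" "A ^\<^sub>m m * (A ^\<^sub>m k * map_mat D A) \<in> carrier_mat n n"
      using A by auto
    assume f: "A ^\<^sub>m m * map_mat D (A ^\<^sub>m Suc k) = A ^\<^sub>m m * (?D * A) + A ^\<^sub>m m * (A ^\<^sub>m k * map_mat D A)"
      and g: "tr (A ^\<^sub>m m * (?D * A)) = tr (A ^\<^sub>m Suc m * ?D)"
      and h: "A ^\<^sub>m m * (A ^\<^sub>m k * map_mat D A) = A ^\<^sub>m (m + k) * map_mat D A"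
    show ?thesis by (subst f, subst tr_add[OF X], subst g, subst h, subst Suc.IH, rule refl)
  qed
  then show ?case
    by (cases k) (simp_all add: algebra_simps)
qed

lemma derivation_tr_pow:
  assumes "derivation D" "A \<in> carrier_mat n n"
  shows "D (tr (A ^\<^sub>m k)) = of_nat k * tr (A ^\<^sub>m (k - 1) * map_mat D A)"
proof -
  have "D (tr (A ^\<^sub>m k)) = tr (map_mat D (A ^\<^sub>m k))"
    using assms by (simp add: tr_def derivation_simps[OF assms(1)])
  also have "map_mat D (A ^\<^sub>m k) = A ^\<^sub>m 0 * map_mat D (A ^\<^sub>m k)"
    using assms(2) by (simp add: left_mult_one_mat[where nc = n])
  also have "tr \<dots> = of_nat k * tr (A ^\<^sub>m (0 + k - 1) * map_mat D A)"
    by (rule derivation_tr_pow_aux[OF assms])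
  finally show ?thesis by simp
qed

text \<open>The commutator disappears under the trace.\<close>
lemma derivation_tr_pow_Lax:
  assumes D: "derivation D" and A: "A \<in> carrier_mat n n" and K: "K \<in> carrier_mat n n"
    and Lax: "map_mat D A = c \<cdot>\<^sub>m A ^\<^sub>m (k + 1) + (K * A - A * K)"
  shows "D (tr (A ^\<^sub>m j)) = c * of_nat j * tr (A ^\<^sub>m (j + k))"
proof (cases j)
  case 0
  then show ?thesis using derivation_tr_pow[OF D A, of 0] by simp
next
  case (Suc i)
  have Am [simp]: "A ^\<^sub>m i \<in> carrier_mat n n" for i using A by simp
  have "A ^\<^sub>m i * map_mat D A = c \<cdot>\<^sub>m (A ^\<^sub>m i * A ^\<^sub>m (k + 1)) + (A ^\<^sub>m i * (K * A) - A ^\<^sub>m i * (A * K))"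
  proof -
    have X: "c \<cdot>\<^sub>m A ^\<^sub>m (k + 1) \<in> carrier_mat n n" "A ^\<^sub>m (k + 1) \<in> carrier_mat n n"
        "K * A \<in> carrier_mat n n" "A * K \<in> carrier_mat n n" "K * A - A * K \<in> carrier_mat n n"
      using A K pow_carrier_mat[OF A, of "k + 1"] by (auto simp del: pow_mat.simps)
    show ?thesis
      unfolding Lax mult_add_distrib_mat[OF Am X(1,5)] mult_minus_distrib_mat[OF Am X(3,4)]
        mult_smult_distrib[OF Am X(2)] ..
  qed
  moreover have "tr (A ^\<^sub>m i * (K * A)) = tr (A ^\<^sub>m i * (A * K))"
  proof -
    have "tr (A ^\<^sub>m i * (K * A)) = tr ((A ^\<^sub>m i * K) * A)"
      using A K by (simp add: assoc_mult_mat[OF Am K A])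
    also have "\<dots> = tr (A * (A ^\<^sub>m i * K))"
      using A K by (intro tr_mult_commute[where n = n and m = n]) auto
    also have "A * (A ^\<^sub>m i * K) = (A * A ^\<^sub>m i) * K"
      by (rule assoc_mult_mat[OF A Am K, symmetric])
    also have "A * A ^\<^sub>m i = A ^\<^sub>m i * A"
      using pow_mat_add[OF A, of 1 i] A by simp
    also have "\<dots> * K = A ^\<^sub>m i * (A * K)"
      by (rule assoc_mult_mat[OF Am A K])
    finally show ?thesis .
  qed
  ultimately have "tr (A ^\<^sub>m i * map_mat D A) = c * tr (A ^\<^sub>m (i + (k + 1)))"
  proof -
    have X: "A ^\<^sub>m i * A ^\<^sub>m (k + 1) \<in> carrier_mat n n" "c \<cdot>\<^sub>m (A ^\<^sub>m i * A ^\<^sub>m (k + 1)) \<in> carrier_mat n n"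
      "A ^\<^sub>m i * (K * A) \<in> carrier_mat n n" "A ^\<^sub>m i * (A * K) \<in> carrier_mat n n"
      "A ^\<^sub>m i * (K * A) - A ^\<^sub>m i * (A * K) \<in> carrier_mat n n"
      using A K pow_carrier_mat[OF A, of "k + 1"] by (auto simp del: pow_mat.simps)
    assume "A ^\<^sub>m i * map_mat D A = c \<cdot>\<^sub>m (A ^\<^sub>m i * A ^\<^sub>m (k + 1)) + (A ^\<^sub>m i * (K * A) - A ^\<^sub>m i * (A * K))"
      and "tr (A ^\<^sub>m i * (K * A)) = tr (A ^\<^sub>m i * (A * K))"
    then show ?thesis
      by (simp only: tr_add[OF X(2,5)] tr_diff[OF X(3,4)] tr_smult[OF X(1)] pow_mat_add[OF A, of i "k + 1"]) simp
  qed
  then show ?thesis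
    using derivation_tr_pow[OF D A, of j] Suc by (simp del: pow_mat.simps add: mult_ac)
qed

text \<open>Twice the divergence of the field \<Sum> x_i^(k+1) d/dx_i against the squared
  Vandermonde determinant times the Laguerre weight; doubling clears the fractions a / 2 - 1 and 1 /
  2. The diagonal of the Vandermonde double sum cancels the plain divergence (k + 1) P_k.\<close>

definition loop_poly :: "int \<Rightarrow> (nat \<Rightarrow> 'r::comm_ring_1) \<Rightarrow> nat \<Rightarrow> 'r" where
  "loop_poly a P k = 2 * (\<Sum>i\<le>k. P i * P (k - i)) + of_int (a - 2) * P k - P (k + 1)"

text \<open>The \<open>k\<close>-th loop equation of a Laguerre ensemble with weight \<open>x\<close> to the power \<open>a / 2 - 1\<close> times \<open>exp (- x / 2)\<close>,
  in the form of integration by parts along a vector field acting on the power sums \<open>P\<close> like \<open>\<Sum>\<^sub>i x\<^sub>i\<^sup>k\<^sup>+\<^sup>1 \<partial>\<^sub>i\<close>.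
  The factor \<open>c\<close> makes the notion stable under brackets without any division.\<close>
definition virasoro :: "('r::comm_ring_1 \<Rightarrow> complex) \<Rightarrow> int \<Rightarrow> (nat \<Rightarrow> 'r) \<Rightarrow> nat \<Rightarrow> bool" where
  "virasoro E a P k \<longleftrightarrow> (\<exists>V c. derivation V \<and> c \<noteq> 0 \<and> (\<forall>j. V (P j) = of_int c * of_nat j * P (j + k)) \<and>
     (\<forall>f. E (2 * V f + of_int c * (loop_poly a P k * f)) = 0))"

text \<open>The sum is averaged with its reflection under j to m - j; the factor 2 stays on the left
  since the ring has no division.\<close>

lemma sum_weighted_symmetric:
  fixes P :: "nat \<Rightarrow> 'r::comm_ring_1"
  shows "2 * (\<Sum>j\<le>m. of_nat j * (P j * P (m - j))) = of_nat m * (\<Sum>j\<le>m. P j * P (m - j))"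
proof -
  have "(\<Sum>j\<le>m. of_nat j * (P j * P (m - j))) = (\<Sum>j\<le>m. of_nat (m - j) * (P (m - j) * P j))"
    by (rule sum.reindex_bij_witness[of _ "\<lambda>j. m - j" "\<lambda>j. m - j"]) auto
  then have "2 * (\<Sum>j\<le>m. of_nat j * (P j * P (m - j))) =
      (\<Sum>j\<le>m. of_nat j * (P j * P (m - j)) + of_nat (m - j) * (P (m - j) * P j))"
    by (simp add: sum.distrib)
  also have "\<dots> = (\<Sum>j\<le>m. of_nat m * (P j * P (m - j)))"
    by (rule sum.cong) (auto simp: of_nat_diff algebra_simps)
  finally show ?thesis by (simp add: sum_distrib_left)
qed

lemma derivation_loop_poly:
  assumes D: "derivation D" and P: "\<And>j. D (P j) = c * of_nat j * P (j + l)"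
  shows "D (loop_poly a P k) = c * (4 * (\<Sum>i\<le>k. of_nat i * (P (i + l) * P (k - i))) + of_int (a - 2) * of_nat k * P (k + l)
     - of_nat (k + 1) * P (k + 1 + l))"
proof -
  have "(\<Sum>i\<le>k. P i * (of_nat (k - i) * P (k - i + l))) = (\<Sum>i\<le>k. of_nat i * (P (i + l) * P (k - i)))"
    by (rule sum.reindex_bij_witness[of _ "\<lambda>j. k - j" "\<lambda>j. k - j"]) (auto simp: mult_ac)
  then have "(\<Sum>i\<le>k. D (P i * P (k - i))) = c * (2 * (\<Sum>i\<le>k. of_nat i * (P (i + l) * P (k - i))))"
    by (simp add: derivation_mult[OF D] P sum.distrib mult_ac flip: sum_distrib_left)
  then show ?thesis
    by (simp add: loop_poly_def derivation_simps[OF D] P algebra_simps)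
qed

text \<open>Divergences of a bracket are compatible: V_1 of the k-th loop polynomial minus V_k of
  the first is (k - 1) times the next one. The weights \<open>i\<close> in the quadratic sum
  disappear after an index shift and the reflection symmetry.\<close>

lemma loop_poly_bracket:
  fixes P :: "nat \<Rightarrow> 'r::comm_ring_1"
  assumes "k \<ge> 1"
  shows "4 * (\<Sum>i\<le>k. of_nat i * (P (i + 1) * P (k - i))) + of_int (a - 2) * of_nat k * P (k + 1)
     - of_nat (k + 1) * P (k + 1 + 1) -
    (4 * (\<Sum>i\<le>1. of_nat i * (P (i + k) * P (1 - i))) + of_int (a - 2) * of_nat 1 * P (1 + k)
     - of_nat (1 + 1) * P (1 + 1 + k)) = of_int (int k - 1) * loop_poly a P (k + 1)"
proof -
  have "(\<Sum>j\<le>k + 1. of_nat j * (P j * P (k + 1 - j))) = (\<Sum>i\<le>k. of_nat (Suc i) * (P (Suc i) * P (k - i)))"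
    by (simp only: Suc_eq_plus1[symmetric] sum.atMost_Suc_shift) simp
  also have "\<dots> = (\<Sum>i\<le>k. of_nat i * (P (i + 1) * P (k - i))) + (\<Sum>i\<le>k. P (Suc i) * P (k - i))"
    by (simp add: distrib_right sum.distrib)
  finally have 1: "(\<Sum>i\<le>k. of_nat i * (P (i + 1) * P (k - i))) =
      (\<Sum>j\<le>k + 1. of_nat j * (P j * P (k + 1 - j))) - (\<Sum>i\<le>k. P (Suc i) * P (k - i))" by simp
  have 2: "(\<Sum>j\<le>k + 1. P j * P (k + 1 - j)) = P 0 * P (k + 1) + (\<Sum>i\<le>k. P (Suc i) * P (k - i))"
    by (simp only: Suc_eq_plus1[symmetric] sum.atMost_Suc_shift) simp
  define S where "S = (\<Sum>i\<le>k. P (Suc i) * P (k - i))"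
  have 3: "4 * (\<Sum>j\<le>k + 1. of_nat j * (P j * P (k + 1 - j))) = 2 * of_nat (k + 1) * (P 0 * P (k + 1) + S)"
  proof -
    have "4 * x = 2 * (2 * x)" for x :: 'r by simp
    then show ?thesis
      by (simp only: sum_weighted_symmetric[where m = "k + 1" and P = P] 2 S_def[symmetric] mult.assoc)
  qed
  have "4 * (\<Sum>i\<le>k. of_nat i * (P (i + 1) * P (k - i))) = 2 * of_nat (k + 1) * (P 0 * P (k + 1) + S) - 4 * S"
    unfolding 1 S_def[symmetric] right_diff_distrib 3 ..
  then show ?thesis
    unfolding loop_poly_def 2 S_def[symmetric] by (simp add: algebra_simps)
qed

text \<open>Since \<open>[V\<^sub>1, V\<^sub>k]\<close> is \<open>(k - 1) V\<^sub>k\<^sub>+\<^sub>1\<close> on power sums, the equations for \<open>k \<le> 2\<close> generate all of them.\<close>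
lemma virasoro_bracket:
  assumes E: "\<And>f g. E (f + g) = E f + E g" "E 0 = 0"
    and 1: "virasoro E a P 1" and k: "virasoro E a P k" "k \<ge> 2"
  shows "virasoro E a P (k + 1)"
proof -
  obtain V c where V: "derivation V" "c \<noteq> 0" "\<And>j. V (P j) = of_int c * of_nat j * P (j + 1)"
    "\<And>f. E (2 * V f + of_int c * (loop_poly a P 1 * f)) = 0"
    using 1 unfolding virasoro_def by blast
  obtain W d where W: "derivation W" "d \<noteq> 0" "\<And>j. W (P j) = of_int d * of_nat j * P (j + k)"
    "\<And>f. E (2 * W f + of_int d * (loop_poly a P k * f)) = 0"
    using k(1) unfolding virasoro_def by blast
  have Em: "E (- f) = - E f" for f using E(1)[of f "- f"] E(2) by (simp add: eq_neg_iff_add_eq_0 add.commute)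
  let ?G1 = "loop_poly a P 1" and ?Gk = "loop_poly a P k"
  let ?B = "\<lambda>f. V (W f) - W (V f)"
  let ?e = "c * d * (int k - 1)"
  have G: "of_int d * V ?Gk - of_int c * W ?G1 = of_int ?e * loop_poly a P (k + 1)"
  proof -
    have "k \<ge> 1" using k by simp
    note b = loop_poly_bracket[OF this, where P = P and a = a, unfolded mult.assoc]
    have "of_int d * (of_int c * x) - of_int c * (of_int d * y) = of_int c * of_int d * (x - y)" for x y :: 'a
      by (simp add: algebra_simps)
    then show ?thesis
      unfolding derivation_loop_poly[OF V(1,3)] derivation_loop_poly[OF W(1,3)]
      by (simp only: b of_int_mult mult.assoc)
  qed
  have "E (2 * ?B f + of_int ?e * (loop_poly a P (k + 1) * f)) = 0" for f
  proof -
    \<comment> \<open>The identity for V tested on the one for W, and conversely. In the difference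
      the second-order terms form the bracket and the products with both loop polynomials
      cancel.\<close>
    let ?x = "2 * V (2 * W f + of_int d * (?Gk * f)) + of_int c * (?G1 * (2 * W f + of_int d * (?Gk * f)))"
    let ?y = "2 * W (2 * V f + of_int c * (?G1 * f)) + of_int d * (?Gk * (2 * V f + of_int c * (?G1 * f)))"
    have "?x - ?y = 2 * (2 * ?B f + (of_int d * V ?Gk - of_int c * W ?G1) * f)"
      by (simp add: derivation_simps[OF V(1)] derivation_simps[OF W(1)] algebra_simps)
    also have "\<dots> = 2 * (2 * ?B f + of_int ?e * (loop_poly a P (k + 1) * f))"
      unfolding G by (simp add: mult.assoc)
    finally have xy0: "?x - ?y = 2 * (2 * ?B f + of_int ?e * (loop_poly a P (k + 1) * f))" .
    have xy: "?x + - ?y = (2 * ?B f + of_int ?e * (loop_poly a P (k + 1) * f)) + (2 * ?B f + of_int ?e * (loop_poly a P (k + 1) * f))"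
      unfolding diff_conv_add_uminus[symmetric] xy0 by (rule mult_2)
    have "E (?x + - ?y) = 0" unfolding E(1)[of ?x] Em V(4) W(4) by simp
    then show ?thesis unfolding xy E(1)[of "2 * ?B f + of_int ?e * (loop_poly a P (k + 1) * f)"] by simp
  qed
  moreover have "?B (P j) = of_int ?e * of_nat j * P (j + (k + 1))" for j
    by (simp add: V(3) W(3) derivation_simps[OF V(1)] derivation_simps[OF W(1)] algebra_simps)
  \<comment> \<open>This is where \<open>k \<ge> 2\<close> enters: bracketing V_1 with itself would
    give the factor 0.\<close>
  moreover have "?e \<noteq> 0" using V W k by simp
  ultimately show ?thesis
    unfolding virasoro_def using derivation_bracket[OF V(1) W(1)] by blast
qed

lemma virasoro_all:
  assumes E: "\<And>f g. E (f + g) = E f + E g" "E 0 = 0"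
    and "virasoro E a P 0" "virasoro E a P 1" "virasoro E a P 2"
  shows "virasoro E a P k"
proof (induction k rule: less_induct)
  case (less k)
  show ?case
  proof (cases "k \<le> 2")
    case True
    then consider "k = 0" | "k = 1" | "k = 2" by linarith
    then show ?thesis using assms by cases auto
  next
    case False
    then obtain l where "k = l + 1" "l \<ge> 2" using that[of "k - 1"] by auto
    then show ?thesis using virasoro_bracket[where E = E, OF E assms(4) less(1)[of l]] by auto
  qed
qed

text \<open>The loop equations tested on products of power sums. Symmetry of \<open>\<phi>\<close>
  in its list is not part of the notion, because the recursion always consumes the head.\<close>

definition lue_recursion :: "int \<Rightarrow> nat \<Rightarrow> (nat list \<Rightarrow> complex) \<Rightarrow> bool" where
  "lue_recursion a p \<phi> \<longleftrightarrow> (\<forall>ks. \<phi> (0 # ks) = of_nat p * \<phi> ks) \<and>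
    (\<forall>k ks. \<phi> (Suc k # ks) = of_int (a - 2) * \<phi> (k # ks) + 2 * (\<Sum>i\<le>k. \<phi> (i # (k - i) # ks)) +
       2 * (\<Sum>j<length ks. of_nat (ks ! j) * \<phi> (ks[j := ks ! j + k])))"

text \<open>If \<open>ks ! j + k = 0\<close>, the truncated difference in the last sum is multiplied by zero.\<close>
definition gue_recursion :: "nat \<Rightarrow> (nat list \<Rightarrow> complex) \<Rightarrow> bool" where
  "gue_recursion n \<phi> \<longleftrightarrow> (\<forall>ks. \<phi> (0 # ks) = of_nat n * \<phi> ks) \<and>
    (\<forall>k ks. \<phi> (Suc k # ks) = (\<Sum>i<k. \<phi> (i # (k - 1 - i) # ks)) +
       (\<Sum>j<length ks. of_nat (ks ! j) * \<phi> (ks[j := ks ! j + k - 1])))"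

lemma sum_list_update_nat:
  fixes ks :: "nat list"
  shows "j < length ks \<Longrightarrow> sum_list (ks[j := x]) + ks ! j = sum_list ks + x"
  by (induction ks arbitrary: j) (auto split: nat.splits)

text \<open>Every term on the right has a smaller value of twice the sum plus the length: splitting
  the head lowers the sum by one and lengthens the list by one. Cross-multiplication by the values
  at the empty list avoids division.\<close>

lemma lue_recursion_unique:
  assumes "lue_recursion a p \<phi>" "lue_recursion a p \<psi>"
  shows "\<phi> ks * \<psi> [] = \<psi> ks * \<phi> []"
proof (induction ks rule: measure_induct_rule[where f = "\<lambda>ks. 2 * sum_list ks + length ks"])
  case (less ks)
  consider "ks = []" | l where "ks = 0 # l" | k l where "ks = Suc k # l"
    by (metis neq_Nil_conv not0_implies_Suc)
  then show ?case
  proof cases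
    case 2
    have "\<phi> l * \<psi> [] = \<psi> l * \<phi> []" by (rule less) (simp add: 2)
    then show ?thesis using assms by (simp add: 2 lue_recursion_def mult.assoc)
  next
    case (3 k l)
    have 1: "\<phi> (k # l) * \<psi> [] = \<psi> (k # l) * \<phi> []" by (rule less) (simp add: 3)
    have 2: "(\<Sum>i\<le>k. \<phi> (i # (k - i) # l)) * \<psi> [] = (\<Sum>i\<le>k. \<psi> (i # (k - i) # l)) * \<phi> []"
      unfolding sum_distrib_right by (rule sum.cong[OF refl], rule less) (simp add: 3)
    have 4: "(\<Sum>j<length l. of_nat (l ! j) * \<phi> (l[j := l ! j + k])) * \<psi> [] =
        (\<Sum>j<length l. of_nat (l ! j) * \<psi> (l[j := l ! j + k])) * \<phi> []"
      unfolding sum_distrib_right mult.assoc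
    proof (rule sum.cong[OF refl])
      fix j assume j: "j \<in> {..<length l}"
      have "\<phi> (l[j := l ! j + k]) * \<psi> [] = \<psi> (l[j := l ! j + k]) * \<phi> []"
        by (rule less) (use j sum_list_update_nat[of j l "l ! j + k"] in \<open>auto simp: 3\<close>)
      then show "of_nat (l ! j) * (\<phi> (l[j := l ! j + k]) * \<psi> []) = of_nat (l ! j) * (\<psi> (l[j := l ! j + k]) * \<phi> [])"
        by simp
    qed
    have "\<phi> ks * \<psi> [] = of_int (a - 2) * (\<phi> (k # l) * \<psi> []) + 2 * ((\<Sum>i\<le>k. \<phi> (i # (k - i) # l)) * \<psi> []) +
        2 * ((\<Sum>j<length l. of_nat (l ! j) * \<phi> (l[j := l ! j + k])) * \<psi> [])"
    proof -
      have "\<phi> ks = of_int (a - 2) * \<phi> (k # l) + 2 * (\<Sum>i\<le>k. \<phi> (i # (k - i) # l)) +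
          2 * (\<Sum>j<length l. of_nat (l ! j) * \<phi> (l[j := l ! j + k]))"
        using assms(1) unfolding 3 lue_recursion_def by blast
      then show ?thesis by (simp only: distrib_right mult.assoc)
    qed
    also have "\<dots> = \<psi> ks * \<phi> []"
    proof -
      have "\<psi> ks = of_int (a - 2) * \<psi> (k # l) + 2 * (\<Sum>i\<le>k. \<psi> (i # (k - i) # l)) +
          2 * (\<Sum>j<length l. of_nat (l ! j) * \<psi> (l[j := l ! j + k]))"
        using assms(2) unfolding 3 lue_recursion_def by blast
      then show ?thesis unfolding 1 2 4 by (simp only: distrib_right mult.assoc)
    qed
    finally show ?thesis .
  qed simp
qed

lemma gue_recursion_unique:
  assumes "gue_recursion n \<phi>" "gue_recursion n \<psi>"
  shows "\<phi> ks * \<psi> [] = \<psi> ks * \<phi> []"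
proof (induction ks rule: measure_induct_rule[where f = "\<lambda>ks. 2 * sum_list ks + length ks"])
  case (less ks)
  consider "ks = []" | l where "ks = 0 # l" | k l where "ks = Suc k # l"
    by (metis neq_Nil_conv not0_implies_Suc)
  then show ?case
  proof cases
    case 2
    have "\<phi> l * \<psi> [] = \<psi> l * \<phi> []" by (rule less) (simp add: 2)
    then show ?thesis using assms by (simp add: 2 gue_recursion_def mult.assoc)
  next
    case (3 k l)
    have 2: "(\<Sum>i<k. \<phi> (i # (k - 1 - i) # l)) * \<psi> [] = (\<Sum>i<k. \<psi> (i # (k - 1 - i) # l)) * \<phi> []"
      unfolding sum_distrib_right by (rule sum.cong[OF refl], rule less) (auto simp: 3)
    have 4: "(\<Sum>j<length l. of_nat (l ! j) * \<phi> (l[j := l ! j + k - 1])) * \<psi> [] =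
        (\<Sum>j<length l. of_nat (l ! j) * \<psi> (l[j := l ! j + k - 1])) * \<phi> []"
      unfolding sum_distrib_right mult.assoc
    proof (rule sum.cong[OF refl])
      fix j assume j: "j \<in> {..<length l}"
      have "\<phi> (l[j := l ! j + k - 1]) * \<psi> [] = \<psi> (l[j := l ! j + k - 1]) * \<phi> []"
        by (rule less) (use j sum_list_update_nat[of j l "l ! j + k - 1"] in \<open>auto simp: 3\<close>)
      then show "of_nat (l ! j) * (\<phi> (l[j := l ! j + k - 1]) * \<psi> []) = of_nat (l ! j) * (\<psi> (l[j := l ! j + k - 1]) * \<phi> [])"
        by simp
    qed
    have "\<phi> ks * \<psi> [] = (\<Sum>i<k. \<phi> (i # (k - 1 - i) # l)) * \<psi> [] +
        (\<Sum>j<length l. of_nat (l ! j) * \<phi> (l[j := l ! j + k - 1])) * \<psi> []"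
      using assms(1) by (simp add: 3 gue_recursion_def algebra_simps)
    also have "\<dots> = \<psi> ks * \<phi> []"
      unfolding 2 4 using assms(2) by (simp add: 3 gue_recursion_def algebra_simps)
    finally show ?thesis .
  qed simp
qed

text \<open>On a product of power sums the field yields the terms that raise one index of
  \<open>ks\<close>, while the loop polynomial yields the others; the nonzero integer
  \<open>c\<close> cancels after \<open>E\<close> is applied.\<close>

lemma lue_recursion_virasoro:
  fixes E :: "'i cpoly \<Rightarrow> complex"
  assumes E: "\<And>f g. E (f + g) = E f + E g" "\<And>k f. E (of_int k * f) = of_int k * E f"
    and v: "\<And>k. virasoro E a P k" and P0: "P 0 = of_nat p"
  shows "lue_recursion a p (\<lambda>ks. E (\<Prod>k\<leftarrow>ks. P k))"
proof -
  have E0: "E 0 = 0" using E(2)[of 0 0] by simp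
  have Esum: "E (\<Sum>i\<in>A. f i) = (\<Sum>i\<in>A. E (f i))" for A :: "nat set" and f
    by (induction A rule: infinite_finite_induct) (auto simp: E0 E(1))
  have Enat: "E (of_nat k * f) = of_nat k * E f" for k f
    using E(2)[of "int k" f] by simp
  have E2: "E (2 * f) = 2 * E f" for f using Enat[of 2 f] by simp
  have "E (\<Prod>k\<leftarrow>Suc k # ks. P k) = of_int (a - 2) * E (\<Prod>k\<leftarrow>k # ks. P k) + 2 * (\<Sum>i\<le>k. E (\<Prod>k\<leftarrow>i # (k - i) # ks. P k)) +
       2 * (\<Sum>j<length ks. of_nat (ks ! j) * E (\<Prod>k\<leftarrow>ks[j := ks ! j + k]. P k))" for k ks
  proof -
    obtain V c where V: "derivation V" "c \<noteq> 0" "\<And>j. V (P j) = of_int c * of_nat j * P (j + k)"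
      "\<And>f. E (2 * V f + of_int c * (loop_poly a P k * f)) = 0"
      using v[of k] unfolding virasoro_def by blast
    let ?Q = "\<Prod>k\<leftarrow>ks. P k"
    let ?S = "\<Sum>j<length ks. of_nat (ks ! j) * (\<Prod>k\<leftarrow>ks[j := ks ! j + k]. P k)"
    have "2 * V ?Q + of_int c * (loop_poly a P k * ?Q) = of_int c * (2 * ?S + loop_poly a P k * ?Q)"
      by (simp add: derivation_prod_list[OF V(1,3)] algebra_simps)
    then have "of_int c * E (2 * ?S + loop_poly a P k * ?Q) = 0"
      using V(4)[of ?Q] by (simp add: E(2))
    then have "E (2 * ?S + loop_poly a P k * ?Q) = 0" using V(2) by simp
    then have "E (P (Suc k) * ?Q) = E (2 * ?S + loop_poly a P k * ?Q + P (Suc k) * ?Q)"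
      by (simp only: E(1)[of "2 * ?S + loop_poly a P k * ?Q" "P (Suc k) * ?Q"]) simp
    also have "2 * ?S + loop_poly a P k * ?Q + P (Suc k) * ?Q = 2 * ?S + (2 * (\<Sum>i\<le>k. P i * P (k - i) * ?Q) + of_int (a - 2) * (P k * ?Q))"
      by (simp add: loop_poly_def algebra_simps sum_distrib_left sum_distrib_right)
    finally show ?thesis
      unfolding E(1) E(2) E2 Esum Enat by (simp add: mult.assoc)
  qed
  moreover have "E (\<Prod>k\<leftarrow>0 # ks. P k) = of_nat p * E (\<Prod>k\<leftarrow>ks. P k)" for ks
    by (simp add: P0 Enat)
  ultimately show ?thesis unfolding lue_recursion_def by blast
qed

section \<open>Virasoro fields on bidiagonal matrices\<close>

text \<open>\<open>xx p (2 i + 1)\<close> and \<open>xx p (2 i + 2)\<close> are the diagonal and the subdiagonal entry of column \<open>i\<close> (counted from 0)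
  of a lower bidiagonal matrix of order \<open>p\<close>. Integer indices and zero padding spare the boundary cases.\<close>
definition xx :: "nat \<Rightarrow> int \<Rightarrow> nat cpoly" where
  "xx p n = (if 1 \<le> n \<and> n < 2 * int p then Var (nat n) else 0)"

abbreviation uu :: "nat \<Rightarrow> int \<Rightarrow> nat cpoly" where "uu p n \<equiv> (xx p n)\<^sup>2"

definition ss :: "nat \<Rightarrow> int \<Rightarrow> nat cpoly" where "ss p m = (\<Sum>l\<in>{1..m}. uu p l)"

definition dd :: "nat \<Rightarrow> int \<Rightarrow> nat cpoly" where
  "dd p n = 2 * ss p (n - 1) + of_int n * (uu p n + uu p (n + 1) + uu p (n + 2) + uu p (n + 3))"

text \<open>The vector fields \<open>V\<^sub>k = \<Sum>\<^sub>n vv k n x\<^sub>n \<partial>\<^sub>n\<close> solve \<open>V\<^sub>k L = 2 L\<^sup>k\<^sup>+\<^sup>1 + [L, K\<^sub>k]\<close>, where \<open>L\<close> is the Gram matrix of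
  the bidiagonal matrix and \<open>K\<^sub>k\<close> a banded skew-symmetric matrix; \<open>ss\<close> and \<open>dd\<close> are forced by the second off-diagonal.
  Only \<open>k \<le> 2\<close> is meaningful. The polynomial \<open>ee k n\<close> is \<open>x\<^sub>n \<partial>\<^sub>n\<close> of \<open>vv k n\<close>.\<close>
fun vv :: "nat \<Rightarrow> nat \<Rightarrow> int \<Rightarrow> nat cpoly" where
  "vv p 0 n = 1"
| "vv p (Suc 0) n = uu p n + of_int n * uu p (n + 1) - of_int (n - 3) * uu p (n - 1)"
| "vv p (Suc (Suc k)) n = (uu p n)\<^sup>2 + 2 * uu p n * (uu p (n - 1) + uu p (n + 1)) + (uu p (n - 1))\<^sup>2 + (uu p (n + 1))\<^sup>2
     + uu p (n - 1) * uu p (n + 1) + uu p (n - 1) * uu p (n - 2) + uu p (n + 1) * uu p (n + 2)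
     + dd p (n - 1) * uu p (n + 1) - dd p (n - 2) * uu p (n - 1)"

fun ee :: "nat \<Rightarrow> nat \<Rightarrow> int \<Rightarrow> nat cpoly" where
  "ee p 0 n = 0"
| "ee p (Suc 0) n = 2 * uu p n"
| "ee p (Suc (Suc k)) n = 4 * (uu p n)\<^sup>2 + 4 * uu p n * (uu p (n - 1) + uu p (n + 1))
     + 2 * of_int (n - 1) * uu p n * uu p (n + 1) - 2 * of_int (n - 2) * uu p n * uu p (n - 1)"

lemma xx_outside: "n \<le> 0 \<Longrightarrow> xx p n = 0" "n \<ge> 2 * int p \<Longrightarrow> xx p n = 0"
  by (auto simp: xx_def)

text \<open>Holds for every integer: below 1 both sums are empty and the padded entry is
  zero.\<close>

lemma ss_rec: "ss p m = ss p (m - 1) + uu p m"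
proof (cases "m \<ge> 1")
  case True
  then have "{1..m} = insert m {1..m - 1}" by auto
  then show ?thesis by (simp add: ss_def)
qed (simp add: ss_def xx_def)

lemma ss_nonpos: "m \<le> 0 \<Longrightarrow> ss p m = 0"
  by (simp add: ss_def)

definition virasoro_field :: "nat \<Rightarrow> nat \<Rightarrow> nat cpoly \<Rightarrow> nat cpoly" where
  "virasoro_field p k f = (\<Sum>n\<in>{1..<2 * p}. (Var n * vv p k (int n)) * pd n f)"

lemma derivation_virasoro_field: "derivation (virasoro_field p k)"
  unfolding virasoro_field_def by (rule derivation_sum_scaled) (rule derivation_pd)

lemma virasoro_field_xx: "virasoro_field p k (xx p n) = xx p n * vv p k n"
proof (cases "1 \<le> n \<and> n < 2 * int p")
  case True
  then have "virasoro_field p k (xx p n) = (\<Sum>m\<in>{1..<2 * p}. if m = nat n then Var m * vv p k (int m) else 0)"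
    unfolding virasoro_field_def by (intro sum.cong) (auto simp: xx_def pd_Var)
  then show ?thesis using True by (auto simp: sum.delta xx_def)
next
  case False
  then show ?thesis by (auto simp: xx_def derivation_0[OF derivation_virasoro_field])
qed

lemma euler_xx:
  assumes "m \<in> {1..<2 * p}"
  shows "Var m * pd m (xx p n) = (if n = int m then xx p n else 0)"
  using assms by (auto simp: xx_def pd_Var derivation_simps[OF derivation_pd])

lemma euler_uu:
  assumes "m \<in> {1..<2 * p}"
  shows "Var m * pd m (uu p n) = (if n = int m then 2 * uu p n else 0)"
proof -
  have "Var m * pd m (uu p n) = 2 * xx p n * (Var m * pd m (xx p n))"
    by (simp add: derivation_power2[OF derivation_pd] mult_ac)
  then show ?thesis by (simp add: euler_xx[OF assms] power2_eq_square mult_ac)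
qed

lemma euler_ss:
  assumes "m \<in> {1..<2 * p}" "n < int m"
  shows "Var m * pd m (ss p n) = 0"
  unfolding ss_def derivation_sum[OF derivation_pd] sum_distrib_left
  by (rule sum.neutral) (use assms in \<open>auto simp: euler_uu\<close>)

text \<open>The partial sums inside \<open>dd p (n - 1)\<close> and \<open>dd p (n - 2)\<close> stop
  before index n, so the variable n enters \<open>vv\<close> only through the local terms.\<close>

lemma euler_vv:
  assumes m: "m \<in> {1..<2 * p}" and k: "k \<le> 2"
  shows "Var m * pd m (vv p k (int m)) = ee p k (int m)"
proof -
  define T where "T f = Var m * pd m f" for f
  have T: "derivation T" unfolding T_def[abs_def] by (rule derivation_scaled[OF derivation_pd])
  have Tu: "T (uu p n) = (if n = int m then 2 * uu p n else 0)" for n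
    unfolding T_def by (rule euler_uu[OF m])
  have Ts: "T (ss p n) = 0" if "n < int m" for n
    unfolding T_def by (rule euler_ss[OF m that])
  have "T (vv p k (int m)) = ee p k (int m)"
  proof -
    consider "k = 0" | "k = Suc 0" | "k = Suc (Suc 0)" using k by linarith
    then show ?thesis
    proof cases
      case 3
      have 1: "T (dd p (int m - 1)) = 2 * of_int (int m - 1) * uu p (int m)"
        unfolding dd_def by (simp add: derivation_add[OF T] derivation_mult[OF T] derivation_numeral[OF T]
            derivation_of_int[OF T] derivation_diff[OF T] derivation_of_nat[OF T] derivation_1[OF T] Tu Ts algebra_simps)
      have 2: "T (dd p (int m - 2)) = 2 * of_int (int m - 2) * uu p (int m)"
        unfolding dd_def by (simp add: derivation_add[OF T] derivation_mult[OF T] derivation_numeral[OF T]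
            derivation_of_int[OF T] derivation_diff[OF T] derivation_of_nat[OF T] derivation_1[OF T] Tu Ts algebra_simps)
      have sq: "T (f\<^sup>2) = 2 * f * T f" for f by (rule derivation_power2[OF T])
      show ?thesis unfolding 3 vv.simps ee.simps derivation_add[OF T] derivation_diff[OF T] derivation_mult[OF T]
          derivation_numeral[OF T] 1 2 sq[of "uu p _"] Tu
        by (simp add: algebra_simps power2_eq_square)
    next
      case 2
      show ?thesis unfolding 2 vv.simps ee.simps derivation_add[OF T] derivation_diff[OF T] derivation_mult[OF T]
          derivation_of_int[OF T] Tu by simp
    qed (simp add: derivation_1[OF T])
  qed
  then show ?thesis by (simp add: T_def)
qed

section \<open>The tridiagonal Gram matrix and its Lax equations\<close>

definition gram :: "nat \<Rightarrow> int \<Rightarrow> int \<Rightarrow> nat cpoly" where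
  "gram p i j = (if i = j then uu p (2 * i + 1) + uu p (2 * i + 2)
     else if j = i + 1 then xx p (2 * i + 2) * xx p (2 * i + 3)
     else if i = j + 1 then xx p (2 * i) * xx p (2 * i + 1) else 0)"

text \<open>Multiplication by a tridiagonal matrix as a three-term sum over integer indices. The
  entries of \<open>gram\<close> that link -1 to 0 and p - 1 to p vanish by padding, so inside the
  window this is the genuine matrix product.\<close>

definition mulL :: "nat \<Rightarrow> (int \<Rightarrow> int \<Rightarrow> nat cpoly) \<Rightarrow> int \<Rightarrow> int \<Rightarrow> nat cpoly" where
  "mulL p f i j = gram p i (i - 1) * f (i - 1) j + gram p i i * f i j + gram p i (i + 1) * f (i + 1) j"

definition mulR :: "nat \<Rightarrow> (int \<Rightarrow> int \<Rightarrow> nat cpoly) \<Rightarrow> int \<Rightarrow> int \<Rightarrow> nat cpoly" where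
  "mulR p f i j = f i (j - 1) * gram p (j - 1) j + f i j * gram p j j + f i (j + 1) * gram p (j + 1) j"

definition imat :: "nat \<Rightarrow> (int \<Rightarrow> int \<Rightarrow> nat cpoly) \<Rightarrow> nat cpoly mat" where
  "imat p f = mat p p (\<lambda>(i, j). f (int i) (int j))"

lemma imat_carrier [simp]: "imat p f \<in> carrier_mat p p"
  by (simp add: imat_def)

lemma sum_window:
  fixes g :: "int \<Rightarrow> 'r::comm_ring_1"
  assumes "\<And>l. l \<notin> {i - 1, i, i + 1} \<Longrightarrow> g l = 0" "\<And>l. l < 0 \<or> l \<ge> int p \<Longrightarrow> g l = 0"
  shows "(\<Sum>l<p. g (int l)) = g (i - 1) + g i + g (i + 1)"
proof -
  have "(\<Sum>l<p. g (int l)) = sum g (int ` {..<p})"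
    by (simp add: sum.reindex)
  also have "int ` {..<p} = {0..<int p}"
    by (auto simp: image_iff intro!: bexI[of _ "nat _"])
  also have "sum g {0..<int p} = sum g ({0..<int p} \<union> {i - 1, i, i + 1})"
    by (rule sum.mono_neutral_left) (use assms(2) in auto)
  also have "\<dots> = sum g {i - 1, i, i + 1}"
    by (rule sum.mono_neutral_right) (use assms(1) in auto)
  finally show ?thesis by (simp add: add.assoc)
qed

lemma imat_mulL:
  shows "imat p (gram p) * imat p f = imat p (mulL p f)"
proof (rule eq_matI)
  fix i j assume "i < dim_row (imat p (mulL p f))" "j < dim_col (imat p (mulL p f))"
  then have ij: "i < p" "j < p" by (auto simp: imat_def)
  \<comment> \<open>Since \<open>f\<close> is arbitrary outside the window, it is first cut off
    there; the cut-off disappears again because \<open>gram\<close> has no entries leading out of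
    the window.\<close>
  have "(imat p (gram p) * imat p f) $$ (i, j) = (\<Sum>l<p. gram p (int i) (int l) * (if int l < int p \<and> int l \<ge> 0 then f (int l) (int j) else 0))"
    using ij by (simp add: index_mult_sum[where n = p and m = p and k = p] del: index_mult_mat(1)) (simp add: imat_def)
  also have "\<dots> = mulL p (\<lambda>i j. if i < int p \<and> i \<ge> 0 then f i j else 0) (int i) (int j)"
    unfolding mulL_def
    by (rule sum_window[where g = "\<lambda>l. gram p (int i) l * (if l < int p \<and> l \<ge> 0 then f l (int j) else 0)"])
      (auto simp: gram_def)
  also have "\<dots> = mulL p f (int i) (int j)"
    using ij by (auto simp: mulL_def gram_def xx_def)
  finally show "(imat p (gram p) * imat p f) $$ (i, j) = imat p (mulL p f) $$ (i, j)"
    using ij by (simp add: imat_def)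
qed (auto simp: imat_def)

lemma imat_mulR:
  shows "imat p f * imat p (gram p) = imat p (mulR p f)"
proof (rule eq_matI)
  fix i j assume "i < dim_row (imat p (mulR p f))" "j < dim_col (imat p (mulR p f))"
  then have ij: "i < p" "j < p" by (auto simp: imat_def)
  have "(imat p f * imat p (gram p)) $$ (i, j) = (\<Sum>l<p. (if int l < int p \<and> int l \<ge> 0 then f (int i) (int l) else 0) * gram p (int l) (int j))"
    using ij by (simp add: index_mult_sum[where n = p and m = p and k = p] del: index_mult_mat(1)) (simp add: imat_def)
  also have "\<dots> = mulR p (\<lambda>i j. if j < int p \<and> j \<ge> 0 then f i j else 0) (int i) (int j)"
    unfolding mulR_def
    by (rule sum_window[where g = "\<lambda>l. (if l < int p \<and> l \<ge> 0 then f (int i) l else 0) * gram p l (int j)"])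
      (auto simp: gram_def)
  also have "\<dots> = mulR p f (int i) (int j)"
    using ij by (auto simp: mulR_def gram_def xx_def)
  finally show "(imat p f * imat p (gram p)) $$ (i, j) = imat p (mulR p f) $$ (i, j)"
    using ij by (simp add: imat_def)
qed (auto simp: imat_def)

text \<open>The coefficients 2 i + 1 are dictated by the outermost diagonal, where the left-hand
  side vanishes: consecutive ones must differ by 2 to cancel twice the power of L. For index 2 the
  next diagonal then determines \<open>dd\<close>. The skew matrix enters as \<open>lax\<close> L -
  L \<open>lax\<close>, so it is minus the matrix called K above.\<close>

fun lax_upper :: "nat \<Rightarrow> nat \<Rightarrow> int \<Rightarrow> int \<Rightarrow> nat cpoly" where
  "lax_upper p 0 i j = 0"
| "lax_upper p (Suc 0) i j = (if j = i + 1 then of_int (2 * i + 1) * xx p (2 * i + 2) * xx p (2 * i + 3) else 0)"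
| "lax_upper p (Suc (Suc k)) i j = (if j = i + 1 then dd p (2 * i + 1) * xx p (2 * i + 2) * xx p (2 * i + 3)
     else if j = i + 2 then of_int (2 * i + 1) * xx p (2 * i + 2) * xx p (2 * i + 3) * xx p (2 * i + 4) * xx p (2 * i + 5) else 0)"

definition lax :: "nat \<Rightarrow> nat \<Rightarrow> int \<Rightarrow> int \<Rightarrow> nat cpoly" where
  "lax p k i j = lax_upper p k i j - lax_upper p k j i"

lemma virasoro_field_gram: "virasoro_field p k (gram p i j) = (if i = j then 2 * uu p (2 * i + 1) * vv p k (2 * i + 1) + 2 * uu p (2 * i + 2) * vv p k (2 * i + 2)
     else if j = i + 1 then xx p (2 * i + 2) * xx p (2 * i + 3) * (vv p k (2 * i + 2) + vv p k (2 * i + 3))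
     else if i = j + 1 then xx p (2 * i) * xx p (2 * i + 1) * (vv p k (2 * i) + vv p k (2 * i + 1)) else 0)"
  by (simp add: gram_def derivation_simps[OF derivation_virasoro_field] virasoro_field_xx) (simp add: algebra_simps power2_eq_square)

lemma Lax_1: "virasoro_field p (Suc 0) (gram p i j) = 2 * mulL p (gram p) i j + (mulR p (lax p (Suc 0)) i j - mulL p (lax p (Suc 0)) i j)"
proof -
  consider "j = i" | "j = i + 1" | "i = j + 1" | "j = i + 2" | "i = j + 2"
    | "j \<noteq> i" "j \<noteq> i + 1" "i \<noteq> j + 1" "j \<noteq> i + 2" "i \<noteq> j + 2" by blast
  then show ?thesis
    unfolding virasoro_field_gram
    by cases (simp_all add: mulL_def mulR_def lax_def gram_def power2_eq_square algebra_simps)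
qed

lemma Lax_2: "virasoro_field p (Suc (Suc 0)) (gram p i j) = 2 * mulL p (mulL p (gram p)) i j
    + (mulR p (lax p (Suc (Suc 0))) i j - mulL p (lax p (Suc (Suc 0))) i j)"
proof -
  \<comment> \<open>All partial sums are expressed through the one ending at 2 i - 2, so that ring
    normalisation can cancel the nonlocal part.\<close>
  have s: "ss p (2 + i * 2) = ss p (i * 2 - 2) + uu p (i * 2 - 1) + uu p (i * 2) + uu p (1 + i * 2) + uu p (2 + i * 2)"
    "ss p (1 + i * 2) = ss p (i * 2 - 2) + uu p (i * 2 - 1) + uu p (i * 2) + uu p (1 + i * 2)"
    "ss p (i * 2) = ss p (i * 2 - 2) + uu p (i * 2 - 1) + uu p (i * 2)"
    "ss p (i * 2 - 1) = ss p (i * 2 - 2) + uu p (i * 2 - 1)" for i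
    using ss_rec[of p "2 + i * 2"] ss_rec[of p "1 + i * 2"] ss_rec[of p "i * 2"] ss_rec[of p "i * 2 - 1"]
    by (simp_all add: algebra_simps)
  consider "j = i" | "j = i + 1" | "i = j + 1" | "j = i + 2" | "i = j + 2" | "j = i + 3" | "i = j + 3"
    | "j \<noteq> i" "j \<noteq> i + 1" "i \<noteq> j + 1" "j \<noteq> i + 2" "i \<noteq> j + 2" "j \<noteq> i + 3" "i \<noteq> j + 3" by blast
  then show ?thesis
  proof cases
    case 1
    show ?thesis unfolding virasoro_field_gram 1
      by (simp add: mulL_def mulR_def lax_def gram_def dd_def power2_eq_square s[of i] algebra_simps)
  next
    case 2
    show ?thesis unfolding virasoro_field_gram 2
      by (simp add: mulL_def mulR_def lax_def gram_def dd_def power2_eq_square s[of i] algebra_simps)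
  next
    case 3
    show ?thesis unfolding virasoro_field_gram 3
      by (simp add: mulL_def mulR_def lax_def gram_def dd_def power2_eq_square s[of j] algebra_simps)
  next
    case 4
    show ?thesis unfolding virasoro_field_gram 4
      by (simp add: mulL_def mulR_def lax_def gram_def dd_def power2_eq_square s[of i] algebra_simps)
  next
    case 5
    show ?thesis unfolding virasoro_field_gram 5
      by (simp add: mulL_def mulR_def lax_def gram_def dd_def power2_eq_square s[of j] algebra_simps)
  next
    case 6
    show ?thesis unfolding virasoro_field_gram 6
      by (simp add: mulL_def mulR_def lax_def gram_def algebra_simps)
  next
    case 7
    show ?thesis unfolding virasoro_field_gram 7
      by (simp add: mulL_def mulR_def lax_def gram_def algebra_simps)
  next
    case 8
    then show ?thesis unfolding virasoro_field_gram
      by (simp add: mulL_def mulR_def lax_def gram_def)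
  qed
qed

text \<open>The number of degrees of freedom of the chi variable \<open>x\<^sub>n\<close>: the first block has \<open>a = 1\<close>, the second \<open>a = 3\<close>.\<close>
definition chi_deg :: "nat \<Rightarrow> int \<Rightarrow> int \<Rightarrow> int" where
  "chi_deg p a n = 2 * int p - n + (if odd n then a - 1 else 0)"

text \<open>The divergence of \<open>V\<^sub>k\<close> against the product of the chi densities, up to sign.\<close>
definition div_term :: "nat \<Rightarrow> int \<Rightarrow> nat \<Rightarrow> int \<Rightarrow> nat cpoly" where
  "div_term p a k n = (uu p n - of_int (chi_deg p a n)) * vv p k n - ee p k n"

definition gram_mat :: "nat \<Rightarrow> nat cpoly mat" where "gram_mat p = imat p (gram p)"

definition gram_psum :: "nat \<Rightarrow> nat \<Rightarrow> nat cpoly" where "gram_psum p k = tr (gram_mat p ^\<^sub>m k)"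

lemma gram_mat_carrier [simp]: "gram_mat p \<in> carrier_mat p p"
  by (simp add: gram_mat_def)

lemma gram_mat_pow_Suc: "gram_mat p ^\<^sub>m 1 = imat p (gram p)" "gram_mat p ^\<^sub>m 2 = imat p (mulL p (gram p))"
  "gram_mat p ^\<^sub>m 3 = imat p (mulL p (mulL p (gram p)))"
proof -
  show 1: "gram_mat p ^\<^sub>m 1 = imat p (gram p)" by (simp add: gram_mat_def imat_def)
  have "gram_mat p ^\<^sub>m 2 = gram_mat p ^\<^sub>m 1 * gram_mat p ^\<^sub>m 1" using pow_mat_add[OF gram_mat_carrier, of p 1 1] by (simp only: one_add_one)
  then show 2: "gram_mat p ^\<^sub>m 2 = imat p (mulL p (gram p))" unfolding 1 imat_mulL .
  have "gram_mat p ^\<^sub>m 3 = gram_mat p ^\<^sub>m 1 * gram_mat p ^\<^sub>m 2" using pow_mat_add[OF gram_mat_carrier, of p 1 2] by (simp only: one_plus_numeral semiring_norm)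
  then show "gram_mat p ^\<^sub>m 3 = imat p (mulL p (mulL p (gram p)))" unfolding 1 2 imat_mulL .
qed

lemma virasoro_field_gram_psum:
  assumes "k \<le> 2"
  shows "virasoro_field p k (gram_psum p j) = of_int 2 * of_nat j * gram_psum p (j + k)"
proof -
  have eqs: "map_mat D (imat p f) = 2 \<cdot>\<^sub>m imat p h + (imat p (mulR p K) - imat p (mulL p K))"
    if "\<And>i j. D (f i j) = 2 * h i j + (mulR p K i j - mulL p K i j)" for f h K and D :: "nat cpoly \<Rightarrow> nat cpoly"
    by (rule eq_matI) (auto simp: imat_def that)
  have "map_mat (virasoro_field p k) (gram_mat p) = 2 \<cdot>\<^sub>m gram_mat p ^\<^sub>m (k + 1) + (imat p (lax p k) * gram_mat p - gram_mat p * imat p (lax p k))"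
  proof -
    consider "k = 0" | "k = Suc 0" | "k = Suc (Suc 0)" using assms by linarith
    then show ?thesis
    proof cases
      case 1
      have "virasoro_field p 0 (gram p i j) = 2 * gram p i j + (mulR p (lax p 0) i j - mulL p (lax p 0) i j)" for i j
        unfolding virasoro_field_gram by (simp add: gram_def mulR_def mulL_def lax_def algebra_simps)
      from eqs[of "virasoro_field p 0", OF this] show ?thesis
        unfolding gram_mat_def imat_mulR imat_mulL 1 using gram_mat_pow_Suc(1)[of p] by (simp add: gram_mat_def del: pow_mat.simps)
    next
      case 2
      have "gram_mat p ^\<^sub>m (Suc 0 + 1) = imat p (mulL p (gram p))" using gram_mat_pow_Suc(2)[of p] by (simp add: numeral_2_eq_2)
      then show ?thesis
        unfolding 2 using eqs[of "virasoro_field p (Suc 0)", OF Lax_1] unfolding gram_mat_def imat_mulR imat_mulL by simp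
    next
      case 3
      have "gram_mat p ^\<^sub>m (Suc (Suc 0) + 1) = imat p (mulL p (mulL p (gram p)))" using gram_mat_pow_Suc(3)[of p] by (simp add: numeral_3_eq_3)
      then show ?thesis
        unfolding 3 using eqs[of "virasoro_field p (Suc (Suc 0))", OF Lax_2] unfolding gram_mat_def imat_mulR imat_mulL by simp
    qed
  qed
  from derivation_tr_pow_Lax[OF derivation_virasoro_field gram_mat_carrier imat_carrier this, of j] show ?thesis
    by (simp add: gram_psum_def)
qed

lemma gram_psum_0: "gram_psum p 0 = of_nat p"
  by (simp add: gram_psum_def tr_def gram_mat_def imat_def)

lemma tr_imat: "tr (imat p f) = (\<Sum>i<p. f (int i) (int i))"
  by (simp add: tr_def imat_def)

lemma gram_psum_1: "gram_psum p 1 = (\<Sum>i<p. uu p (2 * int i + 1) + uu p (2 * int i + 2))"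
  unfolding gram_psum_def gram_mat_pow_Suc tr_imat by (simp add: gram_def)

section \<open>Divergences of the explicit fields as telescoping sums\<close>

definition t2 :: "nat \<Rightarrow> int \<Rightarrow> nat cpoly" where
  "t2 p n = (uu p n)\<^sup>2 + 2 * uu p n * uu p (n + 1)"

definition t3 :: "nat \<Rightarrow> int \<Rightarrow> nat cpoly" where
  "t3 p n = uu p n ^ 3 + 3 * (uu p n)\<^sup>2 * uu p (n + 1) + 3 * uu p n * (uu p (n + 1))\<^sup>2 + 3 * uu p n * uu p (n + 1) * uu p (n + 2)"

lemma sum_telescope_eq:
  fixes f g b :: "nat \<Rightarrow> 'r::comm_ring_1"
  assumes "\<And>i. f i = g i + b (Suc i) - b i" "b 0 = 0" "b p = 0"
  shows "(\<Sum>i<p. f i) = (\<Sum>i<p. g i)"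
proof -
  have "(\<Sum>i<m. f i) = (\<Sum>i<m. g i) + b m - b 0" for m
    by (induction m) (simp_all add: assms(1))
  then show ?thesis using assms by simp
qed

text \<open>\<open>t2\<close> charges every monomial of the trace to its smallest index, while the
  diagonal entries of the squared matrix distribute the couplings between neighbours differently.
  The discrepancy telescopes with zero ends.\<close>

lemma gram_psum_2: "gram_psum p 2 = (\<Sum>i<p. t2 p (2 * int i + 1) + t2 p (2 * int i + 2))"
  unfolding gram_psum_def gram_mat_pow_Suc tr_imat
  by (rule sum_telescope_eq[where b = "\<lambda>i. - (uu p (2 * int i) * uu p (2 * int i + 1))"])
    (auto simp: mulL_def gram_def t2_def xx_outside power2_eq_square algebra_simps)

lemma gram_psum_3: "gram_psum p 3 = (\<Sum>i<p. t3 p (2 * int i + 1) + t3 p (2 * int i + 2))"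
  unfolding gram_psum_def gram_mat_pow_Suc tr_imat
proof (rule sum_telescope_eq)
  let ?u = "\<lambda>i c. uu p (2 * int i + c)"
  let ?b = "\<lambda>i. - (?u i 0 * ?u i 1 * (?u i (- 1) + ?u i 0 + 2 * ?u i 1 + 2 * ?u i 2))"
  show "mulL p (mulL p (gram p)) (int i) (int i) = t3 p (2 * int i + 1) + t3 p (2 * int i + 2) + ?b (Suc i) - ?b i" for i
    by (simp add: mulL_def gram_def t3_def power2_eq_square power3_eq_cube algebra_simps)
qed (auto simp: xx_outside)

lemma sum_telescope:
  fixes f g b :: "nat \<Rightarrow> 'r::comm_ring_1"
  assumes "\<And>i. f i = g i + (b (Suc i) - b i)"
  shows "(\<Sum>i<p. f i) = (\<Sum>i<p. g i) + b p - b 0"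
  by (induction p) (simp_all add: assms)

lemma ss_gram_psum_1: "ss p (2 * int p) = gram_psum p 1"
proof -
  have "ss p (2 * int m) = (\<Sum>i<m. uu p (2 * int i + 1) + uu p (2 * int i + 2))" for m
  proof (induction m)
    case (Suc m)
    show ?case
      using ss_rec[of p "2 * int m + 2"] ss_rec[of p "2 * int m + 1"] Suc by (simp add: algebra_simps)
  qed (simp add: ss_nonpos)
  then show ?thesis unfolding gram_psum_1 .
qed

lemma sum_div_term_pairs:
  "(\<Sum>n\<in>{1..<2 * p}. div_term p a k (int n)) = (\<Sum>i<p. div_term p a k (2 * int i + 1) + div_term p a k (2 * int i + 2))"
proof (cases p)
  case (Suc q)
  have "(\<Sum>i<m. div_term p a k (2 * int i + 1) + div_term p a k (2 * int i + 2)) = (\<Sum>n\<in>{1..<2 * m + 1}. div_term p a k (int n))" for m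
  proof (induction m)
    case (Suc m)
    have "{1..<2 * Suc m + 1} = insert (2 * m + 1) (insert (2 * m + 2) {1..<2 * m + 1})" by auto
    then show ?case using Suc by (simp add: algebra_simps)
  qed simp
  also have "{1..<2 * p + 1} = insert (2 * p) {1..<2 * p}" using Suc by auto
  also have "(\<Sum>n\<in>\<dots>. div_term p a k (int n)) = div_term p a k (2 * int p) + (\<Sum>n\<in>{1..<2 * p}. div_term p a k (int n))"
    by simp
  \<comment> \<open>The missing subdiagonal entry of the last column can be added to complete the
    pairs: its padded entry is zero, and so is \<open>chi_deg\<close> at 2 p.\<close>
  also have "div_term p a k (2 * int p) = 0"
  proof -
    have "ee p k (2 * int p) = 0" by (cases "(p, k, 2 * int p)" rule: ee.cases) (auto simp: xx_outside)
    then show ?thesis by (simp add: div_term_def chi_deg_def xx_outside)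
  qed
  finally show ?thesis by simp
qed simp

text \<open>The chi degrees of a block add up to p (2 p + a - 2), which is the constant part of the
  loop polynomial of index 0; a quadratic in the column number telescopes to this total.\<close>

lemma divergence_0: "(\<Sum>n\<in>{1..<2 * p}. div_term p a 0 (int n)) = - loop_poly a (gram_psum p) 0"
proof -
  have "(\<Sum>n\<in>{1..<2 * p}. div_term p a 0 (int n)) =
     (\<Sum>i<p. uu p (2 * int i + 1) + uu p (2 * int i + 2)) +
     - (of_nat p * (4 * of_nat p + of_int a - 2 - 2 * of_nat p)) - - (of_nat 0 * (4 * of_nat p + of_int a - 2 - 2 * of_nat 0))"
    unfolding sum_div_term_pairs by (rule sum_telescope) (simp add: div_term_def chi_deg_def algebra_simps)
  then show ?thesis
    unfolding gram_psum_1[symmetric] by (simp add: loop_poly_def gram_psum_0 algebra_simps)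
qed

lemma divergence_1: "(\<Sum>n\<in>{1..<2 * p}. div_term p a (Suc 0) (int n)) = - loop_poly a (gram_psum p) (Suc 0)"
proof -
  let ?u = "\<lambda>i c. uu p (2 * int i + c)"
  let ?m = "\<lambda>i. of_nat i :: nat cpoly"
  \<comment> \<open>A discrete primitive of the difference between the divergence and the density
    \<open>?g\<close>. Its first summand vanishes at both ends by padding, its second by the factors
    i and i - p.\<close>
  let ?b = "\<lambda>i. ?u i 0 * (?m i - 1) * (- 4 * of_nat p - 2 * of_int a + 4 * (?m i + 1) + 2 * ?u i 1)
     + 4 * ?m i * ?u i 1 * (?m i - of_nat p)"
  let ?g = "\<lambda>i. - (4 * of_nat p + of_int a - 2) * (?u i 1 + ?u i 2) + (t2 p (2 * int i + 1) + t2 p (2 * int i + 2))"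
  \<comment> \<open>The squares become atoms, so that unfolding squares in the ring computation does
    not break them into products of entries.\<close>
  define U where "U = (\<lambda>n. uu p n)"
  have U: "uu p n = U n" for n by (simp add: U_def)
  have "(\<Sum>n\<in>{1..<2 * p}. div_term p a (Suc 0) (int n)) = (\<Sum>i<p. ?g i) + ?b p - ?b 0"
    unfolding sum_div_term_pairs
  proof (rule sum_telescope)
    show "div_term p a (Suc 0) (2 * int i + 1) + div_term p a (Suc 0) (2 * int i + 2) = ?g i + (?b (Suc i) - ?b i)" for i
      unfolding div_term_def vv.simps ee.simps t2_def U
      by (simp add: chi_deg_def power2_eq_square algebra_simps)
  qed
  also have "?b p = 0" by (simp add: xx_outside)
  also have "?b 0 = 0" by (simp add: xx_outside)
  also have "(\<Sum>i<p. ?g i) = - (4 * of_nat p + of_int a - 2) * gram_psum p 1 + gram_psum p 2"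
    by (simp only: gram_psum_1 gram_psum_2 sum.distrib flip: sum_distrib_left)
  finally show ?thesis by (simp add: loop_poly_def gram_psum_0 numeral_2_eq_2 algebra_simps)
qed

lemma divergence_2: "(\<Sum>n\<in>{1..<2 * p}. div_term p a (Suc (Suc 0)) (int n)) = - loop_poly a (gram_psum p) (Suc (Suc 0))"
proof -
  let ?u = "\<lambda>i c. uu p (2 * int i + c)"
  let ?m = "\<lambda>i. of_nat i :: nat cpoly"
  let ?P = "of_nat p :: nat cpoly"
  let ?b = "\<lambda>i. (- 4 * ?P - 2 * of_int a + 4 * (?m i + 1) + 2 * ?u i 1) * ?u i 0 *
       (ss p (2 * int i - 2) + (?m i - 1) * (?u i (- 1) + ?u i 0))
     + ?u i 0 * ?u i 1 * (- 8 * (?m i - 1) * ?P - (2 * ?m i - 3) * of_int a + 8 * ?m i * ?m i - 4 * ?m i - 6)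
     + (2 * ?m i - 3) * ?u i 0 * ?u i 1 * (?u i 1 + ?u i 2)
     + 4 * (?m i - ?P) * ?u i 1 * (ss p (2 * int i - 1) + ?m i * (?u i 1 + ?u i 2))
     - 2 * (ss p (2 * int i))\<^sup>2"
  let ?g = "\<lambda>i. - (4 * ?P + of_int a - 2) * (t2 p (2 * int i + 1) + t2 p (2 * int i + 2)) + (t3 p (2 * int i + 1) + t3 p (2 * int i + 2))"
  define U where "U = (\<lambda>n. uu p n)"
  have U: "uu p n = U n" for n by (simp add: U_def)
  have s: "ss p (2 + i * 2) = ss p (i * 2 - 2) + U (i * 2 - 1) + U (i * 2) + U (1 + i * 2) + U (2 + i * 2)"
    "ss p (1 + i * 2) = ss p (i * 2 - 2) + U (i * 2 - 1) + U (i * 2) + U (1 + i * 2)"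
    "ss p (i * 2) = ss p (i * 2 - 2) + U (i * 2 - 1) + U (i * 2)"
    "ss p (i * 2 - 1) = ss p (i * 2 - 2) + U (i * 2 - 1)" for i
    using ss_rec[of p "2 + i * 2"] ss_rec[of p "1 + i * 2"] ss_rec[of p "i * 2"] ss_rec[of p "i * 2 - 1"]
    by (simp_all add: U algebra_simps)
  have "(\<Sum>n\<in>{1..<2 * p}. div_term p a (Suc (Suc 0)) (int n)) = (\<Sum>i<p. ?g i) + ?b p - ?b 0"
    unfolding sum_div_term_pairs
  proof (rule sum_telescope)
    show "div_term p a (Suc (Suc 0)) (2 * int i + 1) + div_term p a (Suc (Suc 0)) (2 * int i + 2) = ?g i + (?b (Suc i) - ?b i)" for i
      unfolding div_term_def vv.simps ee.simps t2_def t3_def dd_def U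
      by (simp add: chi_deg_def power2_eq_square power3_eq_cube s[of "int i"] algebra_simps)
  qed
  also have "?b p = - 2 * (gram_psum p 1)\<^sup>2" by (simp add: xx_outside ss_gram_psum_1)
  also have "?b 0 = 0" by (simp add: xx_outside ss_nonpos)
  also have "(\<Sum>i<p. ?g i) = - (4 * ?P + of_int a - 2) * gram_psum p 2 + gram_psum p 3"
    by (simp only: gram_psum_2 gram_psum_3 sum.distrib flip: sum_distrib_left)
  finally show ?thesis
    by (simp add: loop_poly_def gram_psum_0 numeral_2_eq_2 numeral_3_eq_3 power2_eq_square algebra_simps)
qed

lemma expect_of_int_mult: "expect \<mu> (of_int k * f) = of_int k * expect \<mu> f"
  by (cases k rule: int_cases2) (auto simp: expect_of_nat_mult expect_uminus)

text \<open>Integration by parts in each coordinate, applied to \<open>vv\<close> times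
  \<open>f\<close>: the term with the squared variable and the one with the degrees of freedom come
  from the chi density, and \<open>ee\<close> from the derivative falling on the
  coefficient.\<close>

lemma expect_virasoro_field:
  assumes \<mu>: "\<And>n. \<mu> n 0 = 1"
    and rec: "\<And>n e. n \<in> {1..<2 * p} \<Longrightarrow> \<mu> n (e + 2) = (of_int (chi_deg p a (int n)) + of_nat e) * \<mu> n e"
    and k: "k \<le> 2"
  shows "expect \<mu> (virasoro_field p k f) = expect \<mu> ((\<Sum>n\<in>{1..<2 * p}. div_term p a k (int n)) * f)"
proof -
  have "expect \<mu> ((Var n * vv p k (int n)) * pd n f) = expect \<mu> (div_term p a k (int n) * f)" if n: "n \<in> {1..<2 * p}" for n
  proof -
    let ?v = "vv p k (int n)" and ?k = "chi_deg p a (int n)"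
    have xn: "xx p (int n) = Var n" using n by (auto simp: xx_def)
    have "expect \<mu> (Var n ^ 2 * (?v * f)) = expect \<mu> (Cst (of_int ?k) * (?v * f) + Cst 1 * (Var n * pd n (?v * f)))"
      by (rule expect_Var_gamma) (use \<mu> rec[OF n] in auto)
    also have "Var n * pd n (?v * f) = ee p k (int n) * f + (Var n * ?v) * pd n f"
      unfolding pd_mult distrib_left euler_vv[OF n k, symmetric] mult.assoc ..
    finally have "expect \<mu> (Var n ^ 2 * (?v * f)) = of_int ?k * expect \<mu> (?v * f) + expect \<mu> (ee p k (int n) * f)
        + expect \<mu> ((Var n * ?v) * pd n f)"
      by (simp add: expect_add expect_Cst_mult)
    moreover have "div_term p a k (int n) * f = Var n ^ 2 * (?v * f) - of_int ?k * (?v * f) - ee p k (int n) * f"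
      by (simp add: div_term_def xn algebra_simps)
    ultimately show ?thesis by (simp add: expect_diff expect_of_int_mult)
  qed
  then show ?thesis
    by (simp add: virasoro_field_def expect_sum sum_distrib_right)
qed

lemma lue_recursion_bidiag:
  assumes \<mu>: "\<And>n. \<mu> n 0 = 1"
    and rec: "\<And>n e. n \<in> {1..<2 * p} \<Longrightarrow> \<mu> n (e + 2) = (of_int (chi_deg p a (int n)) + of_nat e) * \<mu> n e"
  shows "lue_recursion a p (\<lambda>ks. expect \<mu> (\<Prod>k\<leftarrow>ks. gram_psum p k))"
proof (rule lue_recursion_virasoro)
  have v: "virasoro (expect \<mu>) a (gram_psum p) k" if "k \<le> 2" for k
  proof -
    have "(\<Sum>n\<in>{1..<2 * p}. div_term p a k (int n)) = - loop_poly a (gram_psum p) k"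
    proof -
      consider "k = 0" | "k = Suc 0" | "k = Suc (Suc 0)" using \<open>k \<le> 2\<close> by linarith
      then show ?thesis using divergence_0 divergence_1 divergence_2 by cases auto
    qed
    then have "expect \<mu> (virasoro_field p k f) = - expect \<mu> (loop_poly a (gram_psum p) k * f)" for f
      using expect_virasoro_field[OF \<mu> rec that, of f] by (simp add: expect_uminus)
    then have "expect \<mu> (2 * virasoro_field p k f + of_int 2 * (loop_poly a (gram_psum p) k * f)) = 0" for f
      using expect_of_nat_mult[of \<mu> 2] by (simp add: expect_add)
    then show ?thesis unfolding virasoro_def
      using derivation_virasoro_field virasoro_field_gram_psum[OF that] by (intro exI[of _ "virasoro_field p k"] exI[of _ 2]) auto
  qed
  show "virasoro (expect \<mu>) a (gram_psum p) k" for k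
    by (rule virasoro_all) (use v[of 0] v[of 1] v[of 2] in \<open>auto simp: expect_add\<close>)
qed (auto simp: expect_add expect_of_int_mult gram_psum_0)

section \<open>Squared Vandermonde weights\<close>

lemma prod_linear_factors_coeffs:
  fixes x :: "nat \<Rightarrow> 'r::comm_ring_1"
  obtains c where "\<And>j y. (\<Prod>l<j. y - x l) = (\<Sum>l\<le>j. c j l * y ^ l)" "\<And>j. c j j = 1"
proof -
  have "\<exists>c. (\<forall>y. (\<Prod>l<j. y - x l) = (\<Sum>l\<le>j. c l * y ^ l)) \<and> c j = 1" for j
  proof (induction j)
    case 0
    show ?case by (rule exI[of _ "\<lambda>_. 1"]) simp
  next
    case (Suc j)
    then obtain c where c: "\<And>y. (\<Prod>l<j. y - x l) = (\<Sum>l\<le>j. c l * y ^ l)" "c j = 1" by blast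
    let ?c = "\<lambda>l. (case l of 0 \<Rightarrow> 0 | Suc l \<Rightarrow> c l) - (if l \<le> j then x j * c l else 0)"
    have "(\<Prod>l<Suc j. y - x l) = (\<Sum>l\<le>Suc j. ?c l * y ^ l)" for y
    proof -
      have "(\<Sum>l\<le>Suc j. ?c l * y ^ l) = (\<Sum>l\<le>Suc j. (case l of 0 \<Rightarrow> 0 | Suc l \<Rightarrow> c l) * y ^ l) - (\<Sum>l\<le>Suc j. (if l \<le> j then x j * c l else 0) * y ^ l)"
        by (simp only: left_diff_distrib sum_subtractf)
      also have "(\<Sum>l\<le>Suc j. (case l of 0 \<Rightarrow> 0 | Suc l \<Rightarrow> c l) * y ^ l) = y * (\<Sum>l\<le>j. c l * y ^ l)"
        by (simp only: sum.atMost_Suc_shift) (simp add: sum_distrib_left mult_ac)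
      also have "(\<Sum>l\<le>Suc j. (if l \<le> j then x j * c l else 0) * y ^ l) = x j * (\<Sum>l\<le>j. c l * y ^ l)"
        by (simp add: sum_distrib_left mult_ac)
      finally show ?thesis by (simp add: c(1)[symmetric] algebra_simps)
    qed
    then show ?case using c(2) by (intro exI[of _ ?c]) auto
  qed
  then show ?thesis using that by metis
qed

text \<open>Multiplying the matrix of powers by the unipotent triangular matrix of coefficients
  turns the columns into Newton products of x_i - x_l over l < j. These vanish above the diagonal,
  so the determinant can be read off over any commutative ring.\<close>

lemma Vandermonde:
  fixes x :: "nat \<Rightarrow> 'r::comm_ring_1"
  shows "(\<Sum>\<tau> | \<tau> permutes {..<n}. of_int (sign \<tau>) * (\<Prod>i<n. x i ^ \<tau> i)) = (\<Prod>i<n. \<Prod>j<i. x i - x j)"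
proof -
  obtain c where c: "\<And>j y. (\<Prod>l<j. y - x l) = (\<Sum>l\<le>j. c j l * y ^ l)" "\<And>j. c j j = (1::'r)"
    by (rule prod_linear_factors_coeffs[of x]) blast
  let ?V = "mat n n (\<lambda>(i, j). x i ^ j)"
  let ?U = "mat n n (\<lambda>(l, j). if l \<le> j then c j l else 0)"
  have V: "?V \<in> carrier_mat n n" and U: "?U \<in> carrier_mat n n" by auto
  have "det ?V = (\<Sum>\<tau> | \<tau> permutes {..<n}. of_int (sign \<tau>) * (\<Prod>i<n. x i ^ \<tau> i))"
    unfolding det_def'[OF V] atLeast0LessThan
  proof (rule sum.cong[OF refl], rule arg_cong2[where f = "(*)", OF refl], rule prod.cong[OF refl])
    fix \<tau> i assume "\<tau> \<in> {\<tau>. \<tau> permutes {..<n}}" "i \<in> {..<n}"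
    then have "\<tau> i < n" using permutes_in_image[of \<tau> "{..<n}" i] by simp
    then show "?V $$ (i, \<tau> i) = x i ^ \<tau> i" using \<open>i \<in> {..<n}\<close> by simp
  qed
  moreover have "det ?U = 1"
  proof -
    have "det ?U = prod_list (diag_mat ?U)"
      by (rule det_upper_triangular[OF _ U]) auto
    then show ?thesis by (simp add: prod_list_diag_prod c)
  qed
  moreover have "det (?V * ?U) = (\<Prod>i<n. \<Prod>j<i. x i - x j)"
  proof -
    have e: "(?V * ?U) $$ (i, j) = (\<Prod>l<j. x i - x l)" if "i < n" "j < n" for i j
    proof -
      have "(?V * ?U) $$ (i, j) = (\<Sum>l<n. x i ^ l * (if l \<le> j then c j l else 0))"
        using that by (simp add: index_mult_sum[OF V U] del: index_mult_mat(1))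
      also have "\<dots> = (\<Sum>l\<le>j. c j l * x i ^ l)"
        by (rule sum.mono_neutral_cong_right) (use that in auto)
      finally show ?thesis by (simp add: c)
    qed
    have "det (?V * ?U) = prod_list (diag_mat (?V * ?U))"
    proof (rule det_lower_triangular)
      show "?V * ?U \<in> carrier_mat n n" by (rule mult_carrier_mat[OF V U])
      show "(?V * ?U) $$ (i, j) = 0" if "i < j" "j < n" for i j
        unfolding e[OF less_trans[OF that] that(2)] by (rule prod_zero) (use that in auto)
    qed
    also have "\<dots> = (\<Prod>i<n. (?V * ?U) $$ (i, i))"
      by (simp add: prod_list_diag_prod atLeast0LessThan)
    also have "\<dots> = (\<Prod>i<n. \<Prod>j<i. x i - x j)"
      by (rule prod.cong) (auto simp: e simp del: index_mult_mat(1))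
    finally show ?thesis .
  qed
  ultimately show ?thesis using det_mult[OF V U] by simp
qed

definition vdm :: "nat \<Rightarrow> nat cpoly" where
  "vdm n = (\<Prod>i<n. \<Prod>j<i. Var i - Var j)"

definition psum :: "nat \<Rightarrow> nat \<Rightarrow> nat cpoly" where
  "psum n k = (\<Sum>i<n. Var i ^ k)"

text \<open>On \<open>\<nu>\<close>-distributed variables with the squared Vandermonde weight, integration by parts along
  these vector fields yields the loop equations of the orthogonal polynomial ensembles.\<close>
definition witt_field :: "nat \<Rightarrow> nat \<Rightarrow> nat cpoly \<Rightarrow> nat cpoly" where
  "witt_field n k f = (\<Sum>i<n. Var i ^ k * pd i f)"

lemma derivation_witt_field: "derivation (witt_field n k)"
  unfolding witt_field_def by (rule derivation_sum_scaled) (rule derivation_pd)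

lemma derivation_power: "derivation D \<Longrightarrow> D (f ^ k) = of_nat k * f ^ (k - 1) * D f"
proof (induction k)
  case (Suc k)
  then show ?case by (cases k) (auto simp: derivation_simps[OF Suc.prems] algebra_simps)
qed (simp add: derivation_1)

lemma witt_field_Var: "i < n \<Longrightarrow> witt_field n k (Var i) = Var i ^ k"
  by (simp add: witt_field_def pd_Var sum.delta if_distrib cong: if_cong)

lemma witt_field_psum: "witt_field n k (psum n j) = 1 * of_nat j * psum n (j + k - 1)"
proof -
  have "witt_field n k (psum n j) = (\<Sum>i<n. of_nat j * Var i ^ (j - 1) * Var i ^ k)"
    by (simp add: psum_def derivation_sum[OF derivation_witt_field] derivation_power[OF derivation_witt_field] witt_field_Var)
  also have "\<dots> = of_nat j * psum n (j + k - 1)"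
    by (cases j) (simp_all add: psum_def sum_distrib_left power_add mult.assoc)
  finally show ?thesis by simp
qed

text \<open>Logarithmic differentiation in a form free of quotients.\<close>

lemma derivation_prod_eigen:
  assumes "derivation D" "finite A" "\<And>z. z \<in> A \<Longrightarrow> D (f z) = f z * h z"
  shows "D (\<Prod>z\<in>A. f z) = (\<Prod>z\<in>A. f z) * (\<Sum>z\<in>A. h z)"
  using assms(2,3)
  by (induction A rule: finite_induct) (auto simp: derivation_1[OF assms(1)] derivation_mult[OF assms(1)] algebra_simps)

text \<open>Each factor x_i - x_j is multiplied by the divided difference of x^k, a polynomial
  symmetric in i and j. Squaring doubles the sum over pairs, which becomes the full double sum minus
  its diagonal.\<close>

lemma witt_field_vdm_sq: "witt_field n k ((vdm n)\<^sup>2) = (vdm n)\<^sup>2 * ((\<Sum>a<k. psum n a * psum n (k - 1 - a)) - of_nat k * psum n (k - 1))"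
proof -
  define h where "h i j = (\<Sum>a<k. Var i ^ a * Var j ^ (k - 1 - a))" for i j :: nat
  have hsym: "h i j = h j i" for i j
    unfolding h_def by (rule sum.reindex_bij_witness[of _ "\<lambda>a. k - 1 - a" "\<lambda>a. k - 1 - a"]) (auto simp: mult.commute)
  have hdiag: "h i i = of_nat k * Var i ^ (k - 1)" for i
    unfolding h_def by (simp add: power_add[symmetric])
  have d: "witt_field n k (Var i - Var j) = (Var i - Var j) * h i j" if "i < n" "j < i" for i j
  proof -
    have "h i j = (\<Sum>a<k. Var j ^ (k - Suc a) * Var i ^ a)"
      unfolding h_def by (simp add: mult.commute)
    then show ?thesis
      using that by (simp add: derivation_diff[OF derivation_witt_field] witt_field_Var power_diff_sumr2)
  qed
  have D: "witt_field n k (vdm n) = vdm n * (\<Sum>i<n. \<Sum>j<i. h i j)"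
    unfolding vdm_def
    by (rule derivation_prod_eigen[OF derivation_witt_field], simp, rule derivation_prod_eigen[OF derivation_witt_field]) (auto simp: d)
  have h1: "2 * (\<Sum>i<m. \<Sum>j<i. h i j) = (\<Sum>i<m. \<Sum>j<m. h i j) - (\<Sum>i<m. h i i)" for m
  proof (induction m)
    case (Suc m)
    have "(\<Sum>i<Suc m. \<Sum>j<Suc m. h i j) = (\<Sum>i<m. \<Sum>j<m. h i j) + (\<Sum>i<m. h i m) + (\<Sum>j<m. h m j) + h m m"
      by (simp add: sum.distrib)
    also have hm: "(\<Sum>j<m. h m j) = (\<Sum>i<m. h i m)" by (rule sum.cong[OF refl], rule hsym)
    finally have F: "(\<Sum>i<Suc m. \<Sum>j<Suc m. h i j) = (\<Sum>i<m. \<Sum>j<m. h i j) + (\<Sum>i<m. h i m) + (\<Sum>i<m. h i m) + h m m" .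
    have L: "(\<Sum>i<Suc m. \<Sum>j<i. h i j) = (\<Sum>i<m. \<Sum>j<i. h i j) + (\<Sum>i<m. h i m)"
      unfolding hm[symmetric] by simp
    have D': "(\<Sum>i<Suc m. h i i) = (\<Sum>i<m. h i i) + h m m" by simp
    show ?case unfolding F L D' distrib_left Suc by (simp add: algebra_simps)
  qed simp
  have h2: "(\<Sum>i<n. \<Sum>j<n. h i j) = (\<Sum>a<k. psum n a * psum n (k - 1 - a))"
  proof -
    have "(\<Sum>i<n. \<Sum>j<n. h i j) = (\<Sum>i<n. \<Sum>a<k. \<Sum>j<n. Var i ^ a * Var j ^ (k - 1 - a))"
      unfolding h_def by (rule sum.cong[OF refl], rule sum.swap)
    also have "\<dots> = (\<Sum>a<k. \<Sum>i<n. \<Sum>j<n. Var i ^ a * Var j ^ (k - 1 - a))"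
      by (rule sum.swap)
    finally show ?thesis by (simp add: psum_def sum_product)
  qed
  have h3: "(\<Sum>i<n. h i i) = of_nat k * psum n (k - 1)"
    unfolding hdiag psum_def by (simp add: sum_distrib_left)
  have H: "2 * (\<Sum>i<n. \<Sum>j<i. h i j) = (\<Sum>a<k. psum n a * psum n (k - 1 - a)) - of_nat k * psum n (k - 1)"
    unfolding h1 h2 h3 ..
  have "witt_field n k ((vdm n)\<^sup>2) = (vdm n)\<^sup>2 * (2 * (\<Sum>i<n. \<Sum>j<i. h i j))"
  proof -
    have "witt_field n k ((vdm n)\<^sup>2) = 2 * vdm n * witt_field n k (vdm n)" by (rule derivation_power2[OF derivation_witt_field])
    then show ?thesis unfolding D by (simp only: power2_eq_square mult_ac)
  qed
  then show ?thesis unfolding H .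
qed

lemma psum_0: "psum n 0 = of_nat n"
  by (simp add: psum_def)

text \<open>The divergence k P_{k-1} of the field cancels the diagonal correction from the squared
  Vandermonde determinant, leaving only splitting and joining terms.\<close>

lemma gue_recursion_vdm:
  assumes \<mu>: "\<And>j. \<mu> j 0 = 1" "\<And>i. i < n \<Longrightarrow> \<mu> i 1 = 0" "\<And>i e. i < n \<Longrightarrow> \<mu> i (e + 2) = of_nat (e + 1) * \<mu> i e"
  shows "gue_recursion n (\<lambda>ks. expect \<mu> ((\<Prod>k\<leftarrow>ks. psum n k) * (vdm n)\<^sup>2))"
proof -
  have ibp: "expect \<mu> (psum n (Suc k) * f) = expect \<mu> (of_nat k * psum n (k - 1) * f + witt_field n k f)" for k f
  proof -
    have "expect \<mu> (Var i ^ Suc k * f) = expect \<mu> (of_nat k * Var i ^ (k - 1) * f + Var i ^ k * pd i f)" if "i < n" for i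
    proof -
      have "expect \<mu> (Var i * (Var i ^ k * f)) = expect \<mu> (pd i (Var i ^ k * f))"
        by (rule expect_Var_normal) (use \<mu> that in auto)
      also have "pd i (Var i ^ k * f) = of_nat k * Var i ^ (k - 1) * f + Var i ^ k * pd i f"
        by (simp add: pd_mult derivation_power[OF derivation_pd] pd_Var)
      finally show ?thesis by (simp add: mult.assoc)
    qed
    then have "(\<Sum>i<n. expect \<mu> (Var i ^ Suc k * f)) = (\<Sum>i<n. expect \<mu> (of_nat k * Var i ^ (k - 1) * f + Var i ^ k * pd i f))"
      by (intro sum.cong) auto
    then show ?thesis
      by (simp add: psum_def witt_field_def sum_distrib_right sum_distrib_left sum.distrib expect_add flip: expect_sum)
  qed
  have "expect \<mu> ((\<Prod>k\<leftarrow>Suc k # ks. psum n k) * (vdm n)\<^sup>2) =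
      (\<Sum>i<k. expect \<mu> ((\<Prod>k\<leftarrow>i # (k - 1 - i) # ks. psum n k) * (vdm n)\<^sup>2)) +
      (\<Sum>j<length ks. of_nat (ks ! j) * expect \<mu> ((\<Prod>k\<leftarrow>ks[j := ks ! j + k - 1]. psum n k) * (vdm n)\<^sup>2))" for k ks
  proof -
    let ?Q = "\<Prod>k\<leftarrow>ks. psum n k"
    let ?S = "\<Sum>j<length ks. of_nat (ks ! j) * (\<Prod>k\<leftarrow>ks[j := ks ! j + k - 1]. psum n k)"
    have "expect \<mu> ((\<Prod>k\<leftarrow>Suc k # ks. psum n k) * (vdm n)\<^sup>2) =
        expect \<mu> (of_nat k * psum n (k - 1) * (?Q * (vdm n)\<^sup>2) + witt_field n k (?Q * (vdm n)\<^sup>2))"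
      using ibp[of k "?Q * (vdm n)\<^sup>2"] by (simp add: mult.assoc)
    also have "witt_field n k (?Q * (vdm n)\<^sup>2) = ?S * (vdm n)\<^sup>2 +
        ?Q * ((vdm n)\<^sup>2 * ((\<Sum>a<k. psum n a * psum n (k - 1 - a)) - of_nat k * psum n (k - 1)))"
      unfolding derivation_mult[OF derivation_witt_field] witt_field_vdm_sq
        derivation_prod_list[where g = "\<lambda>j. j + k - 1", OF derivation_witt_field witt_field_psum] by simp
    also have "of_nat k * psum n (k - 1) * (?Q * (vdm n)\<^sup>2) + (?S * (vdm n)\<^sup>2 +
        ?Q * ((vdm n)\<^sup>2 * ((\<Sum>a<k. psum n a * psum n (k - 1 - a)) - of_nat k * psum n (k - 1)))) =
        (\<Sum>a<k. (\<Prod>k\<leftarrow>a # (k - 1 - a) # ks. psum n k) * (vdm n)\<^sup>2) +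
        (\<Sum>j<length ks. of_nat (ks ! j) * ((\<Prod>k\<leftarrow>ks[j := ks ! j + k - 1]. psum n k) * (vdm n)\<^sup>2))"
      by (simp add: algebra_simps sum_distrib_left sum_distrib_right)
    finally show ?thesis by (simp only: expect_add expect_sum expect_of_nat_mult)
  qed
  then show ?thesis
    unfolding gue_recursion_def by (simp add: psum_0 expect_of_nat_mult mult.assoc)
qed

text \<open>The moment hypothesis is that of the weight x to the power a / 2 - 1 times exp (- x /
  2). The coefficient a - 2 is what remains of a + 2 k after the diagonal correction 2 (k + 1) is
  subtracted.\<close>

lemma lue_recursion_vdm:
  fixes a :: nat
  assumes \<mu>: "\<And>j. \<mu> j 0 = 1" "\<And>i e. i < n \<Longrightarrow> \<mu> i (e + 1) = (of_nat a + 2 * of_nat e) * \<mu> i e"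
  shows "lue_recursion (int a) n (\<lambda>ks. expect \<mu> ((\<Prod>k\<leftarrow>ks. psum n k) * (vdm n)\<^sup>2))"
proof -
  have C2: "Cst 2 = (2 :: nat cpoly)" using Cst_of_nat[of 2, where 'a = nat] by simp
  have ibp: "expect \<mu> (psum n (Suc k) * f) = expect \<mu> (of_nat (a + 2 * k) * psum n k * f + 2 * witt_field n (Suc k) f)" for k f
  proof -
    have "expect \<mu> (Var i ^ Suc k * f) = expect \<mu> (of_nat (a + 2 * k) * Var i ^ k * f + 2 * (Var i ^ Suc k * pd i f))" if "i < n" for i
    proof -
      have "expect \<mu> (Var i ^ 1 * (Var i ^ k * f)) = expect \<mu> (Cst (of_nat a) * (Var i ^ k * f) + Cst 2 * (Var i * pd i (Var i ^ k * f)))"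
        by (rule expect_Var_gamma) (use \<mu> that in auto)
      also have "pd i (Var i ^ k * f) = of_nat k * Var i ^ (k - 1) * f + Var i ^ k * pd i f"
        by (simp add: pd_mult derivation_power[OF derivation_pd] pd_Var)
      also have "Cst (of_nat a) * (Var i ^ k * f) + Cst 2 * (Var i * (of_nat k * Var i ^ (k - 1) * f + Var i ^ k * pd i f)) =
          of_nat (a + 2 * k) * Var i ^ k * f + 2 * (Var i ^ Suc k * pd i f)"
        by (cases k) (simp_all add: Cst_of_nat C2 algebra_simps)
      finally show ?thesis by (simp add: mult.assoc)
    qed
    then have "(\<Sum>i<n. expect \<mu> (Var i ^ Suc k * f)) = (\<Sum>i<n. expect \<mu> (of_nat (a + 2 * k) * Var i ^ k * f + 2 * (Var i ^ Suc k * pd i f)))"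
      by (intro sum.cong) auto
    then show ?thesis
      unfolding psum_def witt_field_def sum_distrib_right sum_distrib_left expect_sum expect_add sum.distrib by simp
  qed
  have E2: "expect \<mu> (2 * f) = 2 * expect \<mu> f" for f
    using expect_of_nat_mult[of \<mu> 2 f] by simp
  have "expect \<mu> ((\<Prod>k\<leftarrow>Suc k # ks. psum n k) * (vdm n)\<^sup>2) =
      of_int (int a - 2) * expect \<mu> ((\<Prod>k\<leftarrow>k # ks. psum n k) * (vdm n)\<^sup>2) +
      2 * (\<Sum>i\<le>k. expect \<mu> ((\<Prod>k\<leftarrow>i # (k - i) # ks. psum n k) * (vdm n)\<^sup>2)) +
      2 * (\<Sum>j<length ks. of_nat (ks ! j) * expect \<mu> ((\<Prod>k\<leftarrow>ks[j := ks ! j + k]. psum n k) * (vdm n)\<^sup>2))" for k ks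
  proof -
    let ?Q = "\<Prod>k\<leftarrow>ks. psum n k"
    let ?S = "\<Sum>j<length ks. of_nat (ks ! j) * (\<Prod>k\<leftarrow>ks[j := ks ! j + k]. psum n k)"
    have P: "witt_field n (Suc k) (psum n j) = 1 * of_nat j * psum n (j + k)" for j
      using witt_field_psum[of n "Suc k" j] by simp
    have "expect \<mu> ((\<Prod>k\<leftarrow>Suc k # ks. psum n k) * (vdm n)\<^sup>2) =
        expect \<mu> (of_nat (a + 2 * k) * psum n k * (?Q * (vdm n)\<^sup>2) + 2 * witt_field n (Suc k) (?Q * (vdm n)\<^sup>2))"
      using ibp[of k "?Q * (vdm n)\<^sup>2"] by (simp add: mult.assoc)
    also have "witt_field n (Suc k) (?Q * (vdm n)\<^sup>2) = ?S * (vdm n)\<^sup>2 +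
        ?Q * ((vdm n)\<^sup>2 * ((\<Sum>a\<le>k. psum n a * psum n (k - a)) - of_nat (Suc k) * psum n k))"
      unfolding derivation_mult[OF derivation_witt_field] witt_field_vdm_sq
        derivation_prod_list[where g = "\<lambda>j. j + k", OF derivation_witt_field P] by (simp add: lessThan_Suc_atMost)
    also have "of_nat (a + 2 * k) * psum n k * (?Q * (vdm n)\<^sup>2) + 2 * (?S * (vdm n)\<^sup>2 +
        ?Q * ((vdm n)\<^sup>2 * ((\<Sum>a\<le>k. psum n a * psum n (k - a)) - of_nat (Suc k) * psum n k))) =
        of_int (int a - 2) * ((\<Prod>k\<leftarrow>k # ks. psum n k) * (vdm n)\<^sup>2) +
        2 * (\<Sum>i\<le>k. (\<Prod>k\<leftarrow>i # (k - i) # ks. psum n k) * (vdm n)\<^sup>2) +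
        2 * (\<Sum>j<length ks. of_nat (ks ! j) * ((\<Prod>k\<leftarrow>ks[j := ks ! j + k]. psum n k) * (vdm n)\<^sup>2))"
      by (simp add: algebra_simps sum_distrib_left sum_distrib_right)
    finally show ?thesis by (simp only: expect_add expect_sum expect_of_nat_mult E2 expect_of_int_mult)
  qed
  then show ?thesis
    unfolding lue_recursion_def by (simp add: psum_0 expect_of_nat_mult mult.assoc)
qed

section \<open>Hankel sums and parity\<close>

text \<open>The product moments of the sums \<open>F\<^sub>k + G\<^sub>k\<close> in terms of those of independent families \<open>F\<close> and \<open>G\<close>.\<close>
fun conv :: "(nat list \<Rightarrow> complex) \<Rightarrow> (nat list \<Rightarrow> complex) \<Rightarrow> nat list \<Rightarrow> complex" where
  "conv \<phi> \<psi> [] = \<phi> [] * \<psi> []"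
| "conv \<phi> \<psi> (k # ks) = conv (\<lambda>l. \<phi> (k # l)) \<psi> ks + conv \<phi> (\<lambda>l. \<psi> (k # l)) ks"

lemma conv_sum_left: "conv (\<lambda>l. \<Sum>i\<in>A. \<phi> i l) \<psi> ks = (\<Sum>i\<in>A. conv (\<phi> i) \<psi> ks)"
  by (induction ks arbitrary: \<phi> \<psi>) (simp_all add: sum_distrib_right sum.distrib)

lemma conv_sum_right: "conv \<phi> (\<lambda>l. \<Sum>i\<in>A. \<psi> i l) ks = (\<Sum>i\<in>A. conv \<phi> (\<psi> i) ks)"
  by (induction ks arbitrary: \<phi> \<psi>) (simp_all add: sum_distrib_left sum.distrib)

lemma conv_mult_left: "conv (\<lambda>l. c * \<phi> l) \<psi> ks = c * conv \<phi> \<psi> ks"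
  by (induction ks arbitrary: \<phi> \<psi>) (simp_all add: algebra_simps)

lemma conv_mult_right: "conv \<phi> (\<lambda>l. c * \<psi> l) ks = c * conv \<phi> \<psi> ks"
  by (induction ks arbitrary: \<phi> \<psi>) (simp_all add: algebra_simps)

lemma conv_map: "conv \<phi> \<psi> (map f ks) = conv (\<lambda>l. \<phi> (map f l)) (\<lambda>l. \<psi> (map f l)) ks"
  by (induction ks arbitrary: \<phi> \<psi>) simp_all

text \<open>A product of power sums and a monomial, expanded: each power sum raises one exponent.
  Arbitrary index sets are allowed so that even and odd indices can be separated.\<close>

fun mixed_moment :: "(nat \<Rightarrow> complex) \<Rightarrow> 'i set \<Rightarrow> nat list \<Rightarrow> ('i \<Rightarrow> nat) \<Rightarrow> complex" where
  "mixed_moment \<nu> I [] e = (\<Prod>i\<in>I. \<nu> (e i))"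
| "mixed_moment \<nu> I (k # ks) e = (\<Sum>i\<in>I. mixed_moment \<nu> I ks (e(i := e i + k)))"

lemma mixed_moment_cong:
  "(\<And>i. i \<in> I \<Longrightarrow> e i = e' i) \<Longrightarrow> mixed_moment \<nu> I ks e = mixed_moment \<nu> I ks e'"
proof (induction ks arbitrary: e e')
  case (Cons k ks)
  have "mixed_moment \<nu> I ks (e(i := e i + k)) = mixed_moment \<nu> I ks (e'(i := e' i + k))" if "i \<in> I" for i
    by (rule Cons.IH) (use Cons.prems that in auto)
  then show ?case by simp
qed simp

lemma mixed_moment_reindex:
  "inj_on g A \<Longrightarrow> mixed_moment \<nu> (g ` A) ks e = mixed_moment \<nu> A ks (\<lambda>i. e (g i))"
proof (induction ks arbitrary: e)
  case Nil
  then show ?case by (simp add: prod.reindex)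
next
  case (Cons k ks)
  have "mixed_moment \<nu> (g ` A) ks (e(g i := e (g i) + k)) = mixed_moment \<nu> A ks ((\<lambda>i. e (g i))(i := e (g i) + k))"
    if "i \<in> A" for i
    unfolding Cons.IH[OF Cons.prems]
    by (rule mixed_moment_cong) (use Cons.prems that in \<open>auto dest: inj_onD\<close>)
  then show ?case using Cons.prems by (simp add: sum.reindex)
qed

lemma mixed_moment_permute:
  "\<pi> permutes I \<Longrightarrow> mixed_moment \<nu> I ks (\<lambda>i. e (\<pi> i)) = mixed_moment \<nu> I ks e"
  using mixed_moment_reindex[of \<pi> I \<nu> ks e] by (simp add: permutes_image permutes_inj_on)

lemma mixed_moment_double:
  "mixed_moment \<nu> I (map ((*) 2) ks) (\<lambda>i. 2 * e i + r) = mixed_moment (\<lambda>m. \<nu> (2 * m + r)) I ks e"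
proof (induction ks arbitrary: e)
  case (Cons k ks)
  have "mixed_moment \<nu> I (map ((*) 2) ks) ((\<lambda>i. 2 * e i + r)(j := 2 * e j + r + 2 * k)) =
      mixed_moment (\<lambda>m. \<nu> (2 * m + r)) I ks (e(j := e j + k))" for j
    unfolding Cons.IH[symmetric] by (rule mixed_moment_cong) auto
  then show ?case by simp
qed simp

text \<open>Inserting even power sums never changes the parity of an exponent, so an odd exponent
  survives to the end and kills the product.\<close>

lemma mixed_moment_odd:
  assumes "\<And>m. odd m \<Longrightarrow> \<nu> m = 0" "finite I" "i \<in> I" "odd (e i)"
  shows "mixed_moment \<nu> I (map ((*) 2) ks) e = 0"
  using assms(4)
proof (induction ks arbitrary: e)
  case Nil
  then show ?case using assms(1-3) by (auto intro!: prod_zero)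
next
  case (Cons k ks)
  have "mixed_moment \<nu> I (map ((*) 2) ks) (e(j := e j + 2 * k)) = 0" for j
    by (rule Cons.IH) (use Cons.prems in auto)
  then show ?case by simp
qed

text \<open>Each power sum raises an exponent either in \<open>I\<close> or in \<open>J\<close>;
  recording the choice for every list entry is what \<open>conv\<close> does.\<close>

lemma mixed_moment_Un:
  assumes "finite I" "finite J" "I \<inter> J = {}"
  shows "mixed_moment \<nu> (I \<union> J) ks e = conv (\<lambda>l. mixed_moment \<nu> I l e) (\<lambda>l. mixed_moment \<nu> J l e) ks"
proof (induction ks arbitrary: e)
  case Nil
  then show ?case using assms by (simp add: prod.union_disjoint)
next
  case (Cons k ks)
  have 1: "mixed_moment \<nu> J l (e(i := x)) = mixed_moment \<nu> J l e" if "i \<in> I" for i x l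
    by (rule mixed_moment_cong) (use that assms(3) in auto)
  have 2: "mixed_moment \<nu> I l (e(i := x)) = mixed_moment \<nu> I l e" if "i \<in> J" for i x l
    by (rule mixed_moment_cong) (use that assms(3) in auto)
  have "mixed_moment \<nu> (I \<union> J) (k # ks) e =
      (\<Sum>i\<in>I. mixed_moment \<nu> (I \<union> J) ks (e(i := e i + k))) + (\<Sum>i\<in>J. mixed_moment \<nu> (I \<union> J) ks (e(i := e i + k)))"
    using assms by (simp add: sum.union_disjoint)
  also have "\<dots> = (\<Sum>i\<in>I. conv (\<lambda>l. mixed_moment \<nu> I l (e(i := e i + k))) (\<lambda>l. mixed_moment \<nu> J l e) ks) +
      (\<Sum>i\<in>J. conv (\<lambda>l. mixed_moment \<nu> I l e) (\<lambda>l. mixed_moment \<nu> J l (e(i := e i + k))) ks)"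
    unfolding Cons.IH by (intro arg_cong2[where f = "(+)"] sum.cong) (simp_all add: 1 2)
  finally show ?case by (simp add: conv_sum_left conv_sum_right)
qed

lemma expect_psum_monomial:
  assumes "\<nu> 0 = 1"
  shows "expect (\<lambda>_. \<nu>) ((\<Prod>k\<leftarrow>ks. psum n k) * (\<Prod>i<n. Var i ^ e i)) = mixed_moment \<nu> {..<n} ks e"
proof (induction ks arbitrary: e)
  case Nil
  then show ?case using assms by (simp add: expect_monomial)
next
  case (Cons k ks)
  have "psum n k * (\<Prod>i<n. Var i ^ e i) = (\<Sum>j<n. \<Prod>i<n. Var i ^ (e(j := e j + k)) i)"
  proof -
    have "Var j ^ k * (\<Prod>i<n. Var i ^ e i) = (\<Prod>i<n. Var i ^ (e(j := e j + k)) i)" if "j < n" for j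
    proof -
      have "(\<Prod>i<n. Var i ^ f i) = Var j ^ f j * (\<Prod>i\<in>{..<n} - {j}. Var i ^ f i)" for f :: "nat \<Rightarrow> nat"
        using that by (simp add: prod.remove)
      then show ?thesis by (simp add: power_add mult_ac)
    qed
    then show ?thesis by (simp add: psum_def sum_distrib_right)
  qed
  then have "(\<Prod>k\<leftarrow>k # ks. psum n k) * (\<Prod>i<n. Var i ^ e i) =
      (\<Sum>j<n. (\<Prod>k\<leftarrow>ks. psum n k) * (\<Prod>i<n. Var i ^ (e(j := e j + k)) i))"
    by (simp add: sum_distrib_left[symmetric] mult_ac)
  then show ?case by (simp only: expect_sum Cons.IH mixed_moment.simps)
qed

text \<open>Leibniz expansion of a Hankel determinant of the moments \<open>\<nu>\<close>, with power sums inserted.\<close>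
definition hankel :: "(nat \<Rightarrow> complex) \<Rightarrow> nat \<Rightarrow> nat list \<Rightarrow> complex" where
  "hankel \<nu> n ks = (\<Sum>\<tau> | \<tau> permutes {..<n}. of_int (sign \<tau>) * mixed_moment \<nu> {..<n} ks (\<lambda>i. i + \<tau> i))"

text \<open>Both Vandermonde factors are expanded into permutations. Power sums are symmetric, so
  only the relative permutation matters, and each \<sigma> contributes the same Hankel sum.\<close>

lemma expect_psum_vdm:
  assumes "\<nu> 0 = 1"
  shows "expect (\<lambda>_. \<nu>) ((\<Prod>k\<leftarrow>ks. psum n k) * (vdm n)\<^sup>2) = fact n * hankel \<nu> n ks"
proof -
  let ?P = "{\<tau>. \<tau> permutes {..<n}}"
  let ?Q = "\<Prod>k\<leftarrow>ks. psum n k"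
  have "?Q * (vdm n)\<^sup>2 = (\<Sum>\<sigma>\<in>?P. \<Sum>\<tau>\<in>?P. of_int (sign \<sigma> * sign \<tau>) * (?Q * (\<Prod>i<n. Var i ^ (\<sigma> i + \<tau> i))))"
    unfolding vdm_def Vandermonde[symmetric] power2_eq_square sum_product unfolding sum_distrib_left
    by (intro sum.cong refl) (simp add: power_add prod.distrib mult_ac)
  then have "expect (\<lambda>_. \<nu>) (?Q * (vdm n)\<^sup>2) =
      (\<Sum>\<sigma>\<in>?P. \<Sum>\<tau>\<in>?P. of_int (sign \<sigma> * sign \<tau>) * mixed_moment \<nu> {..<n} ks (\<lambda>i. \<sigma> i + \<tau> i))"
    by (simp only: expect_sum expect_of_int_mult expect_psum_monomial[where \<nu> = \<nu>, OF assms])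
  also have "\<dots> = (\<Sum>\<sigma>\<in>?P. hankel \<nu> n ks)"
  proof (rule sum.cong[OF refl])
    fix \<sigma> assume \<sigma>: "\<sigma> \<in> ?P"
    then have "(\<Sum>\<tau>\<in>?P. of_int (sign \<sigma> * sign \<tau>) * mixed_moment \<nu> {..<n} ks (\<lambda>i. \<sigma> i + \<tau> i)) =
        (\<Sum>\<tau>\<in>?P. of_int (sign \<sigma> * sign (\<tau> \<circ> \<sigma>)) * mixed_moment \<nu> {..<n} ks (\<lambda>i. \<sigma> i + (\<tau> \<circ> \<sigma>) i))"
      by (intro sum_permutations_compose_right) simp
    also have "\<dots> = hankel \<nu> n ks"
      unfolding hankel_def
    proof (rule sum.cong[OF refl])
      fix \<tau> assume \<tau>: "\<tau> \<in> ?P"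
      have "sign (\<tau> \<circ> \<sigma>) = sign \<tau> * sign \<sigma>"
        by (rule sign_compose) (use \<sigma> \<tau> in \<open>auto intro: permutes_imp_permutation[rotated]\<close>)
      moreover have "mixed_moment \<nu> {..<n} ks (\<lambda>i. \<sigma> i + (\<tau> \<circ> \<sigma>) i) = mixed_moment \<nu> {..<n} ks (\<lambda>i. i + \<tau> i)"
        using mixed_moment_permute[of \<sigma> "{..<n}" \<nu> ks "\<lambda>i. i + \<tau> i"] \<sigma> by (simp add: comp_def)
      moreover have "sign \<sigma> * (sign \<tau> * sign \<sigma>) = sign \<tau>"
        by (simp add: mult.left_commute)
      ultimately show "of_int (sign \<sigma> * sign (\<tau> \<circ> \<sigma>)) * mixed_moment \<nu> {..<n} ks (\<lambda>i. \<sigma> i + (\<tau> \<circ> \<sigma>) i) =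
          of_int (sign \<tau>) * mixed_moment \<nu> {..<n} ks (\<lambda>i. i + \<tau> i)"
        by (simp only:)
    qed
    finally show "(\<Sum>\<tau>\<in>?P. of_int (sign \<sigma> * sign \<tau>) * mixed_moment \<nu> {..<n} ks (\<lambda>i. \<sigma> i + \<tau> i)) = hankel \<nu> n ks" .
  qed
  also have "\<dots> = fact n * hankel \<nu> n ks"
    by (simp add: card_permutations)
  finally show ?thesis .
qed

section \<open>Permutations preserving parity\<close>

definition interleave :: "(nat \<Rightarrow> nat) \<Rightarrow> (nat \<Rightarrow> nat) \<Rightarrow> nat \<Rightarrow> nat" where
  "interleave \<sigma> \<tau> m = (if even m then 2 * \<sigma> (m div 2) else 2 * \<tau> (m div 2) + 1)"

text \<open>Written as transported permutations, the two factors inherit the permutation property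
  and the sign of the original.\<close>

lemma interleave_eq_map_permutation:
  assumes "\<sigma> permutes {..<p}"
  shows "interleave \<sigma> id = map_permutation {..<p} ((*) 2) \<sigma>"
    and "interleave id \<sigma> = map_permutation {..<p} (\<lambda>i. 2 * i + 1) \<sigma>"
proof -
  have fx: "\<sigma> j = j" if "j \<ge> p" for j
    using assms that by (auto simp: permutes_def)
  have i1: "inj_on ((*) (2::nat)) {..<p}" and i2: "inj_on (\<lambda>i::nat. 2 * i + 1) {..<p}"
    by (auto simp: inj_on_def)
  show "interleave \<sigma> id = map_permutation {..<p} ((*) 2) \<sigma>"
  proof
    fix m
    show "interleave \<sigma> id m = map_permutation {..<p} ((*) 2) \<sigma> m"
    proof (cases "m \<in> (*) 2 ` {..<p}")
      case True
      then obtain j where "m = 2 * j" "j < p" by auto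
      then show ?thesis using map_permutation_apply[OF i1, of j \<sigma>] by (simp add: interleave_def)
    next
      case False
      then have "map_permutation {..<p} ((*) 2) \<sigma> m = m" by (simp add: map_permutation_def restrict_id_def)
      moreover have "interleave \<sigma> id m = m"
        using False fx[of "m div 2"] by (cases "m div 2 < p") (auto simp: interleave_def elim!: evenE oddE)
      ultimately show ?thesis by simp
    qed
  qed
  show "interleave id \<sigma> = map_permutation {..<p} (\<lambda>i. 2 * i + 1) \<sigma>"
  proof
    fix m
    show "interleave id \<sigma> m = map_permutation {..<p} (\<lambda>i. 2 * i + 1) \<sigma> m"
    proof (cases "m \<in> (\<lambda>i. 2 * i + 1) ` {..<p}")
      case True
      then obtain j where "m = 2 * j + 1" "j < p" by auto
      then show ?thesis using map_permutation_apply[OF i2, of j \<sigma>] by (simp add: interleave_def)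
    next
      case False
      then have "map_permutation {..<p} (\<lambda>i. 2 * i + 1) \<sigma> m = m" by (simp add: map_permutation_def restrict_id_def)
      moreover have "interleave id \<sigma> m = m"
        using False fx[of "m div 2"] by (cases "m div 2 < p") (auto simp: interleave_def elim!: evenE oddE)
      ultimately show ?thesis by simp
    qed
  qed
qed

context
  fixes n p q :: nat
  assumes pq: "p = (n + 1) div 2" "q = n div 2"
begin

lemma interleave_permutes:
  assumes "\<sigma> permutes {..<p}" "\<tau> permutes {..<q}"
  shows "interleave \<sigma> \<tau> permutes {..<n}"
    and "sign (interleave \<sigma> \<tau>) = sign \<sigma> * sign \<tau>"
proof -
  have i1: "inj_on ((*) (2::nat)) {..<p}" and i2: "inj_on (\<lambda>i::nat. 2 * i + 1) {..<q}"
    by (auto simp: inj_on_def)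
  have 1: "interleave \<sigma> \<tau> = interleave \<sigma> id \<circ> interleave id \<tau>"
    by (auto simp: interleave_def fun_eq_iff)
  have s: "(*) 2 ` {..<p} \<subseteq> {..<n}" "(\<lambda>i. 2 * i + 1) ` {..<q} \<subseteq> {..<n}"
    using pq by auto
  have "interleave \<sigma> id permutes (*) 2 ` {..<p}"
    unfolding interleave_eq_map_permutation(1)[OF assms(1)]
    by (rule map_permutation_permutes) (use assms i1 in \<open>auto simp: bij_betw_def\<close>)
  then have p1: "interleave \<sigma> id permutes {..<n}" using s(1) by (rule permutes_subset)
  have "interleave id \<tau> permutes (\<lambda>i. 2 * i + 1) ` {..<q}"
    unfolding interleave_eq_map_permutation(2)[OF assms(2)]
    by (rule map_permutation_permutes) (use assms i2 in \<open>auto simp: bij_betw_def\<close>)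
  then have p2: "interleave id \<tau> permutes {..<n}" using s(2) by (rule permutes_subset)
  show "interleave \<sigma> \<tau> permutes {..<n}"
    unfolding 1 by (rule permutes_compose[OF p2 p1])
  have "sign (interleave \<sigma> \<tau>) = sign (interleave \<sigma> id) * sign (interleave id \<tau>)"
    unfolding 1 by (rule sign_compose) (use p1 p2 in \<open>auto intro: permutes_imp_permutation[rotated]\<close>)
  also have "sign (interleave \<sigma> id) = sign \<sigma>"
    unfolding interleave_eq_map_permutation(1)[OF assms(1)] by (rule sign_map_permutation) (use assms i1 in auto)
  also have "sign (interleave id \<tau>) = sign \<tau>"
    unfolding interleave_eq_map_permutation(2)[OF assms(2)] by (rule sign_map_permutation) (use assms i2 in auto)
  finally show "sign (interleave \<sigma> \<tau>) = sign \<sigma> * sign \<tau>" .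
qed

lemma lessThan_parity: "{..<n} = (*) 2 ` {..<p} \<union> (\<lambda>i. 2 * i + 1) ` {..<q}"
proof (intro Set.set_eqI iffI)
  fix m assume "m \<in> {..<n}"
  then show "m \<in> (*) 2 ` {..<p} \<union> (\<lambda>i. 2 * i + 1) ` {..<q}"
    using pq by (cases "even m") (auto elim!: evenE oddE simp: image_iff)
qed (use pq in auto)

text \<open>At an even position the exponent is 2 (i + \<sigma> i). At an odd one the two extra
  units make it 2 (i + \<tau> i) + 2; this shift is the extra factor x that distinguishes the second
  Laguerre weight.\<close>

lemma mixed_moment_interleave:
  "mixed_moment \<nu> {..<n} (map ((*) 2) ks) (\<lambda>m. m + interleave \<sigma> \<tau> m) =
     conv (\<lambda>l. mixed_moment (\<lambda>m. \<nu> (2 * m)) {..<p} l (\<lambda>i. i + \<sigma> i))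
       (\<lambda>l. mixed_moment (\<lambda>m. \<nu> (2 * m + 2)) {..<q} l (\<lambda>i. i + \<tau> i)) ks"
proof -
  have i1: "inj_on ((*) (2::nat)) {..<p}" and i2: "inj_on (\<lambda>i::nat. 2 * i + 1) {..<q}"
    by (auto simp: inj_on_def)
  have e1: "mixed_moment \<nu> ((*) 2 ` {..<p}) (map ((*) 2) l) (\<lambda>m. m + interleave \<sigma> \<tau> m) =
      mixed_moment (\<lambda>m. \<nu> (2 * m)) {..<p} l (\<lambda>i. i + \<sigma> i)" for l
    unfolding mixed_moment_reindex[OF i1] using mixed_moment_double[of \<nu> "{..<p}" l "\<lambda>i. i + \<sigma> i" 0]
    by (simp add: interleave_def)
  have e2: "mixed_moment \<nu> ((\<lambda>i. 2 * i + 1) ` {..<q}) (map ((*) 2) l) (\<lambda>m. m + interleave \<sigma> \<tau> m) =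
      mixed_moment (\<lambda>m. \<nu> (2 * m + 2)) {..<q} l (\<lambda>i. i + \<tau> i)" for l
    unfolding mixed_moment_reindex[OF i2] using mixed_moment_double[of \<nu> "{..<q}" l "\<lambda>i. i + \<tau> i" 2]
    by (simp add: interleave_def)
  show ?thesis
    unfolding lessThan_parity
  proof (subst mixed_moment_Un)
    show "(*) 2 ` {..<p} \<inter> (\<lambda>i. 2 * i + 1) ` {..<q} = {}" by auto presburger
    show "conv (\<lambda>l. mixed_moment \<nu> ((*) 2 ` {..<p}) l (\<lambda>m. m + interleave \<sigma> \<tau> m))
        (\<lambda>l. mixed_moment \<nu> ((\<lambda>i. 2 * i + 1) ` {..<q}) l (\<lambda>m. m + interleave \<sigma> \<tau> m)) (map ((*) 2) ks) =
      conv (\<lambda>l. mixed_moment (\<lambda>m. \<nu> (2 * m)) {..<p} l (\<lambda>i. i + \<sigma> i))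
       (\<lambda>l. mixed_moment (\<lambda>m. \<nu> (2 * m + 2)) {..<q} l (\<lambda>i. i + \<tau> i)) ks"
      unfolding conv_map e1 e2 ..
  qed auto
qed

text \<open>If the odd moments vanish, only permutations preserving parity survive, so the even and the odd
  indices separate. This splits the GUE into two independent Laguerre ensembles.\<close>
lemma hankel_parity:
  assumes odd: "\<And>m. odd m \<Longrightarrow> \<nu> m = 0"
  shows "hankel \<nu> n (map ((*) 2) ks) = conv (hankel (\<lambda>m. \<nu> (2 * m)) p) (hankel (\<lambda>m. \<nu> (2 * m + 2)) q) ks"
proof -
  let ?g = "\<lambda>\<tau>. of_int (sign \<tau>) * mixed_moment \<nu> {..<n} (map ((*) 2) ks) (\<lambda>i. i + \<tau> i)"
  let ?E = "{\<tau>. \<tau> permutes {..<n} \<and> (\<forall>i<n. even (i + \<tau> i))}"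
  let ?A = "{\<sigma>. \<sigma> permutes {..<p}}" and ?B = "{\<tau>. \<tau> permutes {..<q}}"
  have fin: "finite {\<tau>. \<tau> permutes {..<n}}" by (rule finite_permutations) simp
  have "hankel \<nu> n (map ((*) 2) ks) = sum ?g ?E"
    unfolding hankel_def
  proof (rule sum.mono_neutral_right[OF fin])
    show "\<forall>\<tau>\<in>{\<tau>. \<tau> permutes {..<n}} - ?E. ?g \<tau> = 0"
    proof
      fix \<tau> assume "\<tau> \<in> {\<tau>. \<tau> permutes {..<n}} - ?E"
      then obtain i where "i < n" "odd (i + \<tau> i)" by auto
      then have "mixed_moment \<nu> {..<n} (map ((*) 2) ks) (\<lambda>i. i + \<tau> i) = 0"
        by (intro mixed_moment_odd[of \<nu> "{..<n}" i, OF odd]) auto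
      then show "?g \<tau> = 0" by simp
    qed
  qed auto
  also have "\<dots> = (\<Sum>(\<sigma>, \<tau>)\<in>?A \<times> ?B. ?g (interleave \<sigma> \<tau>))"
  \<comment> \<open>A permutation preserving parity is interleaved from its restrictions to even and
    to odd numbers, each halved.\<close>
  proof (rule sum.reindex_bij_witness[of _ "\<lambda>(\<sigma>, \<tau>). interleave \<sigma> \<tau>" "\<lambda>\<tau>. (\<lambda>i. \<tau> (2 * i) div 2, \<lambda>i. \<tau> (2 * i + 1) div 2)"])
    fix \<tau> assume "\<tau> \<in> ?E"
    then have \<tau>: "\<tau> permutes {..<n}" and ev: "\<And>i. i < n \<Longrightarrow> even (i + \<tau> i)" by auto
    have ev': "even (\<tau> i) = even i" for i
      using ev[of i] \<tau> by (cases "i < n") (auto simp: permutes_def)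
    show inv: "(case (\<lambda>i. \<tau> (2 * i) div 2, \<lambda>i. \<tau> (2 * i + 1) div 2) of (\<sigma>, \<tau>) \<Rightarrow> interleave \<sigma> \<tau>) = \<tau>"
      using ev' by (auto simp: interleave_def fun_eq_iff elim!: evenE oddE)
    show "(case (\<lambda>i. \<tau> (2 * i) div 2, \<lambda>i. \<tau> (2 * i + 1) div 2) of (\<sigma>, \<tau>) \<Rightarrow> ?g (interleave \<sigma> \<tau>)) = ?g \<tau>"
      using inv by simp
    have bij: "bij \<tau>" using \<tau> by (rule permutes_bij)
    have fixn: "\<tau> i = i" if "i \<ge> n" for i using \<tau> that by (auto simp: permutes_def)
    have inj: "\<tau> x = \<tau> y \<Longrightarrow> x = y" for x y using bij by (auto simp: bij_def inj_def)
    have lt: "i < n \<Longrightarrow> \<tau> i < n" for i using permutes_in_image[OF \<tau>, of i] by simp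
    have "(\<lambda>i. \<tau> (2 * i) div 2) permutes {..<p}"
    proof (rule bij_imp_permutes)
      show "bij_betw (\<lambda>i. \<tau> (2 * i) div 2) {..<p} {..<p}"
      proof (rule bij_betwI')
        show "(\<tau> (2 * x) div 2 = \<tau> (2 * y) div 2) = (x = y)" for x y
          using inj[of "2 * x" "2 * y"] ev'[of "2 * x"] ev'[of "2 * y"] by (auto elim!: evenE)
        show "\<tau> (2 * x) div 2 \<in> {..<p}" if "x \<in> {..<p}" for x
        proof -
          have "2 * x < n" using that pq by auto
          then show ?thesis using lt[of "2 * x"] ev'[of "2 * x"] pq by (auto elim!: evenE)
        qed
        show "\<exists>x\<in>{..<p}. y = \<tau> (2 * x) div 2" if "y \<in> {..<p}" for y
        proof -
          obtain z where z: "\<tau> z = 2 * y" using bij by (metis bij_pointE)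
          have "even z" using ev'[of z] z by simp
          then obtain x where x: "z = 2 * x" by (auto elim!: evenE)
          have "z < n" using fixn[of z] z that pq by (cases "z < n") auto
          then show ?thesis using x z pq by (intro bexI[of _ x]) auto
        qed
      qed
      show "\<tau> (2 * x) div 2 = x" if "x \<notin> {..<p}" for x
        using fixn[of "2 * x"] that pq by auto
    qed
    moreover have "(\<lambda>i. \<tau> (2 * i + 1) div 2) permutes {..<q}"
    proof (rule bij_imp_permutes)
      show "bij_betw (\<lambda>i. \<tau> (2 * i + 1) div 2) {..<q} {..<q}"
      proof (rule bij_betwI')
        show "(\<tau> (2 * x + 1) div 2 = \<tau> (2 * y + 1) div 2) = (x = y)" for x y
          using inj[of "2 * x + 1" "2 * y + 1"] ev'[of "2 * x + 1"] ev'[of "2 * y + 1"] by (auto elim!: oddE)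
        show "\<tau> (2 * x + 1) div 2 \<in> {..<q}" if "x \<in> {..<q}" for x
        proof -
          have "2 * x + 1 < n" using that pq by auto
          then show ?thesis using lt[of "2 * x + 1"] ev'[of "2 * x + 1"] pq by (auto elim!: oddE)
        qed
        show "\<exists>x\<in>{..<q}. y = \<tau> (2 * x + 1) div 2" if "y \<in> {..<q}" for y
        proof -
          obtain z where z: "\<tau> z = 2 * y + 1" using bij by (metis bij_pointE)
          have "odd z" using ev'[of z] z by simp
          then obtain x where x: "z = 2 * x + 1" by (auto elim!: oddE)
          have "z < n" using fixn[of z] z that pq by (cases "z < n") auto
          then show ?thesis using x z pq by (intro bexI[of _ x]) auto
        qed
      qed
      show "\<tau> (2 * x + 1) div 2 = x" if "x \<notin> {..<q}" for x
        using fixn[of "2 * x + 1"] that pq by auto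
    qed
    ultimately show "(\<lambda>i. \<tau> (2 * i) div 2, \<lambda>i. \<tau> (2 * i + 1) div 2) \<in> ?A \<times> ?B" by simp
  next
    fix z assume "z \<in> ?A \<times> ?B"
    then obtain \<sigma> \<tau> where z: "z = (\<sigma>, \<tau>)" and st: "\<sigma> permutes {..<p}" "\<tau> permutes {..<q}" by auto
    show "(\<lambda>i. (case z of (\<sigma>, \<tau>) \<Rightarrow> interleave \<sigma> \<tau>) (2 * i) div 2, \<lambda>i. (case z of (\<sigma>, \<tau>) \<Rightarrow> interleave \<sigma> \<tau>) (2 * i + 1) div 2) = z"
      by (simp add: z interleave_def)
    show "(case z of (\<sigma>, \<tau>) \<Rightarrow> interleave \<sigma> \<tau>) \<in> ?E"
      using interleave_permutes(1)[OF st] by (auto simp: z interleave_def)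
  qed
  also have "\<dots> = (\<Sum>\<sigma>\<in>?A. \<Sum>\<tau>\<in>?B. of_int (sign \<sigma>) * (of_int (sign \<tau>) *
      conv (\<lambda>l. mixed_moment (\<lambda>m. \<nu> (2 * m)) {..<p} l (\<lambda>i. i + \<sigma> i))
       (\<lambda>l. mixed_moment (\<lambda>m. \<nu> (2 * m + 2)) {..<q} l (\<lambda>i. i + \<tau> i)) ks))"
    unfolding sum.cartesian_product[symmetric]
    by (intro sum.cong refl) (simp add: interleave_permutes(2) mixed_moment_interleave)
  also have "\<dots> = conv (hankel (\<lambda>m. \<nu> (2 * m)) p) (hankel (\<lambda>m. \<nu> (2 * m + 2)) q) ks"
    unfolding hankel_def conv_sum_left conv_mult_left conv_sum_right conv_mult_right sum_distrib_left ..
  finally show ?thesis .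
qed

end

section \<open>Hermitian Gaussian matrices\<close>

text \<open>The tag of a variable distinguishes the real (\<open>False\<close>) and the imaginary part (\<open>True\<close>).\<close>
definition gue_mat :: "nat \<Rightarrow> (bool \<times> nat \<times> nat) cpoly mat" where
  "gue_mat n = mat n n (\<lambda>(i, j). Cst (1/2) * (Var (False, i, j) + Var (False, j, i)) +
     Cst (\<i>/2) * (Var (True, i, j) - Var (True, j, i)))"

lemma gue_mat_carrier [simp]: "gue_mat n \<in> carrier_mat n n"
  by (simp add: gue_mat_def)

lemma gue_mat_pow_carrier [simp]: "gue_mat n ^\<^sub>m k \<in> carrier_mat n n"
  by simp

text \<open>The combination of partial derivatives that Gaussian integration by parts attaches to
  the entry (i, j). It has the same coefficients as the entry itself because all underlying normals
  have variance one.\<close>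

definition gue_pd :: "nat \<Rightarrow> nat \<Rightarrow> (bool \<times> nat \<times> nat) cpoly \<Rightarrow> (bool \<times> nat \<times> nat) cpoly" where
  "gue_pd i j f = Cst (1/2) * (pd (False, i, j) f + pd (False, j, i) f) +
     Cst (\<i>/2) * (pd (True, i, j) f - pd (True, j, i) f)"

lemma derivation_gue_pd: "derivation (gue_pd i j)"
  unfolding derivation_def gue_pd_def by (simp add: pd_add pd_mult algebra_simps)

lemma gue_pd_gue_mat:
  assumes "k < n" "l < n"
  shows "gue_pd i j (gue_mat n $$ (k, l)) = (if i = l \<and> j = k then 1 else 0)"
proof -
  let ?h = "Cst (1/2) :: (bool \<times> nat \<times> nat) cpoly" and ?i = "Cst (\<i>/2) :: (bool \<times> nat \<times> nat) cpoly"
  define \<delta> :: "nat \<Rightarrow> nat \<Rightarrow> (bool \<times> nat \<times> nat) cpoly" where "\<delta> a b = (if a = k \<and> b = l then 1 else 0)" for a b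
  have g: "gue_mat n $$ (k, l) = ?h * (Var (False, k, l) + Var (False, l, k)) + ?i * (Var (True, k, l) - Var (True, l, k))"
    using assms by (simp add: gue_mat_def)
  have F: "pd (False, a, b) (gue_mat n $$ (k, l)) = ?h * (\<delta> a b + \<delta> b a)" for a b
    unfolding g by (simp add: pd_add pd_mult derivation_diff[OF derivation_pd] pd_Var \<delta>_def conj_commute)
  have T: "pd (True, a, b) (gue_mat n $$ (k, l)) = ?i * (\<delta> a b - \<delta> b a)" for a b
    unfolding g by (simp add: pd_add pd_mult derivation_diff[OF derivation_pd] pd_Var \<delta>_def conj_commute)
  \<comment> \<open>Only the relations between the constants 1/2 and i/2 matter: the contributions
    of \<open>a\<close> cancel between real and imaginary parts and those of \<open>b\<close> add
    up.\<close>
  have alg: "h * (h * (a + b) + h * (b + a)) + c * (c * (a - b) - c * (b - a)) = b"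
    if "c * c = - (h * h)" "4 * (h * h) = 1" for a b c h :: "(bool \<times> nat \<times> nat) cpoly"
  proof -
    have "h * (h * (a + b) + h * (b + a)) + c * (c * (a - b) - c * (b - a)) = 2 * (h * h) * (a + b) + 2 * (c * c) * (a - b)"
      by (simp add: algebra_simps)
    also have "\<dots> = 4 * (h * h) * b" unfolding that(1) by (simp add: algebra_simps)
    finally show ?thesis unfolding that(2) by simp
  qed
  have ii: "?i * ?i = - (?h * ?h)"
    by (simp flip: Cst_mult Cst_minus)
  have hh: "4 * (?h * ?h) = 1"
  proof -
    have "Cst 4 = (4 :: (bool \<times> nat \<times> nat) cpoly)" using Cst_of_nat[of 4, where 'a = "bool \<times> nat \<times> nat"] by simp
    then have "4 * (?h * ?h) = Cst (4 * (1/2 * (1/2)))" by (simp only: Cst_mult)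
    then show ?thesis by simp
  qed
  have "gue_pd i j (gue_mat n $$ (k, l)) = \<delta> j i"
    unfolding gue_pd_def F T by (rule alg[OF ii hh])
  then show ?thesis by (auto simp: \<delta>_def)
qed

lemma expect_gue_mat_mult:
  assumes \<mu>: "\<And>v. \<mu> v 0 = 1" "\<And>v. v \<in> UNIV \<times> {..<n} \<times> {..<n} \<Longrightarrow> \<mu> v 1 = 0" "\<And>v e. v \<in> UNIV \<times> {..<n} \<times> {..<n} \<Longrightarrow> \<mu> v (e + 2) = of_nat (e + 1) * \<mu> v e"
    and ij: "i < n" "j < n"
  shows "expect \<mu> (gue_mat n $$ (i, j) * f) = expect \<mu> (gue_pd i j f)"
proof -
  have V: "expect \<mu> (Var v * f) = expect \<mu> (pd v f)" if "v \<in> UNIV \<times> {..<n} \<times> {..<n}" for v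
    by (rule expect_Var_normal) (use \<mu> that in auto)
  have "gue_mat n $$ (i, j) * f = Cst (1/2) * (Var (False, i, j) * f + Var (False, j, i) * f) +
     Cst (\<i>/2) * (Var (True, i, j) * f - Var (True, j, i) * f)"
    using ij by (simp add: gue_mat_def algebra_simps)
  then show ?thesis
    using ij by (simp add: gue_pd_def expect_add expect_diff expect_Cst_mult V)
qed

text \<open>The derivative hits one of the k factors and cuts the product there into two
  powers.\<close>

lemma gue_pd_gue_mat_pow:
  assumes "r < n" "s < n" "i < n" "j < n"
  shows "gue_pd i j ((gue_mat n ^\<^sub>m k) $$ (r, s)) = (\<Sum>a<k. (gue_mat n ^\<^sub>m a) $$ (r, j) * (gue_mat n ^\<^sub>m (k - 1 - a)) $$ (i, s))"
  using assms(2)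
proof (induction k arbitrary: s)
  case 0
  then show ?case using assms by (auto simp: gue_mat_def derivation_simps[OF derivation_gue_pd])
next
  case (Suc k)
  let ?A = "gue_mat n"
  have mul: "(?A ^\<^sub>m Suc m) $$ (r', s') = (\<Sum>v<n. (?A ^\<^sub>m m) $$ (r', v) * ?A $$ (v, s'))" if "r' < n" "s' < n" for m r' s'
    using index_mult_sum[OF gue_mat_pow_carrier gue_mat_carrier that] by simp
  have "gue_pd i j ((?A ^\<^sub>m Suc k) $$ (r, s)) =
      (\<Sum>v<n. gue_pd i j ((?A ^\<^sub>m k) $$ (r, v)) * ?A $$ (v, s)) + (\<Sum>v<n. (?A ^\<^sub>m k) $$ (r, v) * gue_pd i j (?A $$ (v, s)))"
    unfolding mul[OF assms(1) Suc.prems] derivation_sum[OF derivation_gue_pd] derivation_mult[OF derivation_gue_pd] sum.distrib ..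
  also have "(\<Sum>v<n. (?A ^\<^sub>m k) $$ (r, v) * gue_pd i j (?A $$ (v, s))) = (\<Sum>v<n. if v = j then (if i = s then (?A ^\<^sub>m k) $$ (r, j) else 0) else 0)"
    by (rule sum.cong) (use Suc.prems in \<open>auto simp: gue_pd_gue_mat\<close>)
  also have "\<dots> = (?A ^\<^sub>m k) $$ (r, j) * (?A ^\<^sub>m (Suc k - 1 - k)) $$ (i, s)"
    using assms Suc.prems by (simp add: sum.delta one_mat_def gue_mat_def)
  also have "(\<Sum>v<n. gue_pd i j ((?A ^\<^sub>m k) $$ (r, v)) * ?A $$ (v, s)) =
      (\<Sum>v<n. \<Sum>a<k. (?A ^\<^sub>m a) $$ (r, j) * (?A ^\<^sub>m (k - 1 - a)) $$ (i, v) * ?A $$ (v, s))"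
    by (rule sum.cong) (simp_all add: Suc.IH sum_distrib_right)
  also have "\<dots> = (\<Sum>a<k. (?A ^\<^sub>m a) $$ (r, j) * (\<Sum>v<n. (?A ^\<^sub>m (k - 1 - a)) $$ (i, v) * ?A $$ (v, s)))"
    by (subst sum.swap) (simp add: sum_distrib_left mult.assoc)
  also have "\<dots> = (\<Sum>a<k. (?A ^\<^sub>m a) $$ (r, j) * (?A ^\<^sub>m (Suc k - 1 - a)) $$ (i, s))"
  proof (rule sum.cong[OF refl])
    fix a assume "a \<in> {..<k}"
    then have "Suc k - 1 - a = Suc (k - 1 - a)" by auto
    then show "(?A ^\<^sub>m a) $$ (r, j) * (\<Sum>v<n. (?A ^\<^sub>m (k - 1 - a)) $$ (i, v) * ?A $$ (v, s)) =
        (?A ^\<^sub>m a) $$ (r, j) * (?A ^\<^sub>m (Suc k - 1 - a)) $$ (i, s)"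
      using mul[OF assms(3) Suc.prems, of "k - 1 - a"] by (simp only:)
  qed
  finally show ?case by simp
qed

lemma sum_sum_index_eq_tr:
  assumes "A \<in> carrier_mat n n" "B \<in> carrier_mat n n"
  shows "(\<Sum>i<n. \<Sum>j<n. A $$ (j, i) * B $$ (i, j)) = tr (A * B)"
proof -
  have "tr (A * B) = (\<Sum>j<n. \<Sum>i<n. A $$ (j, i) * B $$ (i, j))"
    using assms by (simp add: tr_def index_mult_sum del: index_mult_mat(1))
  then show ?thesis by (subst sum.swap) simp
qed

lemma gue_pd_tr:
  assumes "i < n" "j < n"
  shows "gue_pd i j (tr (gue_mat n ^\<^sub>m m)) = of_nat m * (gue_mat n ^\<^sub>m (m - 1)) $$ (i, j)"
proof -
  have dim: "dim_row (gue_mat n ^\<^sub>m m) = n" by (simp add: gue_mat_def)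
  have "gue_pd i j (tr (gue_mat n ^\<^sub>m m)) = (\<Sum>r<n. \<Sum>a<m. (gue_mat n ^\<^sub>m a) $$ (r, j) * (gue_mat n ^\<^sub>m (m - 1 - a)) $$ (i, r))"
    unfolding tr_def dim derivation_sum[OF derivation_gue_pd]
    by (rule sum.cong) (use assms in \<open>auto simp: gue_pd_gue_mat_pow\<close>)
  also have "\<dots> = (\<Sum>a<m. \<Sum>r<n. (gue_mat n ^\<^sub>m (m - 1 - a)) $$ (i, r) * (gue_mat n ^\<^sub>m a) $$ (r, j))"
    by (subst sum.swap) (simp add: mult.commute)
  also have "\<dots> = (\<Sum>a<m. (gue_mat n ^\<^sub>m (m - 1)) $$ (i, j))"
  proof (rule sum.cong[OF refl])
    fix a assume "a \<in> {..<m}"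
    then have "m - 1 = (m - 1 - a) + a" by auto
    then have "gue_mat n ^\<^sub>m (m - 1) = gue_mat n ^\<^sub>m (m - 1 - a) * gue_mat n ^\<^sub>m a"
      using pow_mat_add[OF gue_mat_carrier, of n "m - 1 - a" a] by simp
    then show "(\<Sum>r<n. (gue_mat n ^\<^sub>m (m - 1 - a)) $$ (i, r) * (gue_mat n ^\<^sub>m a) $$ (r, j)) = (gue_mat n ^\<^sub>m (m - 1)) $$ (i, j)"
      using index_mult_sum[OF gue_mat_pow_carrier gue_mat_pow_carrier assms, of "m - 1 - a" a] by simp
  qed
  finally show ?thesis by simp
qed

text \<open>One factor is integrated by parts. The derivative falls on the remaining power, which
  splits the trace in two, or on another trace, which joins the two. Hence the recursion is that of
  the squared Vandermonde weight, without any change of variables to eigenvalues.\<close>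

lemma gue_recursion_tr:
  assumes \<mu>: "\<And>v. \<mu> v 0 = 1" "\<And>v. v \<in> UNIV \<times> {..<n} \<times> {..<n} \<Longrightarrow> \<mu> v 1 = 0" "\<And>v e. v \<in> UNIV \<times> {..<n} \<times> {..<n} \<Longrightarrow> \<mu> v (e + 2) = of_nat (e + 1) * \<mu> v e"
  shows "gue_recursion n (\<lambda>ks. expect \<mu> (\<Prod>k\<leftarrow>ks. tr (gue_mat n ^\<^sub>m k)))"
proof -
  let ?A = "gue_mat n"
  define P where "P k = tr (?A ^\<^sub>m k)" for k
  define D where "D k f = (\<Sum>i<n. \<Sum>j<n. (?A ^\<^sub>m k) $$ (j, i) * gue_pd i j f)" for k f
  have derD: "derivation (D k)" for k
    unfolding derivation_def D_def
    by (simp add: derivation_add[OF derivation_gue_pd] derivation_mult[OF derivation_gue_pd] algebra_simps sum.distrib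
        sum_distrib_left sum_distrib_right)
  have DP: "D k (P m) = 1 * of_nat m * P (m + k - 1)" for k m
  proof -
    have "D k (P m) = of_nat m * (\<Sum>i<n. \<Sum>j<n. (?A ^\<^sub>m k) $$ (j, i) * (?A ^\<^sub>m (m - 1)) $$ (i, j))"
      unfolding D_def P_def sum_distrib_left by (intro sum.cong refl) (simp add: gue_pd_tr mult_ac)
    also have "(\<Sum>i<n. \<Sum>j<n. (?A ^\<^sub>m k) $$ (j, i) * (?A ^\<^sub>m (m - 1)) $$ (i, j)) = tr (?A ^\<^sub>m (k + (m - 1)))"
      by (simp add: sum_sum_index_eq_tr pow_mat_add[OF gue_mat_carrier])
    finally show ?thesis by (cases m) (simp_all add: P_def add.commute)
  qed
  have loop: "expect \<mu> (P (Suc k) * f) = expect \<mu> ((\<Sum>a<k. P a * P (k - 1 - a)) * f + D k f)" for k f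
  proof -
    have "P (Suc k) = tr (?A ^\<^sub>m k * ?A)" by (simp add: P_def)
    also have "\<dots> = (\<Sum>i<n. \<Sum>j<n. (?A ^\<^sub>m k) $$ (j, i) * ?A $$ (i, j))"
      by (rule sum_sum_index_eq_tr[symmetric]) auto
    finally have Pk: "P (Suc k) = (\<Sum>i<n. \<Sum>j<n. (?A ^\<^sub>m k) $$ (j, i) * ?A $$ (i, j))" .
    have "P (Suc k) * f = (\<Sum>i<n. \<Sum>j<n. ?A $$ (i, j) * ((?A ^\<^sub>m k) $$ (j, i) * f))"
      unfolding Pk sum_distrib_right by (intro sum.cong refl) (simp only: mult_ac)
    then have "expect \<mu> (P (Suc k) * f) = (\<Sum>i<n. \<Sum>j<n. expect \<mu> (?A $$ (i, j) * ((?A ^\<^sub>m k) $$ (j, i) * f)))"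
      by (simp only: expect_sum)
    also have "\<dots> = (\<Sum>i<n. \<Sum>j<n. expect \<mu> (gue_pd i j ((?A ^\<^sub>m k) $$ (j, i) * f)))"
      by (intro sum.cong refl expect_gue_mat_mult \<mu>) auto
    also have "\<dots> = (\<Sum>i<n. \<Sum>j<n. expect \<mu> ((\<Sum>a<k. (?A ^\<^sub>m a) $$ (j, j) * (?A ^\<^sub>m (k - 1 - a)) $$ (i, i)) * f
        + (?A ^\<^sub>m k) $$ (j, i) * gue_pd i j f))"
      by (intro sum.cong refl) (simp add: derivation_mult[OF derivation_gue_pd] gue_pd_gue_mat_pow)
    also have "\<dots> = expect \<mu> ((\<Sum>i<n. \<Sum>j<n. \<Sum>a<k. (?A ^\<^sub>m a) $$ (j, j) * (?A ^\<^sub>m (k - 1 - a)) $$ (i, i)) * f + D k f)"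
      unfolding D_def sum_distrib_right expect_add expect_sum sum.distrib ..
    also have "(\<Sum>i<n. \<Sum>j<n. \<Sum>a<k. (?A ^\<^sub>m a) $$ (j, j) * (?A ^\<^sub>m (k - 1 - a)) $$ (i, i)) = (\<Sum>a<k. P a * P (k - 1 - a))"
    proof -
      have dim: "dim_row (?A ^\<^sub>m m) = n" for m by (simp add: gue_mat_def)
      have "(\<Sum>i<n. \<Sum>j<n. \<Sum>a<k. (?A ^\<^sub>m a) $$ (j, j) * (?A ^\<^sub>m (k - 1 - a)) $$ (i, i)) =
          (\<Sum>i<n. \<Sum>a<k. \<Sum>j<n. (?A ^\<^sub>m a) $$ (j, j) * (?A ^\<^sub>m (k - 1 - a)) $$ (i, i))"
        by (rule sum.cong[OF refl], rule sum.swap)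
      also have "\<dots> = (\<Sum>a<k. \<Sum>i<n. \<Sum>j<n. (?A ^\<^sub>m a) $$ (j, j) * (?A ^\<^sub>m (k - 1 - a)) $$ (i, i))"
        by (rule sum.swap)
      also have "\<dots> = (\<Sum>a<k. P a * P (k - 1 - a))"
        unfolding P_def tr_def dim sum_product by (rule sum.cong[OF refl], rule sum.swap)
      finally show ?thesis .
    qed
    finally show ?thesis .
  qed
  have "expect \<mu> (\<Prod>k\<leftarrow>Suc k # ks. P k) = (\<Sum>i<k. expect \<mu> (\<Prod>k\<leftarrow>i # (k - 1 - i) # ks. P k)) +
      (\<Sum>j<length ks. of_nat (ks ! j) * expect \<mu> (\<Prod>k\<leftarrow>ks[j := ks ! j + k - 1]. P k))" for k ks
  proof -
    have "expect \<mu> (\<Prod>k\<leftarrow>Suc k # ks. P k) = expect \<mu> ((\<Sum>a<k. P a * P (k - 1 - a)) * (\<Prod>k\<leftarrow>ks. P k) + D k (\<Prod>k\<leftarrow>ks. P k))"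
      using loop[of k "\<Prod>k\<leftarrow>ks. P k"] by simp
    also have "\<dots> = expect \<mu> ((\<Sum>a<k. \<Prod>k\<leftarrow>a # (k - 1 - a) # ks. P k) +
        (\<Sum>j<length ks. of_nat (ks ! j) * (\<Prod>k\<leftarrow>ks[j := ks ! j + k - 1]. P k)))"
      unfolding derivation_prod_list[where g = "\<lambda>m. m + k - 1", OF derD DP]
      by (simp add: sum_distrib_right mult.assoc)
    finally show ?thesis by (simp only: expect_add expect_sum expect_of_nat_mult)
  qed
  moreover have "P 0 = of_nat n" by (simp add: P_def tr_def gue_mat_def)
  ultimately show ?thesis
    unfolding gue_recursion_def P_def[symmetric] by (simp add: expect_of_nat_mult)
qed

section \<open>Normal moments and the probability space of the GUE\<close>

definition normal_moment :: "nat \<Rightarrow> real" where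
  "normal_moment e = (if even e then fact e / (2 ^ (e div 2) * fact (e div 2)) else 0)"

lemma normal_moment_simps [simp]: "normal_moment 0 = 1" "normal_moment (Suc 0) = 0"
  by (auto simp: normal_moment_def)

lemma normal_moment_odd: "odd e \<Longrightarrow> normal_moment e = 0"
  by (simp add: normal_moment_def)

lemma normal_moment_rec: "normal_moment (e + 2) = real (e + 1) * normal_moment e"
proof (cases "even e")
  case True
  then obtain k where "e = 2 * k" by (rule evenE)
  then have "normal_moment (e + 2) = ((2 * (real k + 1)) * ((2 * real k + 1) * fact (2 * k))) / ((2 * (real k + 1)) * (2 ^ k * fact k))"
    by (simp add: normal_moment_def algebra_simps)
  also have "\<dots> = ((2 * real k + 1) * fact (2 * k)) / (2 ^ k * fact k)"
    by (rule mult_divide_mult_cancel_left) simp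
  finally show ?thesis using \<open>e = 2 * k\<close> by (simp add: normal_moment_def)
qed (simp add: normal_moment_def)

abbreviation std_normal :: "real measure" where
  "std_normal \<equiv> density lborel std_normal_density"

lemma prob_space_std_normal: "prob_space std_normal"
  by (rule prob_space_normal_density) simp

lemma has_bochner_integral_std_normal_power:
  "has_bochner_integral std_normal (\<lambda>x. x ^ e) (normal_moment e)"
proof (rule has_bochner_integral_density)
  show "has_bochner_integral lborel (\<lambda>x. std_normal_density x *\<^sub>R x ^ e) (normal_moment e)"
  proof (cases "even e")
    case True
    then obtain k where "e = 2 * k" by (rule evenE)
    then show ?thesis using std_normal_moment_even[of k] by (simp add: normal_moment_def)
  next
    case False
    then obtain k where "e = 2 * k + 1" by (rule oddE)
    then show ?thesis using std_normal_moment_odd[of k] by (simp add: normal_moment_def)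
  qed
qed auto

lemma has_bochner_integral_PiM_std_normal:
  assumes "finite I"
  shows "has_bochner_integral (Pi\<^sub>M I (\<lambda>_. std_normal)) (\<lambda>x. \<Prod>i\<in>I. x i ^ e i) (\<Prod>i\<in>I. normal_moment (e i))"
proof -
  interpret prob_space std_normal by (rule prob_space_std_normal)
  interpret product_prob_space "\<lambda>_. std_normal" ..
  note m = has_bochner_integral_std_normal_power
  show ?thesis
    using product_integrable_prod[OF assms, of "\<lambda>i x. x ^ e i"] product_integral_prod[OF assms, of "\<lambda>i x. x ^ e i"] m
    by (auto simp: has_bochner_integral_iff)
qed

lemma has_bochner_integral_pair_mult:
  fixes f :: "'a \<Rightarrow> real" and g :: "'b \<Rightarrow> real"
  assumes "prob_space M" "prob_space N"
    and f: "has_bochner_integral M f a" and g: "has_bochner_integral N g b"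
  shows "has_bochner_integral (M \<Otimes>\<^sub>M N) (\<lambda>z. f (fst z) * g (snd z)) (a * b)"
proof -
  interpret M: prob_space M by fact
  interpret N: prob_space N by fact
  interpret pair_prob_space M N ..
  have [measurable]: "f \<in> borel_measurable M" "g \<in> borel_measurable N"
    using f g by (auto dest: borel_measurable_has_bochner_integral)
  have fi: "integrable M f" "integral\<^sup>L M f = a" and gi: "integrable N g" "integral\<^sup>L N g = b"
    using f g by (auto simp: has_bochner_integral_iff)
  have int: "integrable (M \<Otimes>\<^sub>M N) (\<lambda>z. f (fst z) * g (snd z))"
    by (rule Fubini_integrable) (use fi gi in \<open>auto simp: abs_mult\<close>)
  have "(\<integral>z. f (fst z) * g (snd z) \<partial>(M \<Otimes>\<^sub>M N)) = (\<integral>x. \<integral>y. f x * g y \<partial>N \<partial>M)"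
    using integral_fst'[OF int] by simp
  also have "\<dots> = a * b" using fi gi by simp
  finally show ?thesis using int by (simp add: has_bochner_integral_iff)
qed

abbreviation normal_matrix :: "nat \<Rightarrow> (nat \<times> nat \<Rightarrow> real) measure" where
  "normal_matrix n \<equiv> Pi\<^sub>M ({..<n} \<times> {..<n}) (\<lambda>_. std_normal)"

lemma prob_space_normal_matrix: "prob_space (normal_matrix n)"
  by (rule prob_space_PiM) (rule prob_space_std_normal)

definition gue_var :: "bool \<times> nat \<times> nat \<Rightarrow> (nat \<times> nat \<Rightarrow> real) \<times> (nat \<times> nat \<Rightarrow> real) \<Rightarrow> real" where
  "gue_var v \<omega> = (if fst v then snd \<omega> (snd v) else fst \<omega> (snd v))"

lemma has_bochner_integral_gue_monomial:
  "has_bochner_integral (normal_matrix n \<Otimes>\<^sub>M normal_matrix n)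
     (\<lambda>\<omega>. \<Prod>v\<in>UNIV \<times> {..<n} \<times> {..<n}. gue_var v \<omega> ^ e v) (\<Prod>v\<in>UNIV \<times> {..<n} \<times> {..<n}. normal_moment (e v))"
proof -
  let ?I = "{..<n} \<times> {..<n}"
  have split: "(\<Prod>v\<in>UNIV \<times> ?I. h v) = (\<Prod>i\<in>?I. h (False, i)) * (\<Prod>i\<in>?I. h (True, i))" for h :: "bool \<times> nat \<times> nat \<Rightarrow> real"
  proof -
    have "UNIV \<times> ?I = Pair False ` ?I \<union> Pair True ` ?I" by (auto simp: image_iff)
    then have "(\<Prod>v\<in>UNIV \<times> ?I. h v) = prod h (Pair False ` ?I) * prod h (Pair True ` ?I)"
      by (simp only:) (rule prod.union_disjoint, auto)
    then show ?thesis by (simp add: prod.reindex inj_on_def)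
  qed
  show ?thesis
    unfolding split gue_var_def
    using has_bochner_integral_pair_mult[OF prob_space_normal_matrix prob_space_normal_matrix
        has_bochner_integral_PiM_std_normal[of ?I "\<lambda>i. e (False, i)"]
        has_bochner_integral_PiM_std_normal[of ?I "\<lambda>i. e (True, i)"]]
    by simp
qed

definition gue_map :: "nat \<Rightarrow> (nat \<times> nat \<Rightarrow> real) \<times> (nat \<times> nat \<Rightarrow> real) \<Rightarrow> complex mat" where
  "gue_map n = (\<lambda>(x, y). let G = mat n n (\<lambda>ij. Complex (x ij) (y ij)) in (1 / 2) \<cdot>\<^sub>m (G + mat_adjoint G))"

lemma gue_eq: "gue n = distr (normal_matrix n \<Otimes>\<^sub>M normal_matrix n) (mat_borel n) (gue_map n)"
  by (simp add: gue_def gue_map_def Let_def)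

lemma mat_adjoint_index:
  assumes "A \<in> carrier_mat n m" "i < m" "j < n"
  shows "mat_adjoint A $$ (i, j) = cnj (A $$ (j, i))"
  using assms by (simp add: mat_adjoint_def mat_of_rows_index)

lemma mat_adjoint_carrier: "A \<in> carrier_mat n m \<Longrightarrow> mat_adjoint A \<in> carrier_mat m n"
  by (auto simp: mat_adjoint_def)

text \<open>Identifies the sampled matrix with an evaluation of the formal one, so that formal
  expectations become GUE expectations.\<close>

lemma gue_map_eq:
  "gue_map n \<omega> = map_mat (peval (\<lambda>v. if v \<in> UNIV \<times> {..<n} \<times> {..<n} then of_real (gue_var v \<omega>) else 1)) (gue_mat n)"
proof (rule eq_matI)
  let ?z = "\<lambda>v. if v \<in> UNIV \<times> {..<n} \<times> {..<n} then of_real (gue_var v \<omega>) else (1::complex)"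
  obtain x y where w: "\<omega> = (x, y)" by (cases \<omega>)
  let ?G = "mat n n (\<lambda>ij. Complex (x ij) (y ij))"
  have G: "?G \<in> carrier_mat n n" by simp
  note c = mat_adjoint_carrier[OF G]
  have m: "gue_map n \<omega> = (1 / 2) \<cdot>\<^sub>m (?G + mat_adjoint ?G)" by (simp add: gue_map_def w Let_def)
  show "gue_map n \<omega> $$ (i, j) = map_mat (peval ?z) (gue_mat n) $$ (i, j)"
    if "i < dim_row (map_mat (peval ?z) (gue_mat n))" "j < dim_col (map_mat (peval ?z) (gue_mat n))" for i j
  proof -
    have ij: "i < n" "j < n" using that by (auto simp: gue_mat_def)
    have "gue_map n \<omega> $$ (i, j) = 1 / 2 * (Complex (x (i, j)) (y (i, j)) + cnj (Complex (x (j, i)) (y (j, i))))"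
      using ij c G by (simp add: m mat_adjoint_index[OF G])
    moreover have "map_mat (peval ?z) (gue_mat n) $$ (i, j) =
        1 / 2 * (of_real (x (i, j)) + of_real (x (j, i))) + \<i> / 2 * (of_real (y (i, j)) - of_real (y (j, i)))"
      using ij by (simp add: gue_mat_def peval.hom_add peval.hom_mult peval.hom_minus gue_var_def w)
    ultimately show ?thesis by (simp add: complex_eq_iff)
  qed
  show "dim_row (gue_map n \<omega>) = dim_row (map_mat (peval ?z) (gue_mat n))"
    "dim_col (gue_map n \<omega>) = dim_col (map_mat (peval ?z) (gue_mat n))"
    using c by (simp_all add: m gue_mat_def)
qed

section \<open>Singular values and power sums\<close>

lemma peval_tr_pow:
  assumes "A \<in> carrier_mat n n"
  shows "peval z (tr (A ^\<^sub>m k)) = tr (map_mat (peval z) A ^\<^sub>m k)"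
proof -
  have "tr (map_mat (peval z) (A ^\<^sub>m k)) = peval z (tr (A ^\<^sub>m k))"
    using assms by (simp add: tr_def peval.hom_sum)
  then show ?thesis by (simp add: peval.mat_hom_pow[OF assms])
qed

lemma upper_triangular_mult:
  fixes A B :: "'r::comm_ring_1 mat"
  assumes A: "A \<in> carrier_mat n n" "upper_triangular A" and B: "B \<in> carrier_mat n n" "upper_triangular B"
  shows "upper_triangular (A * B)" "\<And>i. i < n \<Longrightarrow> (A * B) $$ (i, i) = A $$ (i, i) * B $$ (i, i)"
proof -
  have a: "A $$ (i, j) = 0" if "j < i" "i < n" for i j using upper_triangularD[OF A(2), of j i] A that by auto
  have b: "B $$ (i, j) = 0" if "j < i" "i < n" for i j using upper_triangularD[OF B(2), of j i] B that by auto
  have e: "(A * B) $$ (i, j) = (\<Sum>l<n. A $$ (i, l) * B $$ (l, j))" if "i < n" "j < n" for i j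
    by (rule index_mult_sum[OF A(1) B(1) that])
  show "upper_triangular (A * B)"
  proof (rule upper_triangularI)
    fix i j assume ij: "j < i" "i < dim_row (A * B)"
    then have n: "i < n" "j < n" using A by auto
    show "(A * B) $$ (i, j) = 0"
      unfolding e[OF n]
    proof (rule sum.neutral, rule ballI)
      fix l assume "l \<in> {..<n}"
      then show "A $$ (i, l) * B $$ (l, j) = 0" using a[of l i] b[of j l] ij n by (cases "l < i") auto
    qed
  qed
  show "(A * B) $$ (i, i) = A $$ (i, i) * B $$ (i, i)" if i: "i < n" for i
  proof -
    have "(\<Sum>l<n. A $$ (i, l) * B $$ (l, i)) = (\<Sum>l\<in>{i}. A $$ (i, l) * B $$ (l, i))"
    proof (rule sum.mono_neutral_right)
      show "\<forall>l\<in>{..<n} - {i}. A $$ (i, l) * B $$ (l, i) = 0"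
      proof
        fix l assume "l \<in> {..<n} - {i}"
        then show "A $$ (i, l) * B $$ (l, i) = 0" using a[of l i] b[of i l] i by (cases "l < i") auto
      qed
    qed (use i in auto)
    then show ?thesis unfolding e[OF i i] by simp
  qed
qed

lemma upper_triangular_pow_diag:
  fixes A :: "'r::comm_ring_1 mat"
  assumes A: "A \<in> carrier_mat n n" "upper_triangular A"
  shows "upper_triangular (A ^\<^sub>m k) \<and> (\<forall>i<n. (A ^\<^sub>m k) $$ (i, i) = A $$ (i, i) ^ k)"
proof (induction k)
  case 0
  show ?case using A by auto
next
  case (Suc k)
  have Ak: "A ^\<^sub>m k \<in> carrier_mat n n" using A by simp
  show ?case
    using upper_triangular_mult[OF Ak _ A] Suc by (auto simp: mult.commute simp del: index_mult_mat(1))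
qed

text \<open>Schur triangularisation reduces the claim to a triangular matrix, whose powers have the
  powers of its diagonal entries on the diagonal; diagonalisability is not involved.\<close>

lemma sum_proots_char_poly_power:
  fixes A :: "complex mat"
  assumes A: "A \<in> carrier_mat n n"
  shows "(\<Sum>z\<in>#proots (char_poly A). z ^ k) = tr (A ^\<^sub>m k)"
proof -
  obtain es where es: "mset es = proots (char_poly A)" using ex_mset by blast
  have lc: "lead_coeff (char_poly A) = 1" using degree_monic_char_poly[OF A] by simp
  have cp: "char_poly A = (\<Prod>e\<leftarrow>es. [:- e, 1:])"
    using complex_poly_decompose_multiset[of "char_poly A"] lc
    by (simp add: es[symmetric] prod_mset_prod_list[symmetric])
  obtain B P Q where sd: "schur_decomposition A es = (B, P, Q)" by (cases "schur_decomposition A es") auto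
  from schur_decomposition[OF A cp sd]
  have sim: "similar_mat_wit A B P Q" and ut: "upper_triangular B" and diag: "diag_mat B = es" by auto
  from similar_mat_witD2[OF A sim]
  have PQ: "P * Q = 1\<^sub>m n" "Q * P = 1\<^sub>m n" and AB: "A = P * B * Q"
    and B: "B \<in> carrier_mat n n" and P: "P \<in> carrier_mat n n" and Q: "Q \<in> carrier_mat n n" by auto
  have Bk: "B ^\<^sub>m k \<in> carrier_mat n n" for k using B by simp
  have "A ^\<^sub>m k = P * B ^\<^sub>m k * Q"
    by (rule similar_mat_wit_pow_id[OF sim])
  then have "tr (A ^\<^sub>m k) = tr (Q * (P * B ^\<^sub>m k))"
    using tr_mult_commute[of "P * B ^\<^sub>m k" n n Q] P Q Bk[of k] by simp
  also have "Q * (P * B ^\<^sub>m k) = (Q * P) * B ^\<^sub>m k"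
    by (rule assoc_mult_mat[OF Q P Bk, symmetric])
  also have "\<dots> = B ^\<^sub>m k" unfolding PQ by (rule left_mult_one_mat[OF Bk])
  also have "tr (B ^\<^sub>m k) = (\<Sum>i<n. B $$ (i, i) ^ k)"
    using upper_triangular_pow_diag[OF B ut, of k] B by (simp add: tr_def)
  also have "\<dots> = (\<Sum>z\<leftarrow>diag_mat B. z ^ k)"
    using B by (simp add: diag_mat_def comp_def interv_sum_list_conv_sum_set_nat atLeast0LessThan)
  also have "\<dots> = (\<Sum>z\<in>#proots (char_poly A). z ^ k)"
    unfolding diag es[symmetric] by (simp add: sum_mset_sum_list[symmetric])
  finally show ?thesis by simp
qed

text \<open>For an eigenvector v the eigenvalue times the squared norm of v is the squared norm of A
  v, here called \<open>w\<close>.\<close>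

lemma gram_eigenvalue_nonneg:
  assumes A: "A \<in> carrier_mat n n" and z: "z \<in># proots (char_poly (mat_adjoint A * A))"
  shows "0 \<le> Re z \<and> Im z = 0"
proof -
  let ?H = "mat_adjoint A"
  have H: "?H \<in> carrier_mat n n" by (rule mat_adjoint_carrier[OF A])
  have HA: "?H * A \<in> carrier_mat n n" using H A by simp
  have "char_poly (?H * A) \<noteq> 0" using degree_monic_char_poly[OF HA] by auto
  then have "poly (char_poly (?H * A)) z = 0" using z by simp
  then obtain v where "eigenvector (?H * A) v z"
    using eigenvalue_root_char_poly[OF HA] by (auto simp: eigenvalue_def)
  then have v: "v \<in> carrier_vec n" "v \<noteq> 0\<^sub>v n" "(?H * A) *\<^sub>v v = z \<cdot>\<^sub>v v"
    using H by (auto simp: eigenvector_def)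
  define w where "w j = (\<Sum>i<n. A $$ (j, i) * v $ i)" for j
  have "(\<Sum>l<n. (?H * A) $$ (i, l) * v $ l) = z * v $ i" if "i < n" for i
  proof -
    have "((?H * A) *\<^sub>v v) $ i = (\<Sum>l<n. (?H * A) $$ (i, l) * v $ l)"
      using that v(1) carrier_matD[OF H] carrier_matD[OF A] by (simp add: scalar_prod_def atLeast0LessThan del: index_mult_mat(1))
    then show ?thesis using v that by simp
  qed
  moreover have "(\<Sum>l<n. (?H * A) $$ (i, l) * v $ l) = (\<Sum>j<n. cnj (A $$ (j, i)) * w j)" if "i < n" for i
  proof -
    have "(\<Sum>l<n. (?H * A) $$ (i, l) * v $ l) = (\<Sum>l<n. \<Sum>j<n. cnj (A $$ (j, i)) * A $$ (j, l) * v $ l)"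
      using that by (intro sum.cong refl)
        (simp add: index_mult_sum[OF H A] mat_adjoint_index[OF A] sum_distrib_right del: index_mult_mat(1))
    also have "\<dots> = (\<Sum>j<n. cnj (A $$ (j, i)) * w j)"
      by (subst sum.swap) (simp add: w_def sum_distrib_left mult.assoc)
    finally show ?thesis .
  qed
  ultimately have e: "z * v $ i = (\<Sum>j<n. cnj (A $$ (j, i)) * w j)" if "i < n" for i
    using that by simp
  have "z * of_real (\<Sum>i<n. (cmod (v $ i))\<^sup>2) = (\<Sum>i<n. (z * v $ i) * cnj (v $ i))"
    unfolding of_real_sum complex_norm_square sum_distrib_left by (simp add: mult.assoc)
  also have "\<dots> = (\<Sum>i<n. \<Sum>j<n. w j * cnj (A $$ (j, i) * v $ i))"
    by (intro sum.cong refl) (simp add: e sum_distrib_right sum_distrib_left mult_ac)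
  also have "\<dots> = (\<Sum>j<n. w j * cnj (w j))"
    by (subst sum.swap) (simp add: w_def sum_distrib_left)
  also have "\<dots> = of_real (\<Sum>j<n. (cmod (w j))\<^sup>2)"
    by (simp only: of_real_sum complex_norm_square)
  finally have eq: "z * of_real (\<Sum>i<n. (cmod (v $ i))\<^sup>2) = of_real (\<Sum>j<n. (cmod (w j))\<^sup>2)" .
  have pos: "(\<Sum>i<n. (cmod (v $ i))\<^sup>2) > 0"
  proof -
    obtain i where "i < n" "v $ i \<noteq> 0"
      using v(1,2) by (metis carrier_vecD eq_vecI index_zero_vec(1) index_zero_vec(2))
    then show ?thesis by (intro sum_pos2[of _ i]) auto
  qed
  have nn: "(\<Sum>j<n. (cmod (w j))\<^sup>2) \<ge> 0" by (intro sum_nonneg) auto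
  have "z = of_real ((\<Sum>j<n. (cmod (w j))\<^sup>2) / (\<Sum>i<n. (cmod (v $ i))\<^sup>2))"
    using eq pos by (simp only: of_real_divide nonzero_eq_divide_eq of_real_eq_0_iff less_imp_neq[THEN not_sym] not_False_eq_True)
  then show ?thesis using pos nn by (simp add: divide_nonneg_pos)
qed

lemma size_singular_values:
  assumes A: "A \<in> carrier_mat n n"
  shows "size (singular_values A) = n"
proof -
  have "mat_adjoint A * A \<in> carrier_mat n n" using mat_adjoint_carrier[OF A] A by simp
  from degree_monic_char_poly[OF this] show ?thesis
    by (simp add: singular_values_def size_proots_complex)
qed

lemma singular_values_nonneg:
  assumes A: "A \<in> carrier_mat n n" and s: "s \<in># singular_values A"
  shows "0 \<le> s"
  using s gram_eigenvalue_nonneg[OF A] by (auto simp: singular_values_def)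

lemma even_psum_singular_values:
  assumes A: "A \<in> carrier_mat n n"
  shows "of_real (even_psum k (singular_values A)) = tr ((mat_adjoint A * A) ^\<^sub>m k)"
proof -
  let ?B = "mat_adjoint A * A"
  have B: "?B \<in> carrier_mat n n" using mat_adjoint_carrier[OF A] A by simp
  have "of_real (\<Sum>z\<in>#M. f z) = (\<Sum>z\<in>#M. complex_of_real (f z))" for M :: "complex multiset" and f
    by (induction M) auto
  then have "of_real (even_psum k (singular_values A)) = (\<Sum>z\<in>#proots (char_poly ?B). complex_of_real (sqrt (Re z) ^ (2 * k)))"
    by (simp add: even_psum_def singular_values_def image_mset.compositionality comp_def)
  also have "\<dots> = (\<Sum>z\<in>#proots (char_poly ?B). z ^ k)"
    by (rule arg_cong[where f = sum_mset], rule image_mset_cong)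
      (use gram_eigenvalue_nonneg[OF A] in \<open>simp add: power_mult complex_eq_iff flip: of_real_power\<close>)
  finally show ?thesis unfolding sum_proots_char_poly_power[OF B] .
qed

lemma mat_adjoint_gue_map: "mat_adjoint (gue_map n \<omega>) = gue_map n \<omega>"
proof -
  obtain x y where w: "\<omega> = (x, y)" by (cases \<omega>)
  let ?G = "mat n n (\<lambda>ij. Complex (x ij) (y ij))"
  have G: "?G \<in> carrier_mat n n" by simp
  note c = mat_adjoint_carrier[OF G]
  have m: "gue_map n \<omega> = (1 / 2) \<cdot>\<^sub>m (?G + mat_adjoint ?G)" by (simp add: gue_map_def w Let_def)
  then have mc: "gue_map n \<omega> \<in> carrier_mat n n" using c by simp
  have e: "gue_map n \<omega> $$ (i, j) = 1 / 2 * (Complex (x (i, j)) (y (i, j)) + cnj (Complex (x (j, i)) (y (j, i))))"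
    if "i < n" "j < n" for i j
    using that c G by (simp add: m mat_adjoint_index[OF G])
  show ?thesis
    by (rule eq_matI) (use mc mat_adjoint_carrier[OF mc] in \<open>auto simp: mat_adjoint_index[OF mc] e complex_eq_iff\<close>)
qed

lemma gue_map_carrier: "gue_map n \<omega> \<in> carrier_mat n n"
  unfolding gue_map_eq by simp

lemma pow_mat_pow: "A \<in> carrier_mat n n \<Longrightarrow> (A * A) ^\<^sub>m k = A ^\<^sub>m (2 * k)"
proof (induction k)
  case (Suc k)
  then have "(A * A) ^\<^sub>m Suc k = A ^\<^sub>m (2 * k) * A ^\<^sub>m 2"
    by (simp add: numeral_2_eq_2)
  also have "\<dots> = A ^\<^sub>m (2 * Suc k)"
    using pow_mat_add[OF Suc.prems, of "2 * k" 2] by (simp add: add.commute)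
  finally show ?case .
qed auto

text \<open>A Hermitian matrix has its own square as Gram matrix, so power sums of order k are
  traces of order 2 k; hence the doubled index lists on the GUE side.\<close>

lemma even_psum_gue_map:
  "of_real (even_psum k (singular_values (gue_map n \<omega>))) =
     peval (\<lambda>v. if v \<in> UNIV \<times> {..<n} \<times> {..<n} then of_real (gue_var v \<omega>) else 1) (tr (gue_mat n ^\<^sub>m (2 * k)))"
  unfolding even_psum_singular_values[OF gue_map_carrier] mat_adjoint_gue_map
    pow_mat_pow[OF gue_map_carrier] peval_tr_pow[OF gue_mat_carrier] gue_map_eq[symmetric] ..

lemma even_psum_direct_sum:
  assumes B: "B \<in> carrier_mat p p" and C: "C \<in> carrier_mat q q"
  shows "of_real (even_psum k (singular_values (mat_direct_sum B C))) =
    tr ((mat_adjoint B * B) ^\<^sub>m k) + tr ((mat_adjoint C * C) ^\<^sub>m k)"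
proof -
  let ?D = "four_block_mat B (0\<^sub>m p q) (0\<^sub>m q p) C"
  have D: "mat_direct_sum B C = ?D" using B C by (simp add: mat_direct_sum_def)
  have Dc: "?D \<in> carrier_mat (p + q) (p + q)" using B C by simp
  note B' = mat_adjoint_carrier[OF B] and C' = mat_adjoint_carrier[OF C]
  have adj: "mat_adjoint ?D = four_block_mat (mat_adjoint B) (0\<^sub>m p q) (0\<^sub>m q p) (mat_adjoint C)"
    by (rule eq_matI)
      (use B C B' C' mat_adjoint_carrier[OF Dc] in \<open>auto simp: mat_adjoint_index[OF Dc] mat_adjoint_index[OF B] mat_adjoint_index[OF C]\<close>)
  have "mat_adjoint ?D * ?D = four_block_mat (mat_adjoint B * B) (0\<^sub>m p q) (0\<^sub>m q p) (mat_adjoint C * C)"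
    unfolding adj by (subst mult_four_block_mat[of _ p p _ q _ q]) (use B C B' C' in auto)
  then have "(mat_adjoint ?D * ?D) ^\<^sub>m k = four_block_mat ((mat_adjoint B * B) ^\<^sub>m k) (0\<^sub>m p q) (0\<^sub>m q p) ((mat_adjoint C * C) ^\<^sub>m k)"
    using B B' C C' by (simp add: pow_four_block_mat[of _ p _ q])
  moreover have "tr (four_block_mat X (0\<^sub>m p q) (0\<^sub>m q p) Y) = tr X + tr Y"
    if "X \<in> carrier_mat p p" "Y \<in> carrier_mat q q" for X Y :: "complex mat"
  proof -
    have "(\<Sum>i<p + q. f i) = (\<Sum>i<p. f i) + (\<Sum>i<q. f (p + i))" for f :: "nat \<Rightarrow> complex"
      by (induction q) (auto simp: add.assoc)
    then show ?thesis using that by (simp add: tr_def)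
  qed
  ultimately show ?thesis
    unfolding D even_psum_singular_values[OF Dc] using B C B' C' by simp
qed

text \<open>Dictionary from the running index, odd on the diagonal and even below it, to the 1-based
  matrix positions of the statement.\<close>

definition bidiag_pos :: "nat \<Rightarrow> nat \<times> nat" where
  "bidiag_pos n = (if odd n then ((n + 1) div 2, (n + 1) div 2) else (n div 2 + 1, n div 2))"

lemma bidiag_carrier: "bidiag p x \<in> carrier_mat p p"
  by (simp add: bidiag_def)

lemma bidiag_gram:
  "mat_adjoint (bidiag p x) * bidiag p x =
     map_mat (peval (\<lambda>n. if n \<in> {1..<2 * p} then of_real (x (bidiag_pos n)) else 1)) (gram_mat p)"
proof (rule eq_matI)
  define z where "z = (\<lambda>n. if n \<in> {1..<2 * p} then complex_of_real (x (bidiag_pos n)) else 1)"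
  let ?B = "bidiag p x"
  note B = bidiag_carrier[of p x]
  define X where "X n = (if n \<in> {1..<2 * p} then complex_of_real (x (bidiag_pos n)) else 0)" for n
  have zx: "peval z (xx p (int n)) = X n" for n
    by (auto simp: xx_def X_def z_def)
  have Bij: "?B $$ (i, j) = (if i = j then X (2 * j + 1) else if i = j + 1 then X (2 * j + 2) else 0)" if "i < p" "j < p" for i j
    using that by (auto simp: bidiag_def bidiag_positions_def X_def bidiag_pos_def)
  have cB: "cnj (?B $$ (i, j)) = ?B $$ (i, j)" if "i < p" "j < p" for i j
    using that by (simp add: Bij X_def)
  fix i j assume "i < dim_row (map_mat (peval (\<lambda>n. if n \<in> {1..<2 * p} then of_real (x (bidiag_pos n)) else 1)) (gram_mat p))"
    "j < dim_col (map_mat (peval (\<lambda>n. if n \<in> {1..<2 * p} then of_real (x (bidiag_pos n)) else 1)) (gram_mat p))"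
  then have ij: "i < p" "j < p" by (auto simp: gram_mat_def imat_def)
  have "(mat_adjoint ?B * ?B) $$ (i, j) = (\<Sum>l<p. ?B $$ (l, i) * ?B $$ (l, j))"
    using ij by (simp add: index_mult_sum[OF mat_adjoint_carrier[OF B] B] mat_adjoint_index[OF B] cB del: index_mult_mat(1))
  also have "\<dots> = (\<Sum>l\<in>{i, i + 1} \<inter> {..<p}. ?B $$ (l, i) * ?B $$ (l, j))"
    by (rule sum.mono_neutral_right) (use ij in \<open>auto simp: Bij\<close>)
  also have "\<dots> = peval z (gram p (int i) (int j))"
  proof -
    have zx': "peval z (xx p (2 * int i)) = X (2 * i)" "peval z (xx p (2 * int i + 1)) = X (2 * i + 1)"
      "peval z (xx p (2 * int i + 2)) = X (2 * i + 2)" "peval z (xx p (2 + 2 * int i)) = X (2 * i + 2)" "peval z (xx p (1 + 2 * int i)) = X (2 * i + 1)" "peval z (xx p (2 * int i + 3)) = X (Suc (Suc (Suc (2 * i))))"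
      "peval z (xx p (3 + 2 * int i)) = X (Suc (Suc (Suc (2 * i))))" for i
      using zx[of "2 * i"] zx[of "2 * i + 1"] zx[of "2 * i + 2"] zx[of "2 * i + 3"] by (simp_all add: add.commute numeral_3_eq_3)
    have int_eq: "(int i = int j + 1) = (i = Suc j)" for i j by auto
    have X0: "X 0 = 0" "X (2 * p) = 0" by (auto simp: X_def)
    show ?thesis
    proof (cases "i + 1 < p")
      case True
      then have "{i, i + 1} \<inter> {..<p} = {i, i + 1}" using ij by auto
      then show ?thesis
        using True ij unfolding gram_def
        by (auto simp: Bij int_eq peval.hom_add peval.hom_mult zx' power2_eq_square)
    next
      case False
      then have "{i, i + 1} \<inter> {..<p} = {i}" "X (2 * i + 2) = 0" using ij by (auto simp: X_def)
      then show ?thesis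
        using False ij unfolding gram_def
        by (auto simp: Bij int_eq peval.hom_add peval.hom_mult zx' power2_eq_square)
    qed
  qed
  finally show "(mat_adjoint ?B * ?B) $$ (i, j) =
      map_mat (peval (\<lambda>n. if n \<in> {1..<2 * p} then of_real (x (bidiag_pos n)) else 1)) (gram_mat p) $$ (i, j)"
    unfolding z_def using ij by (simp add: gram_mat_def imat_def)
next
  show "dim_row (mat_adjoint (bidiag p x) * bidiag p x) =
    dim_row (map_mat (peval (\<lambda>n. if n \<in> {1..<2 * p} then of_real (x (bidiag_pos n)) else 1)) (gram_mat p))"
    "dim_col (mat_adjoint (bidiag p x) * bidiag p x) =
    dim_col (map_mat (peval (\<lambda>n. if n \<in> {1..<2 * p} then of_real (x (bidiag_pos n)) else 1)) (gram_mat p))"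
    using mat_adjoint_carrier[OF bidiag_carrier[of p x]] bidiag_carrier[of p x] by (auto simp: gram_mat_def imat_def)
qed

lemma even_psum_bidiag_sum:
  "of_real (even_psum k (singular_values (mat_direct_sum (bidiag p x) (bidiag q y)))) =
    peval (\<lambda>n. if n \<in> {1..<2 * p} then of_real (x (bidiag_pos n)) else 1) (gram_psum p k) +
    peval (\<lambda>n. if n \<in> {1..<2 * q} then of_real (y (bidiag_pos n)) else 1) (gram_psum q k)"
  unfolding even_psum_direct_sum[OF bidiag_carrier bidiag_carrier] bidiag_gram gram_psum_def peval_tr_pow[OF gram_mat_carrier] ..

section \<open>Measurability of matrices and of their power sums\<close>

lemma measurable_mat_borelI:
  assumes "\<And>\<omega>. \<omega> \<in> space M \<Longrightarrow> f \<omega> \<in> carrier_mat n n"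
    and "\<And>i j. i < n \<Longrightarrow> j < n \<Longrightarrow> (\<lambda>\<omega>. f \<omega> $$ (i, j)) \<in> borel_measurable M"
  shows "f \<in> M \<rightarrow>\<^sub>M mat_borel n"
  unfolding mat_borel_def
proof (rule measurable_measure_of)
  fix y assume "y \<in> {{A \<in> carrier_mat n n. A $$ (i, j) \<in> B} | i j B. i < n \<and> j < n \<and> B \<in> sets (borel :: complex measure)}"
  then obtain i j B where ij: "i < n" "j < n" "B \<in> sets (borel :: complex measure)"
    and y: "y = {A \<in> carrier_mat n n. A $$ (i, j) \<in> B}" by blast
  have "f -` y \<inter> space M = (\<lambda>\<omega>. f \<omega> $$ (i, j)) -` B \<inter> space M"
    using assms(1) by (auto simp: y)
  also have "\<dots> \<in> sets M" by (rule measurable_sets[OF assms(2)[OF ij(1,2)] ij(3)])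
  finally show "f -` y \<inter> space M \<in> sets M" .
qed (use assms(1) in auto)

lemma space_mat_borel: "space (mat_borel n) = carrier_mat n n"
  unfolding mat_borel_def by (rule space_measure_of) auto

lemma mat_borel_index_measurable:
  assumes "i < n" "j < n"
  shows "(\<lambda>A. A $$ (i, j)) \<in> borel_measurable (mat_borel n)"
proof (rule measurableI)
  fix B assume B: "B \<in> sets (borel :: complex measure)"
  have "(\<lambda>A. A $$ (i, j)) -` B \<inter> space (mat_borel n) = {A \<in> carrier_mat n n. A $$ (i, j) \<in> B}"
    by (auto simp: space_mat_borel)
  also have "\<dots> \<in> sets (mat_borel n)"
    unfolding mat_borel_def by (rule in_measure_of) (use assms B in auto)
  finally show "(\<lambda>A. A $$ (i, j)) -` B \<inter> space (mat_borel n) \<in> sets (mat_borel n)" .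
qed simp

lemma measurable_mat_mult:
  fixes f g :: "'a \<Rightarrow> complex mat"
  assumes "\<And>\<omega>. \<omega> \<in> space M \<Longrightarrow> f \<omega> \<in> carrier_mat n n" "\<And>\<omega>. \<omega> \<in> space M \<Longrightarrow> g \<omega> \<in> carrier_mat n n"
    and f: "\<And>i j. i < n \<Longrightarrow> j < n \<Longrightarrow> (\<lambda>\<omega>. f \<omega> $$ (i, j)) \<in> borel_measurable M"
    and g: "\<And>i j. i < n \<Longrightarrow> j < n \<Longrightarrow> (\<lambda>\<omega>. g \<omega> $$ (i, j)) \<in> borel_measurable M"
    and ij: "i < n" "j < n"
  shows "(\<lambda>\<omega>. (f \<omega> * g \<omega>) $$ (i, j)) \<in> borel_measurable M"
proof -
  have "(\<lambda>\<omega>. \<Sum>l<n. f \<omega> $$ (i, l) * g \<omega> $$ (l, j)) \<in> borel_measurable M"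
    by (intro borel_measurable_sum borel_measurable_times f g ij) auto
  also have "?this \<longleftrightarrow> (\<lambda>\<omega>. (f \<omega> * g \<omega>) $$ (i, j)) \<in> borel_measurable M"
    by (rule measurable_cong) (simp add: index_mult_sum[OF assms(1,2)] ij del: index_mult_mat(1))
  finally show ?thesis .
qed

text \<open>Individual eigenvalues are never tracked: the power sum is the real part of a trace,
  which is built from the entries by sums, products and conjugation.\<close>

lemma even_psum_singular_values_measurable: "(\<lambda>A. even_psum k (singular_values A)) \<in> borel_measurable (mat_borel n)"
proof -
  have H: "(\<lambda>A. mat_adjoint A $$ (i, j)) \<in> borel_measurable (mat_borel n)" if "i < n" "j < n" for i j
  proof -
    have "(\<lambda>A. cnj (A $$ (j, i))) \<in> borel_measurable (mat_borel n)"
      by (rule measurable_compose[OF mat_borel_index_measurable[OF that(2,1)]])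
        (intro borel_measurable_continuous_onI continuous_intros)
    also have "?this \<longleftrightarrow> (\<lambda>A. mat_adjoint A $$ (i, j)) \<in> borel_measurable (mat_borel n)"
      by (rule measurable_cong) (use that in \<open>auto simp: space_mat_borel mat_adjoint_index[where n = n and m = n]\<close>)
    finally show ?thesis .
  qed
  have cH: "mat_adjoint A \<in> carrier_mat n n" if "A \<in> space (mat_borel n)" for A
    using that by (auto simp: space_mat_borel intro: mat_adjoint_carrier)
  have c: "A \<in> carrier_mat n n" if "A \<in> space (mat_borel n)" for A
    using that by (simp add: space_mat_borel)
  have HA: "(\<lambda>A. (mat_adjoint A * A) $$ (i, j)) \<in> borel_measurable (mat_borel n)" if "i < n" "j < n" for i j
    by (rule measurable_mat_mult[OF cH c H mat_borel_index_measurable that])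
  have cB: "mat_adjoint A * A \<in> carrier_mat n n" if "A \<in> space (mat_borel n)" for A
    using cH[OF that] c[OF that] by simp
  have pow: "(\<lambda>A. ((mat_adjoint A * A) ^\<^sub>m k) $$ (i, j)) \<in> borel_measurable (mat_borel n)" if "i < n" "j < n" for i j
    using that
  proof (induction k arbitrary: i j)
    case 0
    have "(\<lambda>A. (1\<^sub>m n :: complex mat) $$ (i, j)) \<in> borel_measurable (mat_borel n)" by simp
    also have "?this \<longleftrightarrow> (\<lambda>A. ((mat_adjoint A * A) ^\<^sub>m 0) $$ (i, j)) \<in> borel_measurable (mat_borel n)"
      by (rule measurable_cong) (use cH in \<open>auto dest!: carrier_matD(1)\<close>)
    finally show ?case .
  next
    case (Suc k)
    show ?case unfolding pow_mat.simps
      by (rule measurable_mat_mult[OF _ cB Suc.IH HA Suc.prems]) (use cB in auto)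
  qed
  have "(\<lambda>A. Re (\<Sum>i<n. ((mat_adjoint A * A) ^\<^sub>m k) $$ (i, i))) \<in> borel_measurable (mat_borel n)"
    by (intro borel_measurable_sum pow measurable_compose[OF _ borel_measurable_Re]) auto
  also have "?this \<longleftrightarrow> (\<lambda>A. even_psum k (singular_values A)) \<in> borel_measurable (mat_borel n)"
  proof (rule measurable_cong)
    fix A assume A: "A \<in> space (mat_borel n)"
    have "dim_row ((mat_adjoint A * A) ^\<^sub>m k) = n"
      using pow_carrier_mat[OF cB[OF A], of k] by auto
    then have "complex_of_real (even_psum k (singular_values A)) = (\<Sum>i<n. ((mat_adjoint A * A) ^\<^sub>m k) $$ (i, i))"
      unfolding even_psum_singular_values[OF c[OF A]] tr_def by simp
    then show "Re (\<Sum>i<n. ((mat_adjoint A * A) ^\<^sub>m k) $$ (i, i)) = even_psum k (singular_values A)"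
      by (metis Re_complex_of_real)
  qed
  finally show ?thesis .
qed

lemma gue_map_measurable: "gue_map n \<in> normal_matrix n \<Otimes>\<^sub>M normal_matrix n \<rightarrow>\<^sub>M mat_borel n"
proof (rule measurable_mat_borelI[OF gue_map_carrier])
  fix i j assume ij: "i < n" "j < n"
  have m: "(\<lambda>\<omega>. of_real (gue_var v \<omega>) :: complex) \<in> borel_measurable (normal_matrix n \<Otimes>\<^sub>M normal_matrix n)"
    if "v \<in> UNIV \<times> {..<n} \<times> {..<n}" for v
  proof -
    have c: "(\<lambda>x. x (snd v)) \<in> borel_measurable (normal_matrix n)"
      using measurable_component_singleton[of "snd v" "{..<n} \<times> {..<n}" "\<lambda>_. std_normal"] that by auto
    have "(\<lambda>\<omega>. gue_var v \<omega>) \<in> borel_measurable (normal_matrix n \<Otimes>\<^sub>M normal_matrix n)"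
    proof -
      have "(\<lambda>\<omega>. fst \<omega> (snd v)) \<in> borel_measurable (normal_matrix n \<Otimes>\<^sub>M normal_matrix n)"
        by (rule measurable_compose[OF measurable_fst c])
      moreover have "(\<lambda>\<omega>. snd \<omega> (snd v)) \<in> borel_measurable (normal_matrix n \<Otimes>\<^sub>M normal_matrix n)"
        by (rule measurable_compose[OF measurable_snd c])
      ultimately show ?thesis unfolding gue_var_def by (cases "fst v") simp_all
    qed
    then show ?thesis by simp
  qed
  have "gue_map n \<omega> $$ (i, j) = 1 / 2 * (of_real (gue_var (False, i, j) \<omega>) + of_real (gue_var (False, j, i) \<omega>)) +
      \<i> / 2 * (of_real (gue_var (True, i, j) \<omega>) - of_real (gue_var (True, j, i) \<omega>))" for \<omega>
    unfolding gue_map_eq using ij by (simp add: gue_mat_def peval.hom_add peval.hom_mult peval.hom_minus)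
  then show "(\<lambda>\<omega>. gue_map n \<omega> $$ (i, j)) \<in> borel_measurable (normal_matrix n \<Otimes>\<^sub>M normal_matrix n)"
    using ij by (simp only:) (intro borel_measurable_add borel_measurable_times borel_measurable_diff m borel_measurable_const, auto)
qed

section \<open>Moments of the GUE and the associated Hankel sums\<close>

definition gue_weight :: "nat \<Rightarrow> bool \<times> nat \<times> nat \<Rightarrow> nat \<Rightarrow> complex" where
  "gue_weight n v e = (if v \<in> UNIV \<times> {..<n} \<times> {..<n} then of_real (normal_moment e) else 1)"

lemma has_bochner_integral_gue_peval:
  "has_bochner_integral (normal_matrix n \<Otimes>\<^sub>M normal_matrix n)
     (\<lambda>\<omega>. peval (\<lambda>v. if v \<in> UNIV \<times> {..<n} \<times> {..<n} then of_real (gue_var v \<omega>) else 1) f) (expect (gue_weight n) f)"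
  by (rule has_bochner_integral_peval[where m = "\<lambda>_. normal_moment", OF _ has_bochner_integral_gue_monomial])
    (auto simp: gue_weight_def)

lemma of_real_prod_list: "of_real (\<Prod>k\<leftarrow>ks. f k) = (\<Prod>k\<leftarrow>ks. of_real (f k) :: complex)"
  by (induction ks) auto

lemma peval_prod_list: "peval z (\<Prod>k\<leftarrow>ks. f k) = (\<Prod>k\<leftarrow>ks. peval z (f k))"
  by (induction ks) (auto simp: peval.hom_mult)

lemma has_bochner_integral_gue_even_psum:
  "has_bochner_integral (gue n) (\<lambda>A. complex_of_real (\<Prod>k\<leftarrow>ks. even_psum k (singular_values A)))
     (expect (gue_weight n) (\<Prod>k\<leftarrow>map ((*) 2) ks. tr (gue_mat n ^\<^sub>m k)))"
proof -
  let ?P = "normal_matrix n \<Otimes>\<^sub>M normal_matrix n"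
  have m: "(\<lambda>A. complex_of_real (\<Prod>k\<leftarrow>ks. even_psum k (singular_values A))) \<in> borel_measurable (mat_borel n)"
    by (induction ks) (use even_psum_singular_values_measurable in auto)
  have "complex_of_real (\<Prod>k\<leftarrow>ks. even_psum k (singular_values (gue_map n \<omega>))) =
      peval (\<lambda>v. if v \<in> UNIV \<times> {..<n} \<times> {..<n} then of_real (gue_var v \<omega>) else 1) (\<Prod>k\<leftarrow>map ((*) 2) ks. tr (gue_mat n ^\<^sub>m k))" for \<omega>
    unfolding of_real_prod_list even_psum_gue_map peval_prod_list by (simp add: comp_def)
  then have "has_bochner_integral ?P (\<lambda>\<omega>. complex_of_real (\<Prod>k\<leftarrow>ks. even_psum k (singular_values (gue_map n \<omega>))))
     (expect (gue_weight n) (\<Prod>k\<leftarrow>map ((*) 2) ks. tr (gue_mat n ^\<^sub>m k)))"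
    using has_bochner_integral_gue_peval by simp
  then show ?thesis
    unfolding gue_eq has_bochner_integral_iff integral_distr[OF gue_map_measurable m] integrable_distr_eq[OF gue_map_measurable m] .
qed

definition gue_moment :: "nat \<Rightarrow> nat list \<Rightarrow> complex" where
  "gue_moment n ks = expect (gue_weight n) (\<Prod>k\<leftarrow>ks. tr (gue_mat n ^\<^sub>m k))"

lemma gue_recursion_gue_moment: "gue_recursion n (gue_moment n)"
  unfolding gue_moment_def[abs_def]
  by (rule gue_recursion_tr) (auto simp: gue_weight_def normal_moment_rec simp del: add_2_eq_Suc')

lemma gue_moment_Nil: "gue_moment n [] = 1"
  by (simp add: gue_moment_def expect_1 gue_weight_def)

text \<open>The trace of the square has the moments of a chi-squared variable with n^2 degrees of
  freedom. This supplies the growth bound needed for determinacy.\<close>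

lemma gue_moment_replicate_2: "gue_moment n (replicate m 2) = (\<Prod>j<m. of_nat (n\<^sup>2 + 2 * j))"
proof (induction m)
  case (Suc m)
  have "gue_moment n (Suc 1 # replicate m 2) = gue_moment n (0 # 0 # replicate m 2) +
      (\<Sum>j<m. 2 * gue_moment n ((replicate m 2)[j := 2]))"
    using gue_recursion_gue_moment[of n] unfolding gue_recursion_def
    by (simp del: replicate_Suc)
  also have "\<dots> = of_nat (n\<^sup>2 + 2 * m) * gue_moment n (replicate m 2)"
  proof -
    have "gue_moment n (0 # 0 # replicate m 2) = of_nat n * (of_nat n * gue_moment n (replicate m 2))"
    proof -
      have "gue_moment n (0 # ls) = of_nat n * gue_moment n ls" for ls
        using gue_recursion_gue_moment[of n] unfolding gue_recursion_def by blast
      then show ?thesis by simp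
    qed
    moreover have "(replicate m (2::nat))[j := 2] = replicate m 2" for j
      by (cases "j < m") (auto intro!: nth_equalityI simp: nth_list_update)
    ultimately show ?thesis by (simp add: power2_eq_square algebra_simps)
  qed
  finally have "gue_moment n (replicate (Suc m) 2) = of_nat (n\<^sup>2 + 2 * m) * gue_moment n (replicate m 2)"
    by (simp only: replicate_Suc Suc_1)
  also have "\<dots> = (\<Prod>j<Suc m. of_nat (n\<^sup>2 + 2 * j))"
    unfolding Suc prod.lessThan_Suc by (rule mult.commute)
  finally show ?case .
qed (simp add: gue_moment_Nil)

definition cnormal_moment :: "nat \<Rightarrow> complex" where "cnormal_moment e = of_real (normal_moment e)"

lemma cnormal_moment_props: "cnormal_moment 0 = 1" "cnormal_moment (Suc 0) = 0" "odd e \<Longrightarrow> cnormal_moment e = 0" "cnormal_moment (e + 2) = of_nat (e + 1) * cnormal_moment e"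
  by (simp_all add: cnormal_moment_def normal_moment_odd normal_moment_rec del: add_2_eq_Suc')

lemma gue_recursion_hankel: "gue_recursion n (\<lambda>ks. fact n * hankel cnormal_moment n ks)"
  unfolding expect_psum_vdm[where \<nu> = cnormal_moment, OF cnormal_moment_props(1), symmetric]
  by (rule gue_recursion_vdm) (use cnormal_moment_props in auto)

text \<open>Successive even normal moments have ratio 2 e + 1, the moment recursion for
  \<open>a = 1\<close>.\<close>

lemma lue_recursion_hankel_1: "lue_recursion 1 p (\<lambda>ks. fact p * hankel (\<lambda>m. cnormal_moment (2 * m)) p ks)"
proof -
  have 0: "cnormal_moment (2 * 0) = 1" by (simp add: cnormal_moment_props)
  have "lue_recursion (int 1) p (\<lambda>ks. expect (\<lambda>_ m. cnormal_moment (2 * m)) ((\<Prod>k\<leftarrow>ks. psum p k) * (vdm p)\<^sup>2))"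
    by (rule lue_recursion_vdm) (use cnormal_moment_props(1) cnormal_moment_props(4)[of "2 * _"] in \<open>auto simp: algebra_simps\<close>)
  then show ?thesis unfolding expect_psum_vdm[of "\<lambda>m. cnormal_moment (2 * m)", OF 0] by simp
qed

text \<open>Starting at the second normal moment, which is 1, the ratios are 2 e + 3; so the shifted
  sequence is normalised and belongs to \<open>a = 3\<close>.\<close>

lemma lue_recursion_hankel_3: "lue_recursion 3 p (\<lambda>ks. fact p * hankel (\<lambda>m. cnormal_moment (2 * m + 2)) p ks)"
proof -
  have 0: "cnormal_moment (2 * 0 + 2) = 1" using cnormal_moment_props(4)[of 0] by (simp add: cnormal_moment_props)
  have "lue_recursion (int 3) p (\<lambda>ks. expect (\<lambda>_ m. cnormal_moment (2 * m + 2)) ((\<Prod>k\<leftarrow>ks. psum p k) * (vdm p)\<^sup>2))"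
    by (rule lue_recursion_vdm) (use 0 cnormal_moment_props(4)[of "2 * _ + 2"] in \<open>auto simp: algebra_simps\<close>)
  then show ?thesis unfolding expect_psum_vdm[of "\<lambda>m. cnormal_moment (2 * m + 2)", OF 0] by simp
qed

section \<open>Moments of normal and chi variables\<close>

lemma poly_AE_nonzero_std_normal:
  assumes "(P :: real poly) \<noteq> 0"
  shows "AE x in std_normal. poly P x \<noteq> 0"
proof -
  have "finite {x. poly P x = 0}" using assms by (rule poly_roots_finite)
  then have "{x. poly P x = 0} \<in> null_sets lborel" by (rule finite_imp_null_set_lborel)
  then have "AE x in lborel. poly P x \<noteq> 0" by (rule AE_I') auto
  then show ?thesis by (subst AE_density) auto
qed

text \<open>A Hankel matrix of moments is the Gram matrix of the monomials: a null vector would be a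
  nonzero polynomial whose square has integral zero against the normal density.\<close>

lemma hankel_normal_nonzero: "hankel cnormal_moment n [] \<noteq> 0"
proof -
  let ?H = "mat n n (\<lambda>(i, j). normal_moment (i + j))"
  have Hc: "?H \<in> carrier_mat n n" by simp
  interpret prob_space std_normal by (rule prob_space_std_normal)
  have "det ?H \<noteq> 0"
  proof
    assume "det ?H = 0"
    then obtain v where v: "v \<in> carrier_vec n" "v \<noteq> 0\<^sub>v n" "?H *\<^sub>v v = 0\<^sub>v n"
      using det_0_iff_vec_prod_zero[OF Hc] by auto
    define P where "P = (\<Sum>i<n. Polynomial.monom (v $ i) i)"
    have pe: "poly P x = (\<Sum>i<n. v $ i * x ^ i)" for x
      by (simp add: P_def poly_sum poly_monom)
    have row: "(\<Sum>j<n. normal_moment (i + j) * v $ j) = 0" if "i < n" for i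
    proof -
      have "(?H *\<^sub>v v) $ i = (\<Sum>j<n. normal_moment (i + j) * v $ j)"
        using that v(1) by (simp add: scalar_prod_def atLeast0LessThan)
      then show ?thesis using v(3) that by simp
    qed
    have "has_bochner_integral std_normal (\<lambda>x. \<Sum>i<n. \<Sum>j<n. (v $ i * v $ j) * x ^ (i + j)) (\<Sum>i<n. \<Sum>j<n. (v $ i * v $ j) * normal_moment (i + j))"
      by (intro has_bochner_integral_sum has_bochner_integral_mult_right has_bochner_integral_std_normal_power)
    moreover have "(\<Sum>i<n. \<Sum>j<n. (v $ i * v $ j) * x ^ (i + j)) = (poly P x)\<^sup>2" for x
      unfolding pe power2_eq_square sum_product by (simp add: power_add mult_ac)
    moreover have "(\<Sum>i<n. \<Sum>j<n. (v $ i * v $ j) * normal_moment (i + j)) = (\<Sum>i<n. v $ i * (\<Sum>j<n. normal_moment (i + j) * v $ j))"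
      by (simp add: sum_distrib_left mult_ac)
    ultimately have hb: "has_bochner_integral std_normal (\<lambda>x. (poly P x)\<^sup>2) 0"
      by (simp add: row)
    have "AE x in std_normal. (poly P x)\<^sup>2 = 0"
      using hb integral_nonneg_eq_0_iff_AE[of std_normal "\<lambda>x. (poly P x)\<^sup>2"] by (auto simp: has_bochner_integral_iff)
    moreover have "P \<noteq> 0"
    proof -
      obtain i where i: "i < n" "v $ i \<noteq> 0"
        using v(1,2) by (metis carrier_vecD eq_vecI index_zero_vec(1) index_zero_vec(2))
      have "Polynomial.coeff P i = v $ i"
        using i by (simp add: P_def Polynomial.coeff_sum coeff_monom)
      then show ?thesis using i by auto
    qed
    then have "AE x in std_normal. poly P x \<noteq> 0" by (rule poly_AE_nonzero_std_normal)
    ultimately have "AE x in std_normal. False" by eventually_elim simp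
    then show False by (simp add: AE_False)
  qed
  moreover have "of_real (det ?H) = hankel cnormal_moment n []"
    unfolding det_def'[OF Hc] hankel_def of_real_sum atLeast0LessThan
  proof (rule sum.cong[OF refl])
    fix \<tau> assume "\<tau> \<in> {\<tau>. \<tau> permutes {..<n}}"
    then have "\<tau> i < n" if "i < n" for i using permutes_in_image[of \<tau> "{..<n}" i] that by simp
    then have "(\<Prod>i<n. ?H $$ (i, \<tau> i)) = (\<Prod>i<n. normal_moment (i + \<tau> i))"
      by (intro prod.cong) auto
    then show "complex_of_real (of_int (sign \<tau>) * (\<Prod>i<n. ?H $$ (i, \<tau> i))) = of_int (sign \<tau>) * mixed_moment cnormal_moment {..<n} [] (\<lambda>i. i + \<tau> i)"
      by (simp add: cnormal_moment_def)
  qed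
  ultimately show ?thesis by (metis of_real_eq_0_iff)
qed

text \<open>Absolute normal moments. Halved, they are the integrals of x^j against the normal
  density over the positive half line, to which all chi moments reduce.\<close>

definition abs_normal_moment :: "nat \<Rightarrow> real" where
  "abs_normal_moment j = (if even j then normal_moment j else sqrt (2 / pi) * 2 ^ (j div 2) * fact (j div 2))"

lemma abs_normal_moment_rec: "abs_normal_moment (j + 2) = real (j + 1) * abs_normal_moment j"
proof (cases "even j")
  case False
  then obtain k where "j = 2 * k + 1" by (rule oddE)
  then show ?thesis by (simp add: abs_normal_moment_def algebra_simps)
qed (simp add: abs_normal_moment_def normal_moment_rec del: add_2_eq_Suc')

lemma has_bochner_integral_abs_normal_moment:
  "has_bochner_integral lborel (\<lambda>x. std_normal_density x * \<bar>x\<bar> ^ j) (abs_normal_moment j)"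
proof (cases "even j")
  case True
  then obtain k where "j = 2 * k" by (rule evenE)
  then show ?thesis using std_normal_moment_even[of k] by (simp add: abs_normal_moment_def normal_moment_def power_even_abs)
next
  case False
  then obtain k where "j = 2 * k + 1" by (rule oddE)
  then show ?thesis using std_normal_moment_abs_odd[of k] by (simp add: abs_normal_moment_def)
qed

lemma has_bochner_integral_half_normal_moment:
  "has_bochner_integral lborel (\<lambda>x. indicator {0<..} x * (std_normal_density x * x ^ j)) (abs_normal_moment j / 2)"
proof -
  let ?f = "\<lambda>x::real. std_normal_density x * \<bar>x\<bar> ^ j"
  have f: "integrable lborel ?f" "integral\<^sup>L lborel ?f = abs_normal_moment j"
    using has_bochner_integral_abs_normal_moment[of j] by (auto simp: has_bochner_integral_iff)
  have i1: "integrable lborel (\<lambda>x. indicator {0<..} x * ?f x)" and i2: "integrable lborel (\<lambda>x. indicator {..<0} x * ?f x)"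
    using integrable_mult_indicator[OF _ f(1), of "{0<..}"] integrable_mult_indicator[OF _ f(1), of "{..<0}"] by simp_all
  have "(\<integral>x. indicator {..<0} x * ?f x \<partial>lborel) = (\<integral>x. indicator {..<0} (0 + (-1) * x) * ?f (0 + (-1) * x) \<partial>lborel)"
    by (subst lborel_integral_real_affine[where c = "-1" and t = 0]) auto
  also have "\<dots> = (\<integral>x. indicator {0<..} x * ?f x \<partial>lborel)"
    by (rule Bochner_Integration.integral_cong) (auto simp: indicator_def std_normal_density_def)
  finally have sym: "(\<integral>x. indicator {..<0} x * ?f x \<partial>lborel) = (\<integral>x. indicator {0<..} x * ?f x \<partial>lborel)" .
  have "AE x in lborel. x \<noteq> (0::real)" by (rule AE_lborel_singleton)
  then have "integral\<^sup>L lborel ?f = (\<integral>x. indicator {0<..} x * ?f x + indicator {..<0} x * ?f x \<partial>lborel)"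
    by (intro integral_cong_AE) (auto simp: indicator_def elim!: eventually_mono)
  also have "\<dots> = 2 * (\<integral>x. indicator {0<..} x * ?f x \<partial>lborel)"
    using i1 i2 sym by (simp add: Bochner_Integration.integral_add)
  finally have "has_bochner_integral lborel (\<lambda>x. indicator {0<..} x * ?f x) (abs_normal_moment j / 2)"
    using i1 f by (simp add: has_bochner_integral_iff)
  moreover have "indicator {0<..} x * ?f x = indicator {0<..} x * (std_normal_density x * x ^ j)" for x :: real
    by (simp add: indicator_def)
  ultimately show ?thesis by simp
qed

lemma chi_density_nonneg: "0 \<le> chi_density k x"
  by (cases "k = 0") (auto simp: chi_density_def intro!: divide_nonneg_nonneg mult_nonneg_nonneg Gamma_real_nonneg)

text \<open>The chi density is a constant times x^(k - 1) times the normal density on the positive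
  half line. The recursion is thus inherited, and the constant need not be evaluated because the
  total mass is one.\<close>

lemma (in prob_space) chi_moments:
  assumes Z: "distributed M lborel Z (\<lambda>x. ennreal (chi_density k x))" and k: "k \<ge> 1"
  obtains m where "\<And>e. has_bochner_integral M (\<lambda>\<omega>. Z \<omega> ^ e) (m e)" "m 0 = 1" "\<And>e. m (e + 2) = (real k + real e) * m e"
proof -
  define C where "C = sqrt (2 * pi) / (2 powr (real k / 2 - 1) * Gamma (real k / 2))"
  define m where "m e = C * (abs_normal_moment (k - 1 + e) / 2)" for e
  have cd: "chi_density k x * x ^ e = C * (indicator {0<..} x * (std_normal_density x * x ^ (k - 1 + e)))" for x e
    by (auto simp: chi_density_def C_def std_normal_density_def power_add indicator_def)
  have hb: "has_bochner_integral lborel (\<lambda>x. chi_density k x * x ^ e) (m e)" for e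
    unfolding cd m_def by (intro has_bochner_integral_mult_right has_bochner_integral_half_normal_moment)
  have Zm: "has_bochner_integral M (\<lambda>\<omega>. Z \<omega> ^ e) (m e)" for e
    using hb[of e] distributed_integral[OF Z, of "\<lambda>x. x ^ e"] distributed_integrable[OF Z, of "\<lambda>x. x ^ e"]
    by (simp add: has_bochner_integral_iff chi_density_nonneg)
  have "m 0 = 1"
    using Zm[of 0] by (simp add: has_bochner_integral_iff prob_space)
  moreover have "m (e + 2) = (real k + real e) * m e" for e
    using abs_normal_moment_rec[of "k - 1 + e"] k by (simp add: m_def algebra_simps of_nat_diff)
  ultimately show ?thesis using that Zm by blast
qed

lemma has_bochner_integral_peval_mult:
  fixes Z :: "'i \<Rightarrow> 'w \<Rightarrow> real" and W :: "'j \<Rightarrow> 'w \<Rightarrow> real"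
  assumes I: "finite I" and J: "finite J"
    and m: "\<And>e e'. has_bochner_integral P (\<lambda>\<omega>. (\<Prod>i\<in>I. Z i \<omega> ^ e i) * (\<Prod>j\<in>J. W j \<omega> ^ e' j)) ((\<Prod>i\<in>I. m i (e i)) * (\<Prod>j\<in>J. m' j (e' j)))"
    and \<mu>: "\<And>i e. \<mu> i e = (if i \<in> I then of_real (m i e) else 1)" and \<mu>0: "\<And>i. \<mu> i 0 = 1"
    and \<mu>': "\<And>j e. \<mu>' j e = (if j \<in> J then of_real (m' j e) else 1)" and \<mu>'0: "\<And>j. \<mu>' j 0 = 1"
  shows "has_bochner_integral P (\<lambda>\<omega>. peval (\<lambda>i. if i \<in> I then of_real (Z i \<omega>) else 1) f *
      peval (\<lambda>j. if j \<in> J then of_real (W j \<omega>) else 1) g) (expect \<mu> f * expect \<mu>' g)"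
proof -
  show ?thesis
  proof (induction f rule: cpoly_induct)
    case (single mm c)
    show ?case
    proof (induction g rule: cpoly_induct)
      case (single mm' c')
      show ?case
        unfolding peval_single_restrict[OF I] peval_single_restrict[OF J]
          expect_single_restrict[where \<nu> = \<mu> and n = m, OF I \<mu> \<mu>0]
          expect_single_restrict[where \<nu> = \<mu>' and n = m', OF J \<mu>' \<mu>'0]
        using has_bochner_integral_mult_right[where c = "c * c'", OF has_bochner_integral_of_real[OF m[of "Poly_Mapping.lookup mm" "Poly_Mapping.lookup mm'"]]]
        by (simp add: mult_ac)
    next
      case (add g h)
      show ?case using has_bochner_integral_add[OF add] by (simp add: peval_add expect_add algebra_simps)
    qed
  next
    case (add f h)
    show ?case using has_bochner_integral_add[OF add] by (simp add: peval_add expect_add algebra_simps)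
  qed
qed

text \<open>Expansion of a product of sums; \<open>f\<close> and \<open>g\<close> accumulate the
  factors already chosen from each family, and for this reason are generalised in the
  induction.\<close>

lemma has_bochner_integral_conv:
  assumes H: "\<And>f g. has_bochner_integral P (\<lambda>\<omega>. peval (z \<omega>) f * peval (w \<omega>) g) (expect \<mu> f * expect \<mu>' g)"
  shows "has_bochner_integral P (\<lambda>\<omega>. peval (z \<omega>) f * peval (w \<omega>) g * (\<Prod>k\<leftarrow>ks. peval (z \<omega>) (F k) + peval (w \<omega>) (G k)))
    (conv (\<lambda>l. expect \<mu> (f * (\<Prod>k\<leftarrow>l. F k))) (\<lambda>l. expect \<mu>' (g * (\<Prod>k\<leftarrow>l. G k))) ks)"
proof (induction ks arbitrary: f g)
  case Nil
  show ?case using H[of f g] by simp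
next
  case (Cons k ks)
  show ?case
    using has_bochner_integral_add[OF Cons.IH[of "f * F k" g] Cons.IH[of f "g * G k"]]
    by (simp add: peval.hom_mult algebra_simps)
qed

section \<open>Comparison of the two ensembles\<close>

lemma (in prob_space) indep_case_sum_moments:
  fixes X :: "'i \<Rightarrow> 'a \<Rightarrow> real" and Y :: "'j \<Rightarrow> 'a \<Rightarrow> real"
  assumes ind: "indep_vars (\<lambda>_. borel) (case_sum X Y) (A <+> B)" and A: "finite A" and B: "finite B"
    and X: "\<And>i e. i \<in> A \<Longrightarrow> has_bochner_integral M (\<lambda>\<omega>. X i \<omega> ^ e) (m i e)"
    and Y: "\<And>j e. j \<in> B \<Longrightarrow> has_bochner_integral M (\<lambda>\<omega>. Y j \<omega> ^ e) (m' j e)"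
  shows "has_bochner_integral M (\<lambda>\<omega>. (\<Prod>i\<in>A. X i \<omega> ^ e i) * (\<Prod>j\<in>B. Y j \<omega> ^ e' j))
    ((\<Prod>i\<in>A. m i (e i)) * (\<Prod>j\<in>B. m' j (e' j)))"
proof -
  let ?Z = "\<lambda>i \<omega>. case_sum X Y i \<omega> ^ case_sum e e' i"
  have iZ: "indep_vars (\<lambda>_. borel) ?Z (A <+> B)"
    by (rule indep_vars_compose2[OF ind, of "\<lambda>i x. x ^ case_sum e e' i" "\<lambda>_. borel"]) simp
  have hb: "has_bochner_integral M (?Z i) (case_sum (\<lambda>i. m i (e i)) (\<lambda>j. m' j (e' j)) i)" if "i \<in> A <+> B" for i
    using that X Y by auto
  have fin: "finite (A <+> B)" using A B by simp
  have int: "integrable M (?Z i)" if "i \<in> A <+> B" for i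
    using hb[OF that] by (simp only: has_bochner_integral_iff)
  have "has_bochner_integral M (\<lambda>\<omega>. \<Prod>i\<in>A <+> B. ?Z i \<omega>) (\<Prod>i\<in>A <+> B. case_sum (\<lambda>i. m i (e i)) (\<lambda>j. m' j (e' j)) i)"
    unfolding has_bochner_integral_iff
  proof
    show "integrable M (\<lambda>\<omega>. \<Prod>i\<in>A <+> B. ?Z i \<omega>)" by (rule indep_vars_integrable[OF fin iZ int])
    show "(\<integral>\<omega>. (\<Prod>i\<in>A <+> B. ?Z i \<omega>) \<partial>M) = (\<Prod>i\<in>A <+> B. case_sum (\<lambda>i. m i (e i)) (\<lambda>j. m' j (e' j)) i)"
      by (rule trans[OF indep_vars_lebesgue_integral[OF fin iZ int]])
        (auto intro!: prod.cong has_bochner_integral_integral_eq[OF X] has_bochner_integral_integral_eq[OF Y])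
  qed
  then show ?thesis by (simp add: prod.Plus[OF A B] comp_def)
qed

lemma bij_betw_bidiag_pos: "bij_betw bidiag_pos {1..<2 * p} (bidiag_positions p)"
proof (rule bij_betw_imageI)
  show "inj_on bidiag_pos {1..<2 * p}"
  proof (rule inj_onI)
    fix m n assume "bidiag_pos m = bidiag_pos n"
    then show "m = n" by (cases "even m"; cases "even n") (auto simp: bidiag_pos_def elim!: evenE oddE)
  qed
  show "bidiag_pos ` {1..<2 * p} = bidiag_positions p"
  proof (intro equalityI subsetI)
    fix ij assume "ij \<in> bidiag_positions p"
    then consider i where "ij = (i, i)" "1 \<le> i" "i \<le> p" | i where "ij = (i + 1, i)" "1 \<le> i" "i < p"
      by (auto simp: bidiag_positions_def)
    then show "ij \<in> bidiag_pos ` {1..<2 * p}"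
    proof cases
      case (1 i)
      then show ?thesis by (intro image_eqI[of _ _ "2 * i - 1"]) (auto simp: bidiag_pos_def)
    next
      case (2 i)
      then show ?thesis by (intro image_eqI[of _ _ "2 * i"]) (auto simp: bidiag_pos_def)
    qed
  qed (auto simp: bidiag_pos_def bidiag_positions_def elim!: evenE oddE)
qed

lemma (in prob_space) indep_bidiag_moments:
  fixes X Y :: "nat \<times> nat \<Rightarrow> 'a \<Rightarrow> real"
  assumes ind: "indep_vars (\<lambda>_. borel) (case_sum X Y) (bidiag_positions p <+> bidiag_positions q)"
    and X: "\<And>n e. n \<in> {1..<2 * p} \<Longrightarrow> has_bochner_integral M (\<lambda>\<omega>. X (bidiag_pos n) \<omega> ^ e) (m n e)"
    and Y: "\<And>n e. n \<in> {1..<2 * q} \<Longrightarrow> has_bochner_integral M (\<lambda>\<omega>. Y (bidiag_pos n) \<omega> ^ e) (m' n e)"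
  shows "has_bochner_integral M (\<lambda>\<omega>. (\<Prod>n\<in>{1..<2 * p}. X (bidiag_pos n) \<omega> ^ e n) * (\<Prod>n\<in>{1..<2 * q}. Y (bidiag_pos n) \<omega> ^ e' n))
    ((\<Prod>n\<in>{1..<2 * p}. m n (e n)) * (\<Prod>n\<in>{1..<2 * q}. m' n (e' n)))"
proof -
  define g where "g p = inv_into {1..<2 * p} bidiag_pos" for p
  have g: "g p (bidiag_pos n) = n" if "n \<in> {1..<2 * p}" for p n
    unfolding g_def using bij_betw_inv_into_left[OF bij_betw_bidiag_pos that] .
  have g': "g p ij \<in> {1..<2 * p}" "bidiag_pos (g p ij) = ij" if "ij \<in> bidiag_positions p" for p ij
    unfolding g_def using bij_betw_inv_into_right[OF bij_betw_bidiag_pos that]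
      bij_betw_apply[OF bij_betw_inv_into[OF bij_betw_bidiag_pos] that] by auto
  have fin: "finite (bidiag_positions p)" for p
    using bij_betw_finite[OF bij_betw_bidiag_pos[of p]] by simp
  have re: "(\<Prod>ij\<in>bidiag_positions p. h ij (g p ij)) = (\<Prod>n\<in>{1..<2 * p}. h (bidiag_pos n) n)" for h :: "nat \<times> nat \<Rightarrow> nat \<Rightarrow> real" and p
    by (subst prod.reindex_bij_betw[OF bij_betw_bidiag_pos, symmetric]) (simp add: g)
  have "has_bochner_integral M (\<lambda>\<omega>. (\<Prod>ij\<in>bidiag_positions p. X ij \<omega> ^ e (g p ij)) * (\<Prod>ij\<in>bidiag_positions q. Y ij \<omega> ^ e' (g q ij)))
      ((\<Prod>ij\<in>bidiag_positions p. m (g p ij) (e (g p ij))) * (\<Prod>ij\<in>bidiag_positions q. m' (g q ij) (e' (g q ij))))"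
  proof (rule indep_case_sum_moments[OF ind fin fin])
    show "has_bochner_integral M (\<lambda>\<omega>. X ij \<omega> ^ e) (m (g p ij) e)" if "ij \<in> bidiag_positions p" for ij e
      using X[OF g'(1)[OF that], of e] unfolding g'(2)[OF that] .
    show "has_bochner_integral M (\<lambda>\<omega>. Y ij \<omega> ^ e) (m' (g q ij) e)" if "ij \<in> bidiag_positions q" for ij e
      using Y[OF g'(1)[OF that], of e] unfolding g'(2)[OF that] .
  qed
  then show ?thesis
    unfolding re[of "\<lambda>ij n. X ij \<omega> ^ e n" p for \<omega>] re[of "\<lambda>ij n. Y ij \<omega> ^ e' n" q for \<omega>]
      re[of "\<lambda>_ n. m n (e n)" p] re[of "\<lambda>_ n. m' n (e' n)" q] .
qed

lemma (in prob_space) chi_bidiag_moments: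
  fixes X :: "nat \<times> nat \<Rightarrow> 'a \<Rightarrow> real"
  assumes diag: "\<And>i. 1 \<le> i \<Longrightarrow> i \<le> p \<Longrightarrow> distributed M lborel (X (i, i)) (chi_density (2 * (p - i) + a))"
    and sub: "\<And>i. 1 \<le> i \<Longrightarrow> i < p \<Longrightarrow> distributed M lborel (X (i + 1, i)) (chi_density (2 * (p - i)))"
    and a: "a \<ge> 1"
  obtains m where "\<And>n e. n \<in> {1..<2 * p} \<Longrightarrow> has_bochner_integral M (\<lambda>\<omega>. X (bidiag_pos n) \<omega> ^ e) (m n e)"
    "\<And>n. n \<in> {1..<2 * p} \<Longrightarrow> m n 0 = 1"
    "\<And>n e. n \<in> {1..<2 * p} \<Longrightarrow> m n (e + 2) = (of_int (chi_deg p (int a) (int n)) + of_nat e) * m n e"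
proof -
  have "\<exists>m. (\<forall>e. has_bochner_integral M (\<lambda>\<omega>. X (bidiag_pos n) \<omega> ^ e) (m e)) \<and> m 0 = 1 \<and>
      (\<forall>e. m (e + 2) = (of_int (chi_deg p (int a) (int n)) + of_nat e) * m e)" if n: "n \<in> {1..<2 * p}" for n
  proof -
    obtain k where k: "distributed M lborel (X (bidiag_pos n)) (chi_density k)" "k \<ge> 1" "int k = chi_deg p (int a) (int n)"
    proof (cases "odd n")
      case True
      then obtain i where i: "n = 2 * i + 1" by (rule oddE)
      show thesis
        by (rule that[of "2 * (p - (i + 1)) + a"]) (use diag[of "i + 1"] n i a in \<open>auto simp: bidiag_pos_def chi_deg_def\<close>)
    next
      case False
      then obtain i where i: "n = 2 * i" by auto
      show thesis
        by (rule that[of "2 * (p - i)"]) (use sub[of i] n i in \<open>auto simp: bidiag_pos_def chi_deg_def\<close>)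
    qed
    obtain m where "\<And>e. has_bochner_integral M (\<lambda>\<omega>. X (bidiag_pos n) \<omega> ^ e) (m e)" "m 0 = 1"
      "\<And>e. m (e + 2) = (real k + real e) * m e"
      using chi_moments[OF k(1,2)] by blast
    then show ?thesis unfolding k(3)[symmetric] by (intro exI[of _ m]) auto
  qed
  then obtain m where m: "\<And>n. n \<in> {1..<2 * p} \<Longrightarrow> (\<forall>e. has_bochner_integral M (\<lambda>\<omega>. X (bidiag_pos n) \<omega> ^ e) (m n e)) \<and> m n 0 = 1 \<and>
      (\<forall>e. m n (e + 2) = (of_int (chi_deg p (int a) (int n)) + of_nat e) * m n e)"
    by metis
  show ?thesis by (rule that[of m]) (use m in auto)
qed

text \<open>Uniqueness of the solutions of the loop equations identifies both sides with normalised Hankel sums.\<close>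
lemma gue_moment_eq_conv:
  assumes p: "p = (n + 1) div 2" and q: "q = n div 2"
    and \<phi>: "lue_recursion 1 p \<phi>" "\<phi> [] = 1" and \<psi>: "lue_recursion 3 q \<psi>" "\<psi> [] = 1"
  shows "gue_moment n (map ((*) 2) ks) = conv \<phi> \<psi> ks"
proof -
  define h1 where "h1 = hankel (\<lambda>m. cnormal_moment (2 * m)) p"
  define h2 where "h2 = hankel (\<lambda>m. cnormal_moment (2 * m + 2)) q"
  have h1: "h1 l = h1 [] * \<phi> l" for l
    using lue_recursion_unique[OF lue_recursion_hankel_1[of p] \<phi>(1), of l] by (simp add: h1_def \<phi>(2))
  have h2: "h2 l = h2 [] * \<psi> l" for l
    using lue_recursion_unique[OF lue_recursion_hankel_3[of q] \<psi>(1), of l] by (simp add: h2_def \<psi>(2))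
  have par: "hankel cnormal_moment n (map ((*) 2) ks) = conv h1 h2 ks" for ks
    unfolding h1_def h2_def p q by (rule hankel_parity[OF refl refl cnormal_moment_props(3)])
  have "conv h1 h2 ks = conv (\<lambda>l. h1 [] * \<phi> l) (\<lambda>l. h2 [] * \<psi> l) ks"
    unfolding h1[symmetric] h2[symmetric] ..
  also have "\<dots> = h1 [] * h2 [] * conv \<phi> \<psi> ks"
    by (simp add: conv_mult_left conv_mult_right)
  finally have c: "conv h1 h2 ks = h1 [] * h2 [] * conv \<phi> \<psi> ks" .
  \<comment> \<open>The empty list yields the normalisations of the two Laguerre sums; only their
    product has to be nonzero for the final cancellation.\<close>
  have z: "hankel cnormal_moment n [] = h1 [] * h2 []" using par[of "[]"] by simp
  have "gue_moment n l * (fact n * hankel cnormal_moment n []) = fact n * hankel cnormal_moment n l * gue_moment n []" for l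
    by (rule gue_recursion_unique[OF gue_recursion_gue_moment gue_recursion_hankel])
  then have "gue_moment n l * hankel cnormal_moment n [] = hankel cnormal_moment n l" for l
    by (simp add: gue_moment_Nil)
  then have "gue_moment n (map ((*) 2) ks) * hankel cnormal_moment n [] = hankel cnormal_moment n (map ((*) 2) ks)" by simp
  also have "\<dots> = conv \<phi> \<psi> ks * hankel cnormal_moment n []"
    unfolding par c z by (simp only: mult.commute)
  finally show ?thesis using hankel_normal_nonzero[of n] by simp
qed

lemma (in prob_space) has_bochner_integral_bidiag_even_psum:
  fixes X Y :: "nat \<times> nat \<Rightarrow> 'a \<Rightarrow> real"
  assumes p: "p = (n + 1) div 2" and q: "q = n div 2"
    and ind: "indep_vars (\<lambda>_. borel) (case_sum X Y) (bidiag_positions p <+> bidiag_positions q)"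
    and X: "\<And>i. 1 \<le> i \<Longrightarrow> i \<le> p \<Longrightarrow> distributed M lborel (X (i, i)) (chi_density (2 * (p - i) + 1))"
      "\<And>i. 1 \<le> i \<Longrightarrow> i < p \<Longrightarrow> distributed M lborel (X (i + 1, i)) (chi_density (2 * (p - i)))"
    and Y: "\<And>i. 1 \<le> i \<Longrightarrow> i \<le> q \<Longrightarrow> distributed M lborel (Y (i, i)) (chi_density (2 * (q - i) + 3))"
      "\<And>i. 1 \<le> i \<Longrightarrow> i < q \<Longrightarrow> distributed M lborel (Y (i + 1, i)) (chi_density (2 * (q - i)))"
  shows "has_bochner_integral M (\<lambda>\<omega>. complex_of_real (\<Prod>k\<leftarrow>ks. even_psum k (singular_values
      (mat_direct_sum (bidiag p (\<lambda>ij. X ij \<omega>)) (bidiag q (\<lambda>ij. Y ij \<omega>)))))) (gue_moment n (map ((*) 2) ks))"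
proof -
  let ?I = "{1..<2 * p}" and ?J = "{1..<2 * q}"
  obtain m where m: "\<And>n e. n \<in> ?I \<Longrightarrow> has_bochner_integral M (\<lambda>\<omega>. X (bidiag_pos n) \<omega> ^ e) (m n e)"
    "\<And>n. n \<in> ?I \<Longrightarrow> m n 0 = 1"
    "\<And>n e. n \<in> ?I \<Longrightarrow> m n (e + 2) = (of_int (chi_deg p (int 1) (int n)) + of_nat e) * m n e"
    using chi_bidiag_moments[of p X 1, OF X] by blast
  obtain m' where m': "\<And>n e. n \<in> ?J \<Longrightarrow> has_bochner_integral M (\<lambda>\<omega>. Y (bidiag_pos n) \<omega> ^ e) (m' n e)"
    "\<And>n. n \<in> ?J \<Longrightarrow> m' n 0 = 1"
    "\<And>n e. n \<in> ?J \<Longrightarrow> m' n (e + 2) = (of_int (chi_deg q (int 3) (int n)) + of_nat e) * m' n e"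
    using chi_bidiag_moments[of q Y 3, OF Y] by auto
  define \<mu> where "\<mu> n e = (if n \<in> ?I then complex_of_real (m n e) else 1)" for n e
  define \<mu>' where "\<mu>' n e = (if n \<in> ?J then complex_of_real (m' n e) else 1)" for n e
  have 0: "\<mu> i 0 = 1" "\<mu>' i 0 = 1" for i using m(2) m'(2) by (auto simp: \<mu>_def \<mu>'_def)
  let ?z = "\<lambda>\<omega> i. if i \<in> ?I then complex_of_real (X (bidiag_pos i) \<omega>) else 1"
  let ?w = "\<lambda>\<omega> i. if i \<in> ?J then complex_of_real (Y (bidiag_pos i) \<omega>) else 1"
  have H: "has_bochner_integral M (\<lambda>\<omega>. peval (?z \<omega>) f * peval (?w \<omega>) g) (expect \<mu> f * expect \<mu>' g)" for f g
    by (rule has_bochner_integral_peval_mult[OF _ _ indep_bidiag_moments[OF ind m(1) m'(1)] \<mu>_def 0(1) \<mu>'_def 0(2)])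
      auto
  have 1: "lue_recursion 1 p (\<lambda>l. expect \<mu> (\<Prod>k\<leftarrow>l. gram_psum p k))"
  proof (rule lue_recursion_bidiag[where \<mu> = \<mu>, OF 0(1)])
    fix n e assume n: "n \<in> ?I"
    show "\<mu> n (e + 2) = (of_int (chi_deg p 1 (int n)) + of_nat e) * \<mu> n e"
      using m(3)[OF n, of e] n by (simp add: \<mu>_def)
  qed
  have 3: "lue_recursion 3 q (\<lambda>l. expect \<mu>' (\<Prod>k\<leftarrow>l. gram_psum q k))"
  proof (rule lue_recursion_bidiag[where \<mu> = \<mu>', OF 0(2)])
    fix n e assume n: "n \<in> ?J"
    show "\<mu>' n (e + 2) = (of_int (chi_deg q 3 (int n)) + of_nat e) * \<mu>' n e"
      using m'(3)[OF n, of e] n by (simp add: \<mu>'_def)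
  qed
  have "gue_moment n (map ((*) 2) ks) = conv (\<lambda>l. expect \<mu> (\<Prod>k\<leftarrow>l. gram_psum p k)) (\<lambda>l. expect \<mu>' (\<Prod>k\<leftarrow>l. gram_psum q k)) ks"
    by (rule gue_moment_eq_conv[OF p q 1 _ 3]) (simp_all add: expect_1 0)
  then show ?thesis
    using has_bochner_integral_conv[OF H, where f = 1 and g = 1 and ks = ks and F = "gram_psum p" and G = "gram_psum q"]
    unfolding of_real_prod_list even_psum_bidiag_sum by simp
qed

theorem mainTheorem5:
  fixes n p q :: nat
    and M :: "'a measure" and A :: "'a \<Rightarrow> complex mat"
    and N :: "'b measure" and X Y :: "nat \<times> nat \<Rightarrow> 'b \<Rightarrow> real"
  assumes "n \<ge> 1"
    and "p = nat \<lceil>real n / 2\<rceil>" and "q = nat \<lfloor>real n / 2\<rfloor>"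
    and "prob_space M" and "prob_space N"
    and "A \<in> M \<rightarrow>\<^sub>M mat_borel n" and "distr M (mat_borel n) A = gue n"
    and "prob_space.indep_vars N (\<lambda>_. borel) (case_sum X Y)
           (bidiag_positions p <+> bidiag_positions q)"
    and "\<And>i. 1 \<le> i \<Longrightarrow> i \<le> p \<Longrightarrow>
           distributed N lborel (X (i, i)) (chi_density (2 * (p - i) + 1))"
    and "\<And>i. 1 \<le> i \<Longrightarrow> i < p \<Longrightarrow>
           distributed N lborel (X (i + 1, i)) (chi_density (2 * (p - i)))"
    and "\<And>i. 1 \<le> i \<Longrightarrow> i \<le> q \<Longrightarrow>
           distributed N lborel (Y (i, i)) (chi_density (2 * (q - i) + 3))"
    and "\<And>i. 1 \<le> i \<Longrightarrow> i < q \<Longrightarrow>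
           distributed N lborel (Y (i + 1, i)) (chi_density (2 * (q - i)))"
  shows "let S = \<lambda>\<omega>. singular_values (A \<omega>);
             T = \<lambda>\<omega>. singular_values
                   (mat_direct_sum (bidiag p (\<lambda>ij. X ij \<omega>)) (bidiag q (\<lambda>ij. Y ij \<omega>)))
         in S \<in> M \<rightarrow>\<^sub>M mset_borel \<and> T \<in> N \<rightarrow>\<^sub>M mset_borel \<and>
            distr M mset_borel S = distr N mset_borel T"
proof -
  have "real n / 2 = real_of_int (int n) / real_of_int 2" by simp
  then have p: "p = (n + 1) div 2" and q: "q = n div 2"
    unfolding assms(2,3) by (simp_all only: ceiling_divide_eq_div floor_divide_of_int_eq)
  have pq: "p + q = n" using p q by linarith
  define S where "S \<omega> = singular_values (A \<omega>)" for \<omega>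
  define T where "T \<omega> = singular_values (mat_direct_sum (bidiag p (\<lambda>ij. X ij \<omega>)) (bidiag q (\<lambda>ij. Y ij \<omega>)))" for \<omega>
  have cA: "A \<omega> \<in> carrier_mat n n" if "\<omega> \<in> space M" for \<omega>
    using measurable_space[OF assms(6) that] by (simp add: space_mat_borel)
  have cT: "mat_direct_sum (bidiag p x) (bidiag q y) \<in> carrier_mat n n" for x y
    unfolding mat_direct_sum_def pq[symmetric]
    using four_block_carrier_mat[OF bidiag_carrier[of p x] bidiag_carrier[of q y]] by blast
  have T: "has_bochner_integral N (\<lambda>\<omega>. complex_of_real (\<Prod>k\<leftarrow>ks. even_psum k (T \<omega>))) (gue_moment n (map ((*) 2) ks))" for ks
    unfolding T_def by (rule prob_space.has_bochner_integral_bidiag_even_psum[OF assms(5) p q assms(8-12)])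
  have S: "has_bochner_integral M (\<lambda>\<omega>. complex_of_real (\<Prod>k\<leftarrow>ks. even_psum k (S \<omega>))) (gue_moment n (map ((*) 2) ks))" for ks
  proof -
    have m: "(\<lambda>B. complex_of_real (\<Prod>k\<leftarrow>ks. even_psum k (singular_values B))) \<in> borel_measurable (mat_borel n)"
      by (induction ks) (use even_psum_singular_values_measurable in auto)
    show ?thesis
      using has_bochner_integral_gue_even_psum[of n ks]
      unfolding assms(7)[symmetric] has_bochner_integral_iff integral_distr[OF assms(6) m] integrable_distr_eq[OF assms(6) m]
        S_def gue_moment_def .
  qed
  \<comment> \<open>The formal expectations are complex; taking real parts returns to the real
    integrals required for comparison of the laws.\<close>
  have T': "has_bochner_integral N (\<lambda>\<omega>. \<Prod>k\<leftarrow>ks. even_psum k (T \<omega>)) (Re (gue_moment n (map ((*) 2) ks)))" for ks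
    using has_bochner_integral_bounded_linear[OF bounded_linear_Re T] by simp
  have S': "has_bochner_integral M (\<lambda>\<omega>. \<Prod>k\<leftarrow>ks. even_psum k (S \<omega>)) (Re (gue_moment n (map ((*) 2) ks)))" for ks
    using has_bochner_integral_bounded_linear[OF bounded_linear_Re S] by simp
  \<comment> \<open>Each factor n^2 + 2 j is at most (n^2 + 2) (j + 1), and the second factors
    multiply to the factorial.\<close>
  have C: "(\<integral>\<omega>. even_psum 1 (S \<omega>) ^ m \<partial>M) \<le> (real (n\<^sup>2 + 2)) ^ m * fact m" for m
  proof -
    have "(\<integral>\<omega>. even_psum 1 (S \<omega>) ^ m \<partial>M) = Re (gue_moment n (replicate m 2))"
      using S'[of "replicate m 1"] by (simp add: has_bochner_integral_iff map_replicate prod_list_replicate)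
    also have "\<dots> = (\<Prod>j<m. real (n\<^sup>2 + 2 * j))"
      unfolding gue_moment_replicate_2 of_nat_prod[symmetric] by (simp only: complex_Re_of_nat)
    also have "\<dots> \<le> (\<Prod>j<m. real (n\<^sup>2 + 2) * real (Suc j))"
      by (intro prod_mono conjI of_nat_0_le_iff) (simp add: algebra_simps)
    also have "\<dots> = (real (n\<^sup>2 + 2)) ^ m * fact m"
      by (simp add: prod.distrib fact_prod_Suc atLeast0LessThan)
    finally show ?thesis .
  qed
  have "S \<in> M \<rightarrow>\<^sub>M mset_borel \<and> T \<in> N \<rightarrow>\<^sub>M mset_borel \<and> distr M mset_borel S = distr N mset_borel T"
  proof (intro conjI)
    note * = mset_distr_eqI[where C = "real (n\<^sup>2 + 2)" and S = S and T = T, OF assms(4,5,1)]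
    have sS: "size (S \<omega>) = n" "\<And>s. s \<in># S \<omega> \<Longrightarrow> 0 \<le> s" if "\<omega> \<in> space M" for \<omega>
      unfolding S_def using size_singular_values[OF cA[OF that]] singular_values_nonneg[OF cA[OF that]] by auto
    have sT: "size (T \<omega>) = n" "\<And>s. s \<in># T \<omega> \<Longrightarrow> 0 \<le> s" for \<omega>
      unfolding T_def using size_singular_values[OF cT] singular_values_nonneg[OF cT] by auto
    have i: "integrable M (\<lambda>\<omega>. \<Prod>k\<leftarrow>ks. even_psum k (S \<omega>))" "integrable N (\<lambda>\<omega>. \<Prod>k\<leftarrow>ks. even_psum k (T \<omega>))"
      "(\<integral>\<omega>. (\<Prod>k\<leftarrow>ks. even_psum k (S \<omega>)) \<partial>M) = (\<integral>\<omega>. (\<Prod>k\<leftarrow>ks. even_psum k (T \<omega>)) \<partial>N)" for ks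
      using S'[of ks] T'[of ks] by (auto simp: has_bochner_integral_iff)
    show "S \<in> M \<rightarrow>\<^sub>M mset_borel" by (rule *(1)[OF sS sT i _ C]) auto
    show "T \<in> N \<rightarrow>\<^sub>M mset_borel" by (rule *(2)[OF sS sT i _ C]) auto
    show "distr M mset_borel S = distr N mset_borel T" by (rule *(3)[OF sS sT i _ C]) auto
  qed
  then show ?thesis unfolding S_def[abs_def] T_def[abs_def] Let_def .
qed

end
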